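(* Let $N \in \mathbb{N}$, $1 \leq p < \infty$, and let $w:\mathbb{R}^N \to (0,\infty)$ be a continuous weight with $w(x)=w(-x)$ for all $x\in\mathbb{R}^N$ and $$\sup_{x\in\mathbb{R}^N} \frac{(1+|x|)^m}{w(x)} < \infty \quad \text{for all } m\in\mathbb{N}.$$ $1^\circ$. Let $N=1$. There exists a Schauder basis $(e_n)_{n=1}^\infty$ of the Banach space $L^p_w(\mathbb{R})$ with the following property: for every $m\in\mathbb{N}$ there exist $n_m\in\mathbb{N}$ and a constant $C>0$ such that every $f=\sum_{n=1}^\infty f_n e_n \in L^p_w(\mathbb{R})$ with $f_n=0$ for all $n=1,\ldots,n_m$ satisfies $$\| e^{t\Delta} f\|_\infty \leq \frac{C}{t^m}\,\|f\|_{p,w}\quad\text{for all } t\geq 1.$$ $2^\circ$. Let $N>1$. There exists a continuous weight $\tilde w:\mathbb{R}^N\to(0,\infty)$ with $\tilde w(x)=\tilde w(-x)$ for all $x$ and $\sup_{x\in\mathbb{R}^N}(1+|x|)^m/\tilde w(x)<\infty$ for all $m\in\mathbb{N}$, such that $L^p_w(\mathbb{R}^N)\subset L^1_{\tilde w}(\mathbb{R}^N)$ and such that the space $L^1_{\tilde w}(\mathbb{R}^N)$ has a Schauder basis $(e_n)_{n=1}^\infty$ with the following property: for every $m\in\mathbb{N}$ there exist $n_m\in\mathbb{N}$ and a constant $C>0$ such that every $f=\sum_{n=1}^\infty f_n e_n\in L^1_{\tilde w}(\mathbb{R}^N)$ with $f_n=0$ for all $n=1,\ldots,n_m$ satisfies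 $$\| e^{t\Delta} f\|_\infty \leq \frac{C}{t^m}\,\|f\|_{1,\tilde w}\quad\text{for all } t\geq 1.$$
   Context: For a weight $w$ on $\mathbb{R}^N$ and $1\le p<\infty$, $L^p_w(\mathbb{R}^N)$ is the weighted Lebesgue space with norm $\|f\|_{p,w}=\big(\int_{\mathbb{R}^N}|f(x)|^p w(x)\,dx\big)^{1/p}$ (the weight enters as a density, not raised to the power $p$). Scalars are $\mathbb{K}=\mathbb{R}$ or $\mathbb{C}$. Under the stated conditions on the weights, $L^p_w(\mathbb{R}^N)\subset L^1(\mathbb{R}^N)$. For $f\in L^1(\mathbb{R}^N)$ and $t>0$, $e^{t\Delta}f$ denotes the solution at time $t$ of the heat equation $\partial_t u=\Delta u$, $u(\cdot,0)=f$, on $\mathbb{R}^N$, i.e. $$e^{t\Delta}f(x)=\frac{1}{(4\pi t)^{N/2}}\int_{\mathbb{R}^N}e^{-|x-y|^2/(4t)}f(y)\,dy .$$ $\|\cdot\|_\infty$ is the sup-norm on $\mathbb{R}^N$. A sequence $(e_n)_{n=1}^\infty$ in a Banach space $X$ is a Schauder basis if every $f\in X$ can be written as a norm-convergent series $f=\sum_{n=1}^\infty f_ne_n$ with uniquely determined scalars $f_n$. *)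

theory Defs
  imports "HOL-Analysis.Analysis"
begin

text \<open>
  The space \<open>\<real>\<^sup>N\<close> is rendered by a type \<open>'a :: euclidean_space\<close> with \<open>N = DIM('a)\<close>, so that
  \<open>N = 1\<close> includes the type \<open>real\<close> itself. The scalar field is a type \<open>'k\<close>,
  to be instantiated with \<open>real\<close> and with \<open>complex\<close>.
\<close>

definition admissible_weight :: "('a::euclidean_space \<Rightarrow> real) \<Rightarrow> bool" where
  "admissible_weight w \<longleftrightarrow>
     continuous_on UNIV w \<and>
     (\<forall>x. 0 < w x) \<and>
     (\<forall>x. w (- x) = w x) \<and>
     (\<forall>m::nat. bdd_above (range (\<lambda>x. (1 + norm x) ^ m / w x)))"

text \<open>
  Elements of \<open>L\<^sup>p\<^sub>w\<close> are represented by Lebesgue measurable functions rather than by classes modulo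
  a.e. equality. All notions below depend on a function only through its a.e. class.
\<close>

definition Lpw :: "real \<Rightarrow> ('a::euclidean_space \<Rightarrow> real) \<Rightarrow> ('a \<Rightarrow> 'k::real_normed_field) set" where
  "Lpw p w = {f \<in> borel_measurable lebesgue. integrable lebesgue (\<lambda>x. norm (f x) powr p * w x)}"

definition Lpw_norm :: "real \<Rightarrow> ('a::euclidean_space \<Rightarrow> real) \<Rightarrow> ('a \<Rightarrow> 'k::real_normed_field) \<Rightarrow> real" where
  "Lpw_norm p w f = (LINT x|lebesgue. norm (f x) powr p * w x) powr (1 / p)"

text \<open>
  \<open>Lpw_expansion p w e f c\<close>: the series with terms \<open>c n \<cdot> e n\<close> converges to \<open>f\<close> in the norm of \<open>L\<^sup>p\<^sub>w\<close>.
  Sequences are indexed from \<open>0\<close>: \<open>e n\<close> is the basis vector usually written with index \<open>n + 1\<close>.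
\<close>

definition Lpw_expansion ::
  "real \<Rightarrow> ('a::euclidean_space \<Rightarrow> real) \<Rightarrow> (nat \<Rightarrow> 'a \<Rightarrow> 'k::real_normed_field) \<Rightarrow> ('a \<Rightarrow> 'k) \<Rightarrow> (nat \<Rightarrow> 'k) \<Rightarrow> bool" where
  "Lpw_expansion p w e f c \<longleftrightarrow>
     (\<lambda>n. Lpw_norm p w (\<lambda>x. f x - (\<Sum>k<n. c k * e k x))) \<longlonglongrightarrow> 0"

definition schauder_basis_Lpw ::
  "real \<Rightarrow> ('a::euclidean_space \<Rightarrow> real) \<Rightarrow> (nat \<Rightarrow> 'a \<Rightarrow> 'k::real_normed_field) \<Rightarrow> bool" where
  "schauder_basis_Lpw p w e \<longleftrightarrow>
     (\<forall>n. e n \<in> Lpw p w) \<and> (\<forall>f\<in>Lpw p w. \<exists>!c. Lpw_expansion p w e f c)"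

definition heat :: "real \<Rightarrow> ('a::euclidean_space \<Rightarrow> 'k) \<Rightarrow> 'a \<Rightarrow> 'k::{real_normed_field, banach, second_countable_topology}" where
  "heat t f x = (1 / (4 * pi * t) powr (real DIM('a) / 2)) *\<^sub>R
     (LINT y|lebesgue. exp (- (norm (x - y))\<^sup>2 / (4 * t)) *\<^sub>R f y)"

text \<open>Extended real valued, since a real supremum has no meaningful value on an unbounded function.\<close>

definition sup_norm :: "('a \<Rightarrow> 'k::real_normed_vector) \<Rightarrow> ereal" where
  "sup_norm g = (SUP x. ereal (norm (g x)))"

definition heat_decay_property ::
  "real \<Rightarrow> ('a::euclidean_space \<Rightarrow> real) \<Rightarrow> (nat \<Rightarrow> 'a \<Rightarrow> 'k::{real_normed_field, banach, second_countable_topology}) \<Rightarrow> bool" where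
  "heat_decay_property p w e \<longleftrightarrow>
     (\<forall>m::nat. \<exists>n\<^sub>m::nat. \<exists>C::real. C > 0 \<and>
       (\<forall>f\<in>Lpw p w. \<forall>c. Lpw_expansion p w e f c \<and> (\<forall>n<n\<^sub>m. c n = 0) \<longrightarrow>
         (\<forall>t::real. t \<ge> 1 \<longrightarrow> sup_norm (heat t f) \<le> ereal (C / t ^ m * Lpw_norm p w f))))"

end

theory Submission
  imports Defs "HOL-Library.Function_Algebras" "HOL-Library.Nat_Bijection"
begin

text \<open>
  If the moments of \<open>f\<close> of order less than \<open>2 m\<close> vanish, a Taylor expansion of the heat kernel
  \<open>exp (- |x - y|\<^sup>2 / (4 t))\<close> in \<open>y\<close> gives \<open>|e\<^sup>t\<^sup>\<Delta> f| \<le> C t\<^sup>-\<^sup>m \<integral> |y|\<^sup>2\<^sup>m |f(y)| dy\<close>. So it suffices to find a basis for which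
  every moment functional is a finite linear combination of coordinate functionals.

  Start from a generalised Haar system. In \<open>L\<^sup>p\<^sub>w\<close>, whose elements are written as \<open>h g\<close> with \<open>g\<close> in \<open>L\<^sup>p\<close> of
  a finite measure, its partial sums are conditional expectations, hence contractions. A moment
  functional is integration of \<open>g\<close> against a continuous function vanishing at infinity. Such a function is
  a uniform limit of step functions, because the cells of the system are dyadic cubes in a
  compactification of \<open>\<real>\<^sup>N\<close>; therefore a moment functional is a norm limit of finite combinations of
  coordinate functionals. A small triangular perturbation of the basis, one coordinate at a time,
  replaces the limits by equalities. This works for all \<open>N\<close> and \<open>p\<close>; for \<open>N > 1\<close> it is applied to
  the weight \<open>w\<^sup>1\<^sup>/\<^sup>(\<^sup>2\<^sup>p\<^sup>)\<close> and exponent \<open>1\<close>.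
\<close>

section \<open>Perturbation of bases\<close>

text \<open>Approximating the moment functionals in norm is the delicate point when
  \<open>p = 1\<close>: the coordinate functionals of the Haar system are step functions in
  \<open>L^\<infinity>\<close>, where they do not span a dense subspace, so the continuity of the
  moment weights up to infinity has to do what duality would give for \<open>p > 1\<close>. Cells
  that reach out to infinity are needed for this, since finitely many bounded cells never cover the
  space.

  The system is perturbed by operators of rank one and square zero, whose inverses are explicit.
  Step number j settles the j-th functional and leaves alone all coordinates on which the earlier
  functionals depend; hence each vector changes only finitely often and earlier relations persist.

  Functions are not identified modulo null sets, so this takes place in a seminormed space.
  Coefficients are unique nevertheless, because bounded functionals do not see functions of seminorm
  zero.

  Moments up to order 2 m rather than m have to vanish because the Taylor remainder is a power of
  \<open>norm y / sqrt t\<close>.\<close>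

locale seminormed_space = vector_space scale
  for scale :: "'k::real_normed_field \<Rightarrow> 'v::ab_group_add \<Rightarrow> 'v" (infixr "\<odot>" 75) +
  fixes X :: "'v set" and N :: "'v \<Rightarrow> real"
  assumes subspace_X: "subspace X"
    and N_add: "\<And>f g. f \<in> X \<Longrightarrow> g \<in> X \<Longrightarrow> N (f + g) \<le> N f + N g"
    and N_scale: "\<And>c f. f \<in> X \<Longrightarrow> N (c \<odot> f) = norm c * N f"
begin

lemmas X_0 = subspace_0[OF subspace_X]
  and X_add = subspace_add[OF subspace_X]
  and X_diff = subspace_diff[OF subspace_X]
  and X_scale = subspace_scale[OF subspace_X]
  and X_sum = subspace_sum[OF subspace_X]

lemma N_0: "N 0 = 0"
  using N_scale[OF X_0, of 0] by simp

lemma N_minus: "f \<in> X \<Longrightarrow> N (- f) = N f"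
  using N_scale[of f "-1"] by simp

lemma N_nonneg: "f \<in> X \<Longrightarrow> 0 \<le> N f"
  using N_add[of f "- f"] N_0 N_minus[of f] subspace_neg[OF subspace_X] by simp

lemma N_diff: "f \<in> X \<Longrightarrow> g \<in> X \<Longrightarrow> N (f - g) \<le> N f + N g"
  using N_add[of f "- g"] N_minus[of g] subspace_neg[OF subspace_X] by simp

text \<open>Linearity is asked for on \<open>X\<close> only: the functionals are built from Bochner
  integrals, which are additive only on integrable functions.\<close>

definition bounded_functional :: "('v \<Rightarrow> 'k) \<Rightarrow> bool" where
  "bounded_functional \<phi> \<longleftrightarrow>
     (\<forall>f\<in>X. \<forall>g\<in>X. \<phi> (f + g) = \<phi> f + \<phi> g) \<and> (\<forall>c. \<forall>f\<in>X. \<phi> (c \<odot> f) = c * \<phi> f) \<and>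
     (\<exists>B. \<forall>f\<in>X. norm (\<phi> f) \<le> B * N f)"

lemma bounded_functional_add:
  "bounded_functional \<phi> \<Longrightarrow> f \<in> X \<Longrightarrow> g \<in> X \<Longrightarrow> \<phi> (f + g) = \<phi> f + \<phi> g"
  and bounded_functional_scale:
  "bounded_functional \<phi> \<Longrightarrow> f \<in> X \<Longrightarrow> \<phi> (c \<odot> f) = c * \<phi> f"
  by (auto simp: bounded_functional_def)

lemma bounded_functional_diff:
  "bounded_functional \<phi> \<Longrightarrow> f \<in> X \<Longrightarrow> g \<in> X \<Longrightarrow> \<phi> (f - g) = \<phi> f - \<phi> g"
  using bounded_functional_add[of \<phi> "f - g" g] X_diff[of f g] by simp

lemma bounded_functional_0: "bounded_functional \<phi> \<Longrightarrow> \<phi> 0 = 0"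
  using bounded_functional_diff[of \<phi> 0 0] X_0 by simp

lemma bounded_functional_sum:
  assumes "bounded_functional \<phi>" "\<And>i. i \<in> I \<Longrightarrow> g i \<in> X"
  shows "\<phi> (\<Sum>i\<in>I. g i) = (\<Sum>i\<in>I. \<phi> (g i))"
  using assms(2)
proof (induction I rule: infinite_finite_induct)
  case (insert x F)
  then show ?case
    using bounded_functional_add[OF assms(1), of "g x" "sum g F"] X_sum[of F g] by simp
qed (auto simp: bounded_functional_0[OF assms(1)])

lemma bounded_functional_bound:
  assumes "bounded_functional \<phi>"
  obtains B where "B \<ge> 0" "\<And>f. f \<in> X \<Longrightarrow> norm (\<phi> f) \<le> B * N f"
proof -
  obtain B where B: "\<forall>f\<in>X. norm (\<phi> f) \<le> B * N f"
    using assms by (auto simp: bounded_functional_def)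
  have "norm (\<phi> f) \<le> max 0 B * N f" if "f \<in> X" for f
    using B[rule_format, OF that] mult_right_mono[of B "max 0 B" "N f"] N_nonneg[OF that] by linarith
  then show ?thesis using that[of "max 0 B"] by auto
qed

definition partial_sum :: "(nat \<Rightarrow> 'v) \<Rightarrow> (nat \<Rightarrow> 'v \<Rightarrow> 'k) \<Rightarrow> nat \<Rightarrow> 'v \<Rightarrow> 'v" where
  "partial_sum b a n f = (\<Sum>k<n. a k f \<odot> b k)"

text \<open>\<open>C\<close> is the basis constant. Density of the span is left out on purpose; it
  is carried through the perturbations by a different device, namely that the original basis vectors
  stay fixed under the new partial sums.\<close>

definition basic_system :: "(nat \<Rightarrow> 'v) \<Rightarrow> (nat \<Rightarrow> 'v \<Rightarrow> 'k) \<Rightarrow> real \<Rightarrow> bool" where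
  "basic_system b a C \<longleftrightarrow>
     (\<forall>i. b i \<in> X) \<and> (\<forall>i. bounded_functional (a i)) \<and> (\<forall>i j. a i (b j) = of_bool (i = j)) \<and>
     (\<forall>n. \<forall>f\<in>X. N (partial_sum b a n f) \<le> C * N f)"

text \<open>\<open>\<phi> \<circ> partial_sum b a n\<close> is the combination of the first
  \<open>n\<close> functionals \<open>a k\<close> with coefficients \<open>\<phi> (b k)\<close>. So
  \<open>\<phi>\<close> is required to be a limit of such combinations in the norm of functionals:
  \<open>n\<^sub>0\<close> does not depend on \<open>f\<close>.\<close>

definition tail_small :: "(nat \<Rightarrow> 'v) \<Rightarrow> (nat \<Rightarrow> 'v \<Rightarrow> 'k) \<Rightarrow> ('v \<Rightarrow> 'k) \<Rightarrow> bool" where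
  "tail_small b a \<phi> \<longleftrightarrow>
     (\<forall>\<epsilon>>0. \<exists>n\<^sub>0. \<forall>n\<ge>n\<^sub>0. \<forall>f\<in>X. norm (\<phi> (f - partial_sum b a n f)) \<le> \<epsilon> * N f)"

lemma partial_sum_in: "(\<And>i. b i \<in> X) \<Longrightarrow> partial_sum b a n f \<in> X"
  unfolding partial_sum_def by (intro X_sum X_scale) auto

lemma partial_sum_add:
  "(\<And>i. bounded_functional (a i)) \<Longrightarrow> f \<in> X \<Longrightarrow> g \<in> X \<Longrightarrow>
   partial_sum b a n (f + g) = partial_sum b a n f + partial_sum b a n g"
  by (simp add: partial_sum_def bounded_functional_add scale_left_distrib sum.distrib)

lemma partial_sum_scale:
  "(\<And>i. bounded_functional (a i)) \<Longrightarrow> f \<in> X \<Longrightarrow>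
   partial_sum b a n (c \<odot> f) = c \<odot> partial_sum b a n f"
  by (simp add: partial_sum_def bounded_functional_scale scale_sum_right)

lemma partial_sum_diff:
  assumes "\<And>i. bounded_functional (a i)" "f \<in> X" "g \<in> X"
  shows "partial_sum b a n (f - g) = partial_sum b a n f - partial_sum b a n g"
  using partial_sum_add[OF assms(1) X_diff[OF assms(2,3)] assms(3), where b=b and n=n] by simp

lemma partial_sum_sum:
  assumes "\<And>i. bounded_functional (a i)" "\<And>i. i \<in> I \<Longrightarrow> g i \<in> X"
  shows "partial_sum b a n (\<Sum>i\<in>I. g i) = (\<Sum>i\<in>I. partial_sum b a n (g i))"
proof -
  have "partial_sum b a n (\<Sum>i\<in>I. g i) = (\<Sum>k<n. \<Sum>i\<in>I. a k (g i) \<odot> b k)"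
    using assms by (simp add: partial_sum_def bounded_functional_sum scale_sum_left)
  also have "\<dots> = (\<Sum>i\<in>I. \<Sum>k<n. a k (g i) \<odot> b k)"
    by (rule sum.swap)
  finally show ?thesis by (simp add: partial_sum_def)
qed

context
  fixes b a C
  assumes sys: "basic_system b a C"
begin

lemma basic_in: "b i \<in> X"
  and basic_functional: "bounded_functional (a i)"
  and basic_biorth: "a i (b j) = of_bool (i = j)"
  and basic_bound: "f \<in> X \<Longrightarrow> N (partial_sum b a n f) \<le> C * N f"
  using sys by (auto simp: basic_system_def)

lemma partial_sum_basic: "partial_sum b a n (b i) = (if i < n then b i else 0)"
proof -
  have "partial_sum b a n (b i) = (\<Sum>k<n. if k = i then b k else 0)"
    unfolding partial_sum_def by (rule sum.cong) (auto simp: basic_biorth)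
  then show ?thesis by simp
qed

lemma partial_sum_partial_sum:
  assumes "f \<in> X"
  shows "partial_sum b a m (partial_sum b a n f) = partial_sum b a (min m n) f"
proof -
  have "partial_sum b a m (partial_sum b a n f) = (\<Sum>k<n. a k f \<odot> partial_sum b a m (b k))"
    unfolding partial_sum_def[of b a n]
    by (subst partial_sum_sum)
       (auto simp: basic_functional basic_in X_scale partial_sum_scale intro!: sum.cong)
  also have "\<dots> = (\<Sum>k\<in>{..<n} \<inter> {..<m}. a k f \<odot> b k)"
    by (rule sum.mono_neutral_cong_right) (auto simp: partial_sum_basic)
  also have "{..<n} \<inter> {..<m} = {..<min m n}" by auto
  finally show ?thesis by (simp add: partial_sum_def)
qed

end

lemma basic_system_mono: "basic_system b a C \<Longrightarrow> C \<le> C' \<Longrightarrow> basic_system b a C'"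
  unfolding basic_system_def by (meson N_nonneg mult_right_mono order_trans)

text \<open>If \<open>\<phi> (b k) \<noteq> 0\<close>, then \<open>\<phi>\<close> becomes a finite combination of coordinate functionals once the functional
  \<open>\<Lambda> = (\<phi> - \<phi> \<circ> P m') / \<phi> (b k)\<close>, small for large \<open>m'\<close>, is added to \<open>a k\<close>. The new system is the image of
  the old one under the inverse of \<open>f \<mapsto> f + \<Lambda> f \<odot> b k\<close>. The vectors \<open>v i\<close> are the original basis: keeping
  them fixed keeps the spans, hence density, in the limit.\<close>

lemma perturbation_step:
  fixes v :: "nat \<Rightarrow> 'v" and \<Phi> :: "('v \<Rightarrow> 'k) set"
  assumes sys: "basic_system b a C" and C: "0 < C" "C < C'"
    and v: "\<And>i. v i \<in> X" "\<And>n i. i < n \<Longrightarrow> partial_sum b a n (v i) = v i"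
    and \<Phi>: "\<And>\<psi>. \<psi> \<in> \<Phi> \<Longrightarrow> bounded_functional \<psi>" "\<And>\<psi>. \<psi> \<in> \<Phi> \<Longrightarrow> tail_small b a \<psi>"
    and \<phi>: "\<phi> \<in> \<Phi>"
  shows "\<exists>b' a' m'. m < m' \<and> (\<forall>k<m. b' k = b k \<and> a' k = a k) \<and> basic_system b' a' C' \<and>
     (\<forall>n. \<forall>i<n. partial_sum b' a' n (v i) = v i) \<and> (\<forall>\<psi>\<in>\<Phi>. tail_small b' a' \<psi>) \<and>
     (\<forall>f\<in>X. (\<forall>k<m'. a' k f = 0) \<longrightarrow> \<phi> f = 0)"
proof (cases "\<forall>k\<ge>m. \<phi> (b k) = 0")
  \<comment> \<open>Here \<open>\<phi> (partial_sum b a n f)\<close> involves only the first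
    \<open>m\<close> coordinates, so the old system already works. \<open>Suc m\<close> serves as
    \<open>m'\<close> only because \<open>m < m'\<close> is required.\<close>
  case True
  have bf: "bounded_functional \<phi>" using \<Phi> \<phi> by auto
  have "\<phi> f = 0" if f: "f \<in> X" "\<forall>k<Suc m. a k f = 0" for f
  proof -
    have P0: "\<phi> (partial_sum b a n f) = 0" for n
    proof -
      have "\<phi> (partial_sum b a n f) = (\<Sum>k<n. a k f * \<phi> (b k))"
        unfolding partial_sum_def
        by (subst bounded_functional_sum[OF bf])
           (auto simp: basic_in[OF sys] X_scale bounded_functional_scale[OF bf])
      also have "\<dots> = 0"
        using True f(2) by (intro sum.neutral) (metis less_Suc_eq mult_eq_0_iff not_less lessThan_iff)
      finally show ?thesis .
    qed
    have "norm (\<phi> f) \<le> \<epsilon> * N f" if \<epsilon>: "\<epsilon> > 0" for \<epsilon>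
    proof -
      obtain n where "norm (\<phi> (f - partial_sum b a n f)) \<le> \<epsilon> * N f"
        using \<Phi>(2)[OF \<phi>] f(1) \<epsilon> unfolding tail_small_def by (meson order_refl)
      then show ?thesis
        using bounded_functional_diff[OF bf f(1) partial_sum_in[of b a n f]] basic_in[OF sys] P0[of n] by simp
    qed
    then have "norm (\<phi> f) \<le> 0 + \<epsilon>" if "\<epsilon> > 0" for \<epsilon>
    proof -
      have "\<epsilon> / (N f + 1) > 0" using N_nonneg[OF f(1)] that by simp
      then have "norm (\<phi> f) \<le> \<epsilon> / (N f + 1) * N f" using \<open>\<And>\<epsilon>. \<epsilon> > 0 \<Longrightarrow> norm (\<phi> f) \<le> \<epsilon> * N f\<close> by blast
      also have "\<dots> \<le> \<epsilon>" using N_nonneg[OF f(1)] that by (simp add: field_simps)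
      finally show ?thesis by simp
    qed
    then have "norm (\<phi> f) \<le> 0" by (rule field_le_epsilon)
    then show ?thesis by simp
  qed
  then show ?thesis
    using basic_system_mono[OF sys, of C'] C v(2) \<Phi>(2)
    by (intro exI[of _ b] exI[of _ a] exI[of _ "Suc m"]) auto
next
  case False
  then obtain k where k: "k \<ge> m" "\<phi> (b k) \<noteq> 0" by auto
  define \<alpha> where "\<alpha> = \<phi> (b k)"
  note bin = basic_in[OF sys] and afun = basic_functional[OF sys] and bior = basic_biorth[OF sys]
  have bf: "bounded_functional \<phi>" using \<Phi> \<phi> by auto
  have Nbk: "0 \<le> N (b k)" using N_nonneg bin by auto
  \<comment> \<open>\<open>T\<close> and \<open>U\<close> below have norm at most
    \<open>1 + \<delta>\<close> each, and the new partial sums are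
    \<open>U \<circ> P n \<circ> T\<close>; this accounts for the square.\<close>
  obtain \<delta> where \<delta>: "\<delta> > 0" "C * (1 + \<delta>)\<^sup>2 \<le> C'"
  proof -
    define \<delta> where "\<delta> = min 1 ((C' - C) / (3 * C))"
    have 1: "\<delta> > 0" "\<delta> \<le> 1" "\<delta> \<le> (C' - C) / (3 * C)" using C by (auto simp: \<delta>_def)
    have "(1 + \<delta>)\<^sup>2 \<le> 1 + 3 * \<delta>" using 1 by (simp add: power2_eq_square algebra_simps mult_left_le)
    also have "\<dots> \<le> C' / C" using 1 C by (simp add: field_simps)
    finally have "C * (1 + \<delta>)\<^sup>2 \<le> C'" using C by (simp add: field_simps)
    with 1 that show ?thesis by blast
  qed
  \<comment> \<open>Chosen to give \<open>norm (\<Lambda> f) * N (b k) \<le> \<delta> * N f\<close>;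
    the \<open>+ 1\<close> keeps the denominator positive without a separate proof that
    \<open>N (b k) > 0\<close>.\<close>
  define \<epsilon> where "\<epsilon> = \<delta> * norm \<alpha> / (N (b k) + 1)"
  have "\<epsilon> > 0" using \<delta> k Nbk by (simp add: \<epsilon>_def \<alpha>_def)
  then obtain n\<^sub>0 where n0: "\<And>n f. n \<ge> n\<^sub>0 \<Longrightarrow> f \<in> X \<Longrightarrow> norm (\<phi> (f - partial_sum b a n f)) \<le> \<epsilon> * N f"
    using \<Phi>(2)[OF \<phi>] unfolding tail_small_def by meson
  \<comment> \<open>Beyond \<open>k\<close>, so that \<open>P m'\<close> fixes \<open>b k\<close>
    and \<open>\<Lambda> (b k) = 0\<close>.\<close>
  define m' where "m' = max n\<^sub>0 (Suc k)"
  define P where "P = partial_sum b a"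
  define \<Lambda> where "\<Lambda> f = \<phi> (f - P m' f) / \<alpha>" for f
  have Pin: "P n f \<in> X" for n f using partial_sum_in bin by (auto simp: P_def)
  have PP: "f \<in> X \<Longrightarrow> P i (P j f) = P (min i j) f" for i j f
    using partial_sum_partial_sum[OF sys] by (simp add: P_def)
  have Padd: "P n (f + g) = P n f + P n g" if "f \<in> X" "g \<in> X" for n f g
    using partial_sum_add[OF afun that] by (simp add: P_def)
  have Pdiff: "P n (f - g) = P n f - P n g" if "f \<in> X" "g \<in> X" for n f g
    using partial_sum_diff[OF afun that] by (simp add: P_def)
  have Pscale: "P n (c \<odot> f) = c \<odot> P n f" if "f \<in> X" for n c f
    using partial_sum_scale[OF afun that] by (simp add: P_def)
  have Pbk: "P n (b k) = (if k < n then b k else 0)" for n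
    using partial_sum_basic[OF sys] by (simp add: P_def)
  have \<Lambda>_small: "norm (\<Lambda> f) * N (b k) \<le> \<delta> * N f" if "f \<in> X" for f
  proof -
    have "norm (\<Lambda> f) \<le> \<epsilon> * N f / norm \<alpha>"
      using n0[of m' f] that by (simp add: \<Lambda>_def m'_def P_def norm_divide divide_right_mono)
    also have "\<dots> = \<delta> * N f / (N (b k) + 1)"
      using k by (simp add: \<epsilon>_def \<alpha>_def)
    finally have "norm (\<Lambda> f) * N (b k) \<le> \<delta> * N f / (N (b k) + 1) * N (b k)"
      using Nbk by (intro mult_right_mono) auto
    also have "\<dots> = \<delta> * N f * (N (b k) / (N (b k) + 1))" by simp
    also have "\<dots> \<le> \<delta> * N f * 1"
      using Nbk \<delta>(1) N_nonneg[OF that] by (intro mult_left_mono) (auto simp: divide_le_eq_1)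
    finally show ?thesis by simp
  qed
  have \<Lambda>fun: "bounded_functional \<Lambda>"
    unfolding bounded_functional_def
  proof (intro conjI ballI allI)
    fix f g assume "f \<in> X" "g \<in> X"
    then show "\<Lambda> (f + g) = \<Lambda> f + \<Lambda> g"
      using bounded_functional_add[OF bf, of "f - P m' f" "g - P m' g"]
      by (simp add: \<Lambda>_def Padd X_diff Pin add_divide_distrib algebra_simps)
  next
    fix c f assume "f \<in> X"
    then show "\<Lambda> (c \<odot> f) = c * \<Lambda> f"
      using bounded_functional_scale[OF bf, of "f - P m' f" c]
      by (simp add: \<Lambda>_def Pscale X_diff Pin scale_right_diff_distrib)
  next
    have "norm (\<Lambda> f) \<le> \<epsilon> / norm \<alpha> * N f" if "f \<in> X" for f
      using n0[of m' f] that by (simp add: \<Lambda>_def m'_def P_def norm_divide divide_right_mono)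
    then show "\<exists>B. \<forall>f\<in>X. norm (\<Lambda> f) \<le> B * N f" by blast
  qed
  have \<Lambda>0: "\<Lambda> f = 0" if "f \<in> X" "P m' f = f" for f
    using that bounded_functional_0[OF bf] by (simp add: \<Lambda>_def)
  have \<Lambda>b: "\<Lambda> (b i) = 0" if "i < m'" for i
    using \<Lambda>0[OF bin] partial_sum_basic[OF sys] that by (simp add: P_def)
  have km: "k < m'" by (simp add: m'_def)
  define b' where "b' i = b i - \<Lambda> (b i) \<odot> b k" for i
  define a' where "a' = a(k := \<lambda>f. a k f + \<Lambda> f)"
  define T where "T f = f + \<Lambda> f \<odot> b k" for f
  define U where "U f = f - \<Lambda> f \<odot> b k" for f
  have Tin: "f \<in> X \<Longrightarrow> T f \<in> X" and Uin: "f \<in> X \<Longrightarrow> U f \<in> X" for f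
    by (auto simp: T_def U_def X_add X_diff X_scale bin)
  \<comment> \<open>Because of \<open>\<Lambda> (b k) = 0\<close> the rank one map
    \<open>f \<mapsto> \<Lambda> f \<odot> b k\<close> squares to zero, so \<open>U\<close> inverts
    \<open>T\<close> exactly.\<close>
  have UT: "U (T f) = f" if "f \<in> X" for f
    using that \<Lambda>b[OF km]
    by (simp add: T_def U_def bounded_functional_add[OF \<Lambda>fun] bounded_functional_scale[OF \<Lambda>fun]
        X_scale bin)
  have Udiff: "U (f - g) = U f - U g" if "f \<in> X" "g \<in> X" for f g
    using that by (simp add: U_def bounded_functional_diff[OF \<Lambda>fun] scale_left_diff_distrib)
  have aT: "a' i f = a i (T f)" if "f \<in> X" for i f
    using that by (simp add: a'_def T_def bounded_functional_add[OF afun]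
        bounded_functional_scale[OF afun] X_scale bin bior)
  have bU: "b' i = U (b i)" for i by (simp add: b'_def U_def)
  have P'eq: "partial_sum b' a' n f = U (P n (T f))" if "f \<in> X" for n f
  proof -
    have "U (P n (T f)) = P n (T f) - (\<Sum>i<n. \<Lambda> (a i (T f) \<odot> b i)) \<odot> b k"
      by (simp add: U_def P_def partial_sum_def bounded_functional_sum[OF \<Lambda>fun] X_scale bin)
    also have "\<dots> = (\<Sum>i<n. a i (T f) \<odot> b i - (a i (T f) * \<Lambda> (b i)) \<odot> b k)"
      by (simp add: P_def partial_sum_def sum_subtractf scale_sum_left
          bounded_functional_scale[OF \<Lambda>fun] bin)
    also have "\<dots> = partial_sum b' a' n f"
      by (simp add: partial_sum_def b'_def aT[OF that] scale_right_diff_distrib)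
    finally show ?thesis by simp
  qed
  have NT: "N (T f) \<le> (1 + \<delta>) * N f" if "f \<in> X" for f
    using N_add[of f "\<Lambda> f \<odot> b k"] \<Lambda>_small[OF that] that
    by (simp add: T_def N_scale bin X_scale algebra_simps)
  have NU: "N (U f) \<le> (1 + \<delta>) * N f" if "f \<in> X" for f
    using N_diff[of f "\<Lambda> f \<odot> b k"] \<Lambda>_small[OF that] that
    by (simp add: U_def N_scale bin X_scale algebra_simps)
  have "basic_system b' a' C'"
    unfolding basic_system_def
  proof (intro conjI allI ballI)
    show "b' i \<in> X" for i by (simp add: bU Uin bin)
    show "bounded_functional (a' i)" for i
    proof -
      obtain B1 where B1: "\<And>f. f \<in> X \<Longrightarrow> norm (a k f) \<le> B1 * N f"
        using bounded_functional_bound[OF afun] by blast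
      obtain B2 where B2: "\<And>f. f \<in> X \<Longrightarrow> norm (\<Lambda> f) \<le> B2 * N f"
        using bounded_functional_bound[OF \<Lambda>fun] by blast
      have "norm (a k f + \<Lambda> f) \<le> (B1 + B2) * N f" if "f \<in> X" for f
        using B1[OF that] B2[OF that] norm_triangle_ineq[of "a k f" "\<Lambda> f"]
        by (simp add: algebra_simps)
      then have "bounded_functional (\<lambda>f. a k f + \<Lambda> f)"
        unfolding bounded_functional_def
        by (intro conjI exI[of _ "B1 + B2"])
           (auto simp: bounded_functional_add[OF afun] bounded_functional_add[OF \<Lambda>fun]
            bounded_functional_scale[OF afun] bounded_functional_scale[OF \<Lambda>fun] algebra_simps)
      then show ?thesis by (simp add: a'_def afun)
    qed
    show "a' i (b' j) = of_bool (i = j)" for i j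
    proof -
      have TU: "T (U (b j)) = b j"
        using \<Lambda>b[OF km]
        by (simp add: T_def U_def bounded_functional_diff[OF \<Lambda>fun]
            bounded_functional_scale[OF \<Lambda>fun] X_scale bin)
      show ?thesis
        using aT[of "U (b j)" i] Uin[OF bin] by (simp add: bU TU bior)
    qed
    fix n f assume f: "f \<in> X"
    have "N (partial_sum b' a' n f) \<le> (1 + \<delta>) * N (P n (T f))"
      using P'eq[OF f] NU[OF Pin] by simp
    also have "\<dots> \<le> (1 + \<delta>) * (C * N (T f))"
      using basic_bound[OF sys Tin[OF f]] \<delta> by (intro mult_left_mono) (auto simp: P_def)
    also have "\<dots> \<le> (1 + \<delta>) * (C * ((1 + \<delta>) * N f))"
      using NT[OF f] C \<delta> by (intro mult_left_mono) auto
    also have "\<dots> = (C * (1 + \<delta>)\<^sup>2) * N f" by (simp add: power2_eq_square)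
    also have "\<dots> \<le> C' * N f" using \<delta> N_nonneg[OF f] by (intro mult_right_mono) auto
    finally show "N (partial_sum b' a' n f) \<le> C' * N f" .
  qed
  moreover have "partial_sum b' a' n (v i) = v i" if "i < n" for n i
  proof -
    have "P n (T (v i)) = T (v i)"
    proof (cases "i < m'")
      case True
      then have "T (v i) = v i"
        using \<Lambda>0[OF v(1)] v(2)[of i m'] by (simp add: T_def P_def)
      then show ?thesis using v(2)[OF that] by (simp add: P_def)
    next
      \<comment> \<open>Here \<open>n > i \<ge> m' > k\<close>, so \<open>P n\<close> also fixes the
        added multiple of \<open>b k\<close>.\<close>
      case False
      with that km have "k < n" by simp
      then show ?thesis
        using v(2)[OF that] v(1)[of i] by (simp add: T_def Padd Pscale X_scale bin Pbk) (simp add: P_def)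
    qed
    then show ?thesis using P'eq[OF v(1)] UT[OF v(1)] by simp
  qed
  moreover have "tail_small b' a' \<psi>" if \<psi>: "\<psi> \<in> \<Phi>" for \<psi>
    unfolding tail_small_def
  proof (intro allI impI)
    fix \<eta> :: real assume \<eta>: "\<eta> > 0"
    note \<psi>f = \<Phi>(1)[OF \<psi>]
    define \<eta>' where "\<eta>' = \<eta> / ((1 + \<delta>) * (1 + norm (\<psi> (b k)) / norm \<alpha>))"
    have pos: "1 + norm (\<psi> (b k)) / norm \<alpha> > 0" by (simp add: add_pos_nonneg)
    have "\<eta>' > 0" using \<eta> \<delta> pos by (simp add: \<eta>'_def)
    obtain n1 where n1: "\<And>n f. n \<ge> n1 \<Longrightarrow> f \<in> X \<Longrightarrow> norm (\<psi> (f - P n f)) \<le> \<eta>' * N f"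
      using \<Phi>(2)[OF \<psi>] \<open>\<eta>' > 0\<close> unfolding tail_small_def P_def by meson
    obtain n2 where n2: "\<And>n f. n \<ge> n2 \<Longrightarrow> f \<in> X \<Longrightarrow> norm (\<phi> (f - P n f)) \<le> \<eta>' * N f"
      using \<Phi>(2)[OF \<phi>] \<open>\<eta>' > 0\<close> unfolding tail_small_def P_def by meson
    have "norm (\<psi> (f - partial_sum b' a' n f)) \<le> \<eta> * N f"
      if n: "n \<ge> max m' (max n1 n2)" and f: "f \<in> X" for n f
    proof -
      define g where "g = T f - P n (T f)"
      have g: "g \<in> X" using Tin[OF f] Pin X_diff by (simp add: g_def)
      have "f - partial_sum b' a' n f = U g"
        using UT[OF f] P'eq[OF f] Udiff[OF Tin[OF f] Pin] by (simp add: g_def)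
      then have 1: "\<psi> (f - partial_sum b' a' n f) = \<psi> g - \<Lambda> g * \<psi> (b k)"
        using g by (simp add: U_def bounded_functional_diff[OF \<psi>f] bounded_functional_scale[OF \<psi>f] X_scale bin)
      \<comment> \<open>For \<open>n \<ge> m'\<close> the remainder \<open>g\<close> has no
        coordinates below \<open>m'\<close>. So \<open>\<Lambda> g\<close> reduces to
        \<open>\<phi> g / \<alpha>\<close>, and the smallness of the tails of \<open>\<psi>\<close>
        and \<open>\<phi>\<close> passes to the new system.\<close>
      have "P m' g = 0"
        using n by (simp add: g_def Pdiff Tin[OF f] Pin PP min_def)
      then have 2: "\<Lambda> g = \<phi> g / \<alpha>" by (simp add: \<Lambda>_def)
      have "norm (\<psi> (f - partial_sum b' a' n f)) \<le> norm (\<psi> g) + norm (\<phi> g) / norm \<alpha> * norm (\<psi> (b k))"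
        unfolding 1 2 using norm_triangle_ineq4[of "\<psi> g" "\<phi> g / \<alpha> * \<psi> (b k)"]
        by (simp add: norm_mult norm_divide)
      also have "\<dots> \<le> \<eta>' * N (T f) + \<eta>' * N (T f) / norm \<alpha> * norm (\<psi> (b k))"
        using n1[OF _ Tin[OF f], of n] n2[OF _ Tin[OF f], of n] n unfolding g_def
        by (intro add_mono mult_right_mono divide_right_mono) auto
      also have "\<dots> = \<eta>' * (1 + norm (\<psi> (b k)) / norm \<alpha>) * N (T f)"
        by (simp add: algebra_simps)
      also have "\<dots> \<le> \<eta>' * (1 + norm (\<psi> (b k)) / norm \<alpha>) * ((1 + \<delta>) * N f)"
        using NT[OF f] \<open>\<eta>' > 0\<close> pos by (intro mult_left_mono) auto
      also have "\<dots> = \<eta> * N f"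
        using pos \<delta>(1) by (simp add: \<eta>'_def)
      finally show ?thesis .
    qed
    then show "\<exists>n\<^sub>0. \<forall>n\<ge>n\<^sub>0. \<forall>f\<in>X. norm (\<psi> (f - partial_sum b' a' n f)) \<le> \<eta> * N f" by blast
  qed
  moreover have "\<phi> f = 0" if f: "f \<in> X" and z: "\<forall>i<m'. a' i f = 0" for f
  proof -
    \<comment> \<open>Of the old coordinates below \<open>m'\<close> only number \<open>k\<close>
      can survive, and \<open>a' k f = 0\<close> makes it \<open>- \<Lambda> f\<close>; by the
      choice of \<open>\<Lambda>\<close> this relation reads \<open>\<phi> f = 0\<close>.\<close>
    have "a i f \<odot> b i = 0" if "i < m'" "i \<noteq> k" for i
      using z that by (auto simp: a'_def)
    then have "P m' f = (\<Sum>i<m'. if i = k then a k f \<odot> b k else 0)"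
      unfolding P_def partial_sum_def by (intro sum.cong) auto
    then have Pk: "P m' f = a k f \<odot> b k" using km by simp
    have "a' k f = 0" using z km by blast
    then have "0 = a k f + \<Lambda> f" by (simp add: a'_def)
    also have "\<Lambda> f = (\<phi> f - a k f * \<alpha>) / \<alpha>"
      using f by (simp add: \<Lambda>_def Pk bounded_functional_diff[OF bf] bounded_functional_scale[OF bf] X_scale bin \<alpha>_def)
    finally show ?thesis using k by (simp add: \<alpha>_def field_simps)
  qed
  moreover have "\<forall>i<m. b' i = b i \<and> a' i = a i"
    using k(1) km \<Lambda>b by (auto simp: b'_def a'_def)
  moreover have "m < m'" using k km by simp
  ultimately show ?thesis by blast
qed

lemma partial_sum_cong:
  assumes "\<And>k. k < n \<Longrightarrow> b k = b' k \<and> a k = a' k"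
  shows "partial_sum b a n = partial_sum b' a' n"
  using assms by (simp add: fun_eq_iff partial_sum_def)

lemma partial_sum_fixed_if_partial_sum_basis:
  assumes "\<And>i. bounded_functional (a' i)" "\<And>i. b i \<in> X" "f \<in> X" "n \<ge> n\<^sub>0"
    and "\<And>n i. i < n \<Longrightarrow> partial_sum b' a' n (b i) = b i"
  shows "partial_sum b' a' n (partial_sum b a n\<^sub>0 f) = partial_sum b a n\<^sub>0 f"
  unfolding partial_sum_def[of b a]
  using assms by (subst partial_sum_sum) (auto simp: partial_sum_scale X_scale intro!: sum.cong)

text \<open>Stage \<open>j\<close> of an iteration of \<open>perturbation_step\<close> handles
  \<open>\<phi> j\<close> and keeps the entries below \<open>M j\<close>, so every entry is
  eventually constant and the limit inherits the bounds. Density survives because every stage, hence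
  the limit, satisfies \<open>partial_sum e c n (b i) = b i\<close> for \<open>i < n\<close>: the
  old span stays inside the new one.\<close>

theorem perturbed_basis:
  fixes \<phi> :: "nat \<Rightarrow> 'v \<Rightarrow> 'k"
  assumes sys: "basic_system b a C" and C: "0 < C"
    and dense: "\<And>f \<epsilon>. f \<in> X \<Longrightarrow> \<epsilon> > 0 \<Longrightarrow> \<exists>n. N (f - partial_sum b a n f) < \<epsilon>"
    and \<phi>: "\<And>j. bounded_functional (\<phi> j)" "\<And>j. tail_small b a (\<phi> j)"
  obtains e c where "basic_system e c (C + 1)"
    "\<And>f. f \<in> X \<Longrightarrow> (\<lambda>n. N (f - partial_sum e c n f)) \<longlonglongrightarrow> 0"
    "\<And>j. \<exists>m. \<forall>f\<in>X. (\<forall>k<m. c k f = 0) \<longrightarrow> \<phi> j f = 0"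
proof -
  \<comment> \<open>Increases from \<open>C\<close> towards \<open>C + 1\<close>, which leaves every
    stage room for a strictly larger constant.\<close>
  define K where "K j = C + 1 - 1 / (real j + 1)" for j
  have K: "0 < K j" "K j < K (Suc j)" "K j \<le> C + 1" for j
    using C by (auto simp: K_def field_simps add_pos_nonneg)
  define ok where "ok j s \<longleftrightarrow> (case s of (b', a', m) \<Rightarrow> basic_system b' a' (K j) \<and>
      (\<forall>n. \<forall>i<n. partial_sum b' a' n (b i) = b i) \<and> (\<forall>i. tail_small b' a' (\<phi> i)))"
    for j :: nat and s :: "(nat \<Rightarrow> 'v) \<times> (nat \<Rightarrow> 'v \<Rightarrow> 'k) \<times> nat"
  define step where "step j s s' \<longleftrightarrow> (case (s, s') of ((b1, a1, m1), (b2, a2, m2)) \<Rightarrow>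
      m1 < m2 \<and> (\<forall>k<m1. b2 k = b1 k \<and> a2 k = a1 k) \<and>
      (\<forall>f\<in>X. (\<forall>k<m2. a2 k f = 0) \<longrightarrow> \<phi> j f = 0))"
    for j :: nat and s s' :: "(nat \<Rightarrow> 'v) \<times> (nat \<Rightarrow> 'v \<Rightarrow> 'k) \<times> nat"
  have "\<exists>S. \<forall>j. ok j (S j) \<and> step j (S j) (S (Suc j))"
  proof (rule dependent_nat_choice)
    have "ok 0 (b, a, 0)"
      using sys \<phi>(2) partial_sum_basic[OF sys] by (simp add: ok_def K_def)
    then show "\<exists>s. ok 0 s" by blast
  next
    fix s j assume "ok j s"
    then obtain b1 a1 m1 where s: "s = (b1, a1, m1)" "basic_system b1 a1 (K j)"
      "\<And>n i. i < n \<Longrightarrow> partial_sum b1 a1 n (b i) = b i" "\<And>i. tail_small b1 a1 (\<phi> i)"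
      by (cases s) (auto simp: ok_def)
    obtain b2 a2 m2 where s2: "m1 < m2" "\<forall>k<m1. b2 k = b1 k \<and> a2 k = a1 k"
      "basic_system b2 a2 (K (Suc j))" "\<forall>n. \<forall>i<n. partial_sum b2 a2 n (b i) = b i"
      "\<forall>\<psi>\<in>range \<phi>. tail_small b2 a2 \<psi>" "\<forall>f\<in>X. (\<forall>k<m2. a2 k f = 0) \<longrightarrow> \<phi> j f = 0"
      using perturbation_step[where v=b, OF s(2) K(1,2) basic_in[OF sys] s(3), where \<Phi>="range \<phi>" and \<phi>="\<phi> j" and m=m1] \<phi>(1) s(4)
      by (smt (verit, best) rangeE rangeI)
    have "ok (Suc j) (b2, a2, m2) \<and> step j s (b2, a2, m2)"
      using s2 by (simp add: ok_def step_def s(1))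
    then show "\<exists>s'. ok (Suc j) s' \<and> step j s s'" by blast
  qed
  then obtain S where S: "\<And>j. ok j (S j)" "\<And>j. step j (S j) (S (Suc j))" by blast
  define B where "B j = fst (S j)" for j
  define A where "A j = fst (snd (S j))" for j
  define M where "M j = snd (snd (S j))" for j
  have sysj: "basic_system (B j) (A j) (C + 1)" for j
    using S(1)[of j] basic_system_mono[OF _ K(3)]
    by (auto simp: ok_def B_def A_def split: prod.splits)
  have fixj: "partial_sum (B j) (A j) n (b i) = b i" if "i < n" for j n i
    using S(1)[of j] that by (auto simp: ok_def B_def A_def split: prod.splits)
  have stepj: "M j < M (Suc j)" "\<And>k. k < M j \<Longrightarrow> B (Suc j) k = B j k \<and> A (Suc j) k = A j k"
      "\<And>f. f \<in> X \<Longrightarrow> (\<forall>k<M (Suc j). A (Suc j) k f = 0) \<Longrightarrow> \<phi> j f = 0" for j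
    using S(2)[of j] by (auto simp: step_def B_def A_def M_def split: prod.splits)
  have "strict_mono M" using stepj(1) by (simp add: strict_mono_Suc_iff)
  then have Mge: "j \<le> M j" for j by (rule strict_mono_imp_increasing)
  have Mmono: "M i \<le> M j" if "i \<le> j" for i j
    using \<open>strict_mono M\<close> that by (simp add: strict_mono_less_eq)
  have stable: "B j k = B i k \<and> A j k = A i k" if "i \<le> j" "k < M i" for i j k
    using that
  proof (induction j rule: dec_induct)
    case (step j)
    then show ?case using stepj(2)[of k j] Mmono[of i j] by auto
  qed auto
  \<comment> \<open>Since \<open>k < M (Suc k)\<close>, entry \<open>k\<close> is final from stage
    \<open>Suc k\<close> on.\<close>
  define e where "e k = B (Suc k) k" for k
  define c where "c k = A (Suc k) k" for k
  have ec: "e k = B j k \<and> c k = A j k" if "k < M j" for j k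
  proof -
    have "k < M (Suc k)" using Mge[of "Suc k"] by simp
    then show ?thesis using stable[of "Suc k" j k] stable[of j "Suc k" k] that
      by (cases "Suc k \<le> j") (auto simp: e_def c_def)
  qed
  have psum: "partial_sum e c n = partial_sum (B j) (A j) n" if "n \<le> M j" for n j
    using ec that by (intro partial_sum_cong) auto
  have psum': "partial_sum e c n = partial_sum (B n) (A n) n" for n
    using psum[OF Mge] .
  have sys': "basic_system e c (C + 1)"
    unfolding basic_system_def
  proof (intro conjI allI ballI)
    fix i j
    show "e i \<in> X" using basic_in[OF sysj] by (simp add: e_def)
    show "bounded_functional (c i)" using basic_functional[OF sysj] by (simp add: c_def)
    show "c i (e j) = of_bool (i = j)"
      using ec[of i "Suc (max i j)"] ec[of j "Suc (max i j)"] Mge[of "Suc (max i j)"]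
        basic_biorth[OF sysj] by simp
  qed (use basic_bound[OF sysj] psum' in auto)
  have fix_e: "partial_sum e c n (b i) = b i" if "i < n" for n i
    using fixj that psum' by simp
  have "(\<lambda>n. N (f - partial_sum e c n f)) \<longlonglongrightarrow> 0" if f: "f \<in> X" for f
  proof (rule LIMSEQ_I)
    fix r :: real assume "0 < r"
    \<comment> \<open>Once the partial sum fixes \<open>g\<close>, the error of \<open>f\<close> is
      that of \<open>f - g\<close>, which is at most \<open>1 + (C + 1)\<close> times
      \<open>N (f - g)\<close>.\<close>
    then have "r / (C + 2) > 0" using C by simp
    then obtain n0 where n0: "N (f - partial_sum b a n0 f) < r / (C + 2)" using dense[OF f] by blast
    define g where "g = partial_sum b a n0 f"
    have g: "g \<in> X" using basic_in[OF sys] by (simp add: g_def partial_sum_in)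
    have "norm (N (f - partial_sum e c n f) - 0) < r" if "n \<ge> n0" for n
    proof -
      note Pe = partial_sum_in[of e c n, OF basic_in[OF sys']]
      have "partial_sum e c n g = g"
        unfolding g_def
        using partial_sum_fixed_if_partial_sum_basis[OF basic_functional[OF sys'] basic_in[OF sys] f that fix_e] .
      then have "f - partial_sum e c n f = (f - g) - partial_sum e c n (f - g)"
        by (simp add: partial_sum_diff[OF basic_functional[OF sys'] f g])
      then have "N (f - partial_sum e c n f) \<le> N (f - g) + N (partial_sum e c n (f - g))"
        using N_diff[OF X_diff[OF f g] Pe[of "f - g"]] by (simp only:)
      also have "\<dots> \<le> N (f - g) + (C + 1) * N (f - g)"
        using basic_bound[OF sys' X_diff[OF f g], of n] by simp
      also have "\<dots> = (C + 2) * N (f - g)" by (simp add: algebra_simps)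
      also have "\<dots> < r" using n0 C by (simp add: g_def field_simps)
      finally show ?thesis using N_nonneg[OF X_diff[OF f Pe]] by simp
    qed
    then show "\<exists>n0. \<forall>n\<ge>n0. norm (N (f - partial_sum e c n f) - 0) < r" by blast
  qed
  moreover have "\<exists>m. \<forall>f\<in>X. (\<forall>k<m. c k f = 0) \<longrightarrow> \<phi> j f = 0" for j
    using stepj(3)[of _ j] ec[of _ "Suc j"] by (intro exI[of _ "M (Suc j)"]) auto
  ultimately show ?thesis using that[OF sys'] by blast
qed

text \<open>\<open>c k\<close> reads \<open>d k\<close> off every partial sum with
  \<open>n > k\<close>, and its boundedness passes this to the limit.\<close>

lemma expansion_unique:
  assumes sys: "basic_system e c C" and f: "f \<in> X"
    and lim: "(\<lambda>n. N (f - (\<Sum>k<n. d k \<odot> e k))) \<longlonglongrightarrow> 0"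
  shows "d k = c k f"
proof -
  obtain B where B: "\<And>f. f \<in> X \<Longrightarrow> norm (c k f) \<le> B * N f"
    using bounded_functional_bound[OF basic_functional[OF sys]] by blast
  have "norm (c k f - d k) \<le> B * N (f - (\<Sum>k<n. d k \<odot> e k))" if "n > k" for n
  proof -
    have in_X: "(\<Sum>k<n. d k \<odot> e k) \<in> X"
      by (intro X_sum X_scale basic_in[OF sys])
    have "c k (\<Sum>i<n. d i \<odot> e i) = (\<Sum>i<n. if i = k then d k else 0)"
      by (subst bounded_functional_sum[OF basic_functional[OF sys]])
         (auto simp: X_scale basic_in[OF sys] bounded_functional_scale[OF basic_functional[OF sys]]
           basic_biorth[OF sys] intro!: sum.cong)
    then have "c k (f - (\<Sum>k<n. d k \<odot> e k)) = c k f - d k"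
      using that by (simp add: bounded_functional_diff[OF basic_functional[OF sys] f in_X])
    then show ?thesis using B[OF X_diff[OF f in_X]] by simp
  qed
  then have "\<forall>\<^sub>F n in sequentially. norm (c k f - d k) \<le> B * N (f - (\<Sum>k<n. d k \<odot> e k))"
    by (intro eventually_sequentiallyI[of "Suc k"]) auto
  then have "norm (c k f - d k) \<le> B * 0"
    using tendsto_mult_left[OF lim, of B] by (intro tendsto_lowerbound[OF _ _ sequentially_bot]) auto
  then show ?thesis by simp
qed

end

section \<open>Seminorms of Lebesgue spaces\<close>

text \<open>Source of both the triangle inequality and Jensen's inequality below. The tangent comes
  from convexity on the open half line, so the endpoint \<open>y = 0\<close> is checked by
  hand.\<close>

lemma powr_above_tangent:
  fixes p x y :: real
  assumes "1 \<le> p" "0 < x" "0 \<le> y"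
  shows "x powr p + p * x powr (p - 1) * (y - x) \<le> y powr p"
proof (cases "y = 0")
  case True
  have "x powr p = x powr (p - 1) * x"
    using assms by (simp add: powr_diff)
  then have "x powr p + p * x powr (p - 1) * (y - x) = (1 - p) * x powr p"
    using True by (simp add: algebra_simps)
  also have "\<dots> \<le> 0" using assms by (simp add: mult_nonpos_nonneg)
  finally show ?thesis using True by simp
next
  case False
  have "y powr p - x powr p \<ge> (p * x powr (p - 1)) * (y - x)"
    using assms False
    by (intro convex_on_imp_above_tangent[of "{0<..}"])
       (auto intro!: powr_convex derivative_eq_intros simp: interior_open)
  then show ?thesis by simp
qed

lemma powr_convex_combination:
  fixes p u v t :: real
  assumes "1 \<le> p" "0 \<le> u" "0 \<le> v" "0 \<le> t" "t \<le> 1"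
  shows "(t * u + (1 - t) * v) powr p \<le> t * u powr p + (1 - t) * v powr p"
proof (cases "t * u + (1 - t) * v = 0")
  case False
  define c where "c = t * u + (1 - t) * v"
  have "c > 0" using False assms by (simp add: c_def add_nonneg_nonneg order_less_le)
  have "t * (c powr p + p * c powr (p - 1) * (u - c)) + (1 - t) * (c powr p + p * c powr (p - 1) * (v - c))
      \<le> t * u powr p + (1 - t) * v powr p"
    using assms \<open>c > 0\<close> by (intro add_mono mult_left_mono powr_above_tangent) auto
  also have "t * (c powr p + p * c powr (p - 1) * (u - c)) + (1 - t) * (c powr p + p * c powr (p - 1) * (v - c))
      = c powr p + p * c powr (p - 1) * (t * u + (1 - t) * v - c)"
    by (simp add: algebra_simps)
  finally show ?thesis by (simp add: c_def)
qed (use assms in simp)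

lemma powr_norm_add_le:
  fixes u v :: "'b::real_normed_vector"
  assumes "1 \<le> p"
  shows "norm (u + v) powr p \<le> 2 powr p * (norm u powr p + norm v powr p)"
proof -
  have "norm (u + v) powr p \<le> (2 * max (norm u) (norm v)) powr p"
    using assms norm_triangle_ineq[of u v] by (intro powr_mono2) auto
  also have "\<dots> = 2 powr p * max (norm u) (norm v) powr p" by (simp add: powr_mult)
  also have "\<dots> \<le> 2 powr p * (norm u powr p + norm v powr p)"
    by (intro mult_left_mono) (auto simp: max_def)
  finally show ?thesis .
qed

definition Lp :: "real \<Rightarrow> 'a measure \<Rightarrow> ('a \<Rightarrow> 'k::real_normed_field) set" where
  "Lp p M = {f \<in> borel_measurable M. integrable M (\<lambda>x. norm (f x) powr p)}"

definition Lp_norm :: "real \<Rightarrow> 'a measure \<Rightarrow> ('a \<Rightarrow> 'k::real_normed_field) \<Rightarrow> real" where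
  "Lp_norm p M f = (LINT x|M. norm (f x) powr p) powr (1 / p)"

lemma Lp_norm_powr: "1 \<le> p \<Longrightarrow> Lp_norm p M f powr p = (LINT x|M. norm (f x) powr p)"
  by (simp add: Lp_norm_def powr_powr Bochner_Integration.integral_nonneg)

lemma Lp_norm_nonneg: "0 \<le> Lp_norm p M f"
  by (simp add: Lp_norm_def)

lemma Lp_norm_le:
  assumes "1 \<le> p" "0 \<le> B" "(LINT x|M. norm (f x) powr p) \<le> B powr p"
  shows "Lp_norm p M f \<le> B"
  using powr_mono2[of "1 / p", OF _ _ assms(3)] assms
  by (simp add: Lp_norm_def powr_powr Bochner_Integration.integral_nonneg)

lemma Lp_add:
  fixes f g :: "'a \<Rightarrow> 'k::{real_normed_field, second_countable_topology}"
  assumes p: "1 \<le> p" and "f \<in> Lp p M" "g \<in> Lp p M"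
  shows "(\<lambda>x. f x + g x) \<in> Lp p M"
proof -
  have [measurable]: "f \<in> borel_measurable M" "g \<in> borel_measurable M"
    using assms by (auto simp: Lp_def)
  have "integrable M (\<lambda>x. norm (f x + g x) powr p)"
  proof (rule Bochner_Integration.integrable_bound)
    show "integrable M (\<lambda>x. 2 powr p * (norm (f x) powr p + norm (g x) powr p))"
      using assms by (auto simp: Lp_def)
    show "AE x in M. norm (norm (f x + g x) powr p) \<le> norm (2 powr p * (norm (f x) powr p + norm (g x) powr p))"
      using powr_norm_add_le[OF p] by (intro AE_I2) auto
  qed measurable
  then show ?thesis by (simp add: Lp_def)
qed

lemma Lp_cmult:
  fixes f :: "'a \<Rightarrow> 'k::{real_normed_field, second_countable_topology}"
  shows "f \<in> Lp p M \<Longrightarrow> (\<lambda>x. c * f x) \<in> Lp p M"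
  by (auto simp: Lp_def norm_mult powr_mult)

lemma Lp_norm_cmult:
  "1 \<le> p \<Longrightarrow> Lp_norm p M (\<lambda>x. c * f x) = norm c * Lp_norm p M f"
  by (simp add: Lp_norm_def norm_mult powr_mult powr_powr)

text \<open>Minkowski's inequality by convexity: with \<open>a\<close> and \<open>b\<close> slightly
  above the two norms, \<open>norm (f x) + norm (g x)\<close> is \<open>a + b\<close> times a convex
  combination of \<open>norm (f x) / a\<close> and \<open>norm (g x) / b\<close>. The
  \<open>e / 2\<close> keeps \<open>a\<close> and \<open>b\<close> positive when a norm
  vanishes.\<close>

lemma Lp_norm_triangle:
  fixes f g :: "'a \<Rightarrow> 'k::{real_normed_field, second_countable_topology}"
  assumes p: "1 \<le> p" and f: "f \<in> Lp p M" and g: "g \<in> Lp p M"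
  shows "Lp_norm p M (\<lambda>x. f x + g x) \<le> Lp_norm p M f + Lp_norm p M g"
proof (rule field_le_epsilon)
  fix e :: real assume "0 < e"
  define a where "a = Lp_norm p M f + e / 2"
  define b where "b = Lp_norm p M g + e / 2"
  have ab: "0 < a" "0 < b" "Lp_norm p M f \<le> a" "Lp_norm p M g \<le> b"
    using \<open>0 < e\<close> Lp_norm_nonneg[of p M f] Lp_norm_nonneg[of p M g] by (auto simp: a_def b_def)
  define t where "t = a / (a + b)"
  have t: "0 \<le> t" "t \<le> 1" "1 - t = b / (a + b)" using ab by (auto simp: t_def field_simps)
  have int: "integrable M (\<lambda>x. norm (f x) powr p)" "integrable M (\<lambda>x. norm (g x) powr p)"
    using f g by (auto simp: Lp_def)
  have le1: "(LINT x|M. norm (f x) powr p) / a powr p \<le> 1" "(LINT x|M. norm (g x) powr p) / b powr p \<le> 1"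
    using ab p Lp_norm_nonneg by (auto simp flip: Lp_norm_powr intro!: powr_mono2)
  have pt: "norm (f x + g x) powr p \<le>
      (a + b) powr p * (t * (norm (f x) powr p / a powr p) + (1 - t) * (norm (g x) powr p / b powr p))" for x
  proof -
    have "norm (f x + g x) \<le> (a + b) * (t * (norm (f x) / a) + (1 - t) * (norm (g x) / b))"
      using ab norm_triangle_ineq[of "f x" "g x"] unfolding t(3) by (simp add: t_def distrib_left)
    then have "norm (f x + g x) powr p \<le> ((a + b) * (t * (norm (f x) / a) + (1 - t) * (norm (g x) / b))) powr p"
      using p by (intro powr_mono2) auto
    also have "\<dots> = (a + b) powr p * (t * (norm (f x) / a) + (1 - t) * (norm (g x) / b)) powr p"
      by (rule powr_mult)
    also have "\<dots> \<le> (a + b) powr p * (t * (norm (f x) / a) powr p + (1 - t) * (norm (g x) / b) powr p)"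
      using t ab by (intro mult_left_mono powr_convex_combination p) auto
    finally show ?thesis using ab by (simp add: powr_divide)
  qed
  have "(LINT x|M. norm (f x + g x) powr p) \<le>
      (LINT x|M. (a + b) powr p * (t * (norm (f x) powr p / a powr p) + (1 - t) * (norm (g x) powr p / b powr p)))"
    using Lp_add[OF p f g] int pt by (intro integral_mono) (auto simp: Lp_def)
  also have "\<dots> = (a + b) powr p * (t * ((LINT x|M. norm (f x) powr p) / a powr p)
      + (1 - t) * ((LINT x|M. norm (g x) powr p) / b powr p))"
    using int by simp
  also have "\<dots> \<le> (a + b) powr p * (t * 1 + (1 - t) * 1)"
    using le1 t by (intro mult_left_mono add_mono) auto
  finally have "Lp_norm p M (\<lambda>x. f x + g x) \<le> a + b"
    using ab by (intro Lp_norm_le[OF p]) auto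
  then show "Lp_norm p M (\<lambda>x. f x + g x) \<le> Lp_norm p M f + Lp_norm p M g + e"
    by (simp add: a_def b_def)
qed

text \<open>Integrating the tangent inequality at the mean \<open>m\<close> over \<open>S\<close>
  removes the linear term.\<close>

lemma set_integral_powr_Jensen:
  fixes g :: "'a \<Rightarrow> 'k::{banach, second_countable_topology}"
  assumes p: "1 \<le> p" and S: "S \<in> sets M" "emeasure M S < \<infinity>"
    and g: "set_integrable M S g" "set_integrable M S (\<lambda>x. norm (g x) powr p)"
  shows "((LINT x:S|M. norm (g x)) / measure M S) powr p * measure M S \<le> (LINT x:S|M. norm (g x) powr p)"
proof -
  define m where "m = (LINT x:S|M. norm (g x)) / measure M S"
  have gn: "set_integrable M S (\<lambda>x. norm (g x))"
    using set_integrable_norm[OF g(1)] by simp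
  show ?thesis
  proof (cases "m > 0 \<and> measure M S > 0")
    case True
    have const: "set_integrable M S (\<lambda>x. c::real)" for c
      using S by (simp add: set_integrable_def)
    have meas: "(LINT x:S|M. c) = c * measure M S" for c :: real
      using S by (simp add: set_lebesgue_integral_def)
    have "(LINT x:S|M. m powr p + p * m powr (p - 1) * (norm (g x) - m)) \<le> (LINT x:S|M. norm (g x) powr p)"
      using True p gn g const
      by (intro set_integral_mono powr_above_tangent set_integral_add set_integral_diff
          set_integrable_mult_right) auto
    also have "(LINT x:S|M. m powr p + p * m powr (p - 1) * (norm (g x) - m))
        = m powr p * measure M S + p * m powr (p - 1) * ((LINT x:S|M. norm (g x)) - m * measure M S)"
      using gn const
      by (subst set_integral_add set_integral_mult_right set_integral_diff meas;
          (intro set_integral_diff set_integrable_mult_right)?; simp?)+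
    also have "(LINT x:S|M. norm (g x)) - m * measure M S = 0"
      using True by (simp add: m_def)
    finally show ?thesis by (simp add: m_def)
  next
    case False
    have "0 \<le> (LINT x:S|M. norm (g x))" "0 \<le> (LINT x:S|M. norm (g x) powr p)"
      unfolding set_lebesgue_integral_def by (intro Bochner_Integration.integral_nonneg; simp)+
    with False show ?thesis
      by (auto simp: m_def zero_less_divide_iff not_less divide_le_0_iff le_less powr_def split: if_splits)
  qed
qed

lemma (in finite_measure) Lp_integrable:
  fixes g :: "'a \<Rightarrow> 'k::{real_normed_field, banach, second_countable_topology}"
  assumes p: "1 \<le> p" and g: "g \<in> Lp p M"
  shows "integrable M g"
proof (rule Bochner_Integration.integrable_bound)
  show "integrable M (\<lambda>x. 1 + norm (g x) powr p)" using g by (simp add: Lp_def)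
  show "g \<in> borel_measurable M" using g by (simp add: Lp_def)
  have "norm (g x) \<le> 1 + norm (g x) powr p" for x
  proof (cases "norm (g x) \<le> 1")
    case False
    then have "norm (g x) powr 1 \<le> norm (g x) powr p" using p by (intro powr_mono) auto
    then show ?thesis by simp
  qed (simp add: add_increasing2)
  then show "AE x in M. norm (g x) \<le> norm (1 + norm (g x) powr p)" by simp
qed

text \<open>Hoelder's inequality against the constant 1, read off from Jensen's inequality on the
  whole space.\<close>

lemma (in finite_measure) integral_norm_le_Lp_norm:
  fixes g :: "'a \<Rightarrow> 'k::{real_normed_field, banach, second_countable_topology}"
  assumes p: "1 \<le> p" and g: "g \<in> Lp p M"
  shows "(LINT x|M. norm (g x)) \<le> measure M (space M) powr (1 - 1 / p) * Lp_norm p M g"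
proof -
  define V where "V = measure M (space M)"
  define I where "I = (LINT x|M. norm (g x))"
  have I: "0 \<le> I" by (simp add: I_def)
  have gi: "integrable M g" "integrable M (\<lambda>x. norm (g x) powr p)"
    using Lp_integrable[OF p g] g by (auto simp: Lp_def)
  have si: "set_integrable M (space M) g" "set_integrable M (space M) (\<lambda>x. norm (g x) powr p)"
    using gi by (auto simp: set_integrable_def cong: Bochner_Integration.integrable_cong)
  have J: "(I / V) powr p * V \<le> (LINT x|M. norm (g x) powr p)"
    using set_integral_powr_Jensen[OF p sets.top _ si] gi
    by (simp add: set_integral_space I_def V_def emeasure_finite flip: less_top)
  show ?thesis
  proof (cases "V = 0")
    case True
    then have "AE x in M. False"
      using emeasure_eq_measure[of "space M"] by (intro AE_I[of _ _ "space M"]) (auto simp: V_def)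
    then have "I = 0" unfolding I_def by (subst integral_cong_AE[where g="\<lambda>x. 0"]) (use gi in auto)
    then show ?thesis by (simp add: I_def Lp_norm_nonneg)
  next
    case False
    then have V: "V > 0" by (simp add: V_def zero_less_measure_iff order_less_le)
    have "I * V powr (1 / p - 1) = ((I / V) powr p * V) powr (1 / p)"
      using V I p by (simp add: powr_mult powr_powr powr_diff)
    also have "\<dots> \<le> Lp_norm p M g"
      unfolding Lp_norm_def using J V p by (intro powr_mono2) auto
    finally have "I * V powr (1 / p - 1) * V powr (1 - 1 / p) \<le> Lp_norm p M g * V powr (1 - 1 / p)"
      by (intro mult_right_mono) auto
    moreover have "I * V powr (1 / p - 1) * V powr (1 - 1 / p) = I"
      using V by (simp add: mult.assoc flip: powr_add)
    ultimately have "I \<le> Lp_norm p M g * V powr (1 - 1 / p)" by (simp only:)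
    then show ?thesis by (simp add: I_def V_def mult.commute)
  qed
qed

section \<open>Haar systems\<close>

text \<open>\<open>last_hit A n x\<close> is the index of the atom containing \<open>x\<close> in the partition generated by \<open>A 0, \<dots>, A (n - 1)\<close>.
  By condition \<open>A_nested\<close>, passing from \<open>n\<close> to \<open>n + 1\<close> splits a single atom in two.\<close>

primrec last_hit :: "(nat \<Rightarrow> 'a set) \<Rightarrow> nat \<Rightarrow> 'a \<Rightarrow> nat" where
  "last_hit A 0 x = 0"
| "last_hit A (Suc n) x = (if x \<in> A n then n else last_hit A n x)"

lemma weighted_mean_split:
  fixes a d I J :: "'k::field"
  assumes "a \<noteq> 0" "d \<noteq> 0" "a + d \<noteq> 0"
  shows "I / a = (I + J) / (a + d) + (I / a - J / d) * (d / (a + d))"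
proof -
  have "(I / a - J / d) * d = I / a * d - J" using assms by (simp add: left_diff_distrib)
  then have "(I + J) + (I / a - J / d) * d = I / a * (a + d)" using assms by (simp add: distrib_left)
  then show ?thesis using assms by (simp flip: add_divide_distrib)
qed

text \<open>\<open>atom_pos\<close> makes all averages over atoms meaningful; this includes both
  halves of each split, as they are atoms of the next partition.\<close>

locale haar_system = finite_measure M for M :: "'a measure" +
  fixes A :: "nat \<Rightarrow> 'a set"
  assumes space_UNIV: "space M = UNIV"
    and A_0: "A 0 = UNIV"
    and A_sets: "A n \<in> sets M"
    and A_nested: "x \<in> A n \<Longrightarrow> y \<in> A n \<Longrightarrow> last_hit A n x = last_hit A n y"
    and atom_pos: "i < n \<Longrightarrow> 0 < measure M {x. last_hit A n x = i}"
begin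

definition atom :: "nat \<Rightarrow> nat \<Rightarrow> 'a set" where
  "atom n i = {x. last_hit A n x = i}"

definition parent :: "nat \<Rightarrow> nat" where
  "parent n = last_hit A n (SOME x. x \<in> A n)"

text \<open>After the split the remainder of the parent atom keeps the parent's index, while
  \<open>A n\<close> receives the new index \<open>n\<close>.\<close>

definition sibling :: "nat \<Rightarrow> 'a set" where
  "sibling n = atom (Suc n) (parent n)"

lemma last_hit_less: "0 < n \<Longrightarrow> last_hit A n x < n"
proof (induction n)
  case (Suc n)
  then show ?case by (cases "n = 0") (auto simp: A_0 less_SucI)
qed simp

lemma atom_sets [measurable]: "atom n i \<in> sets M"
proof (induction n arbitrary: i)
  case 0
  show ?case using sets.top[of M] by (auto simp: atom_def space_UNIV)
next
  case (Suc n)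
  have "atom (Suc n) i = (if i = n then A n \<union> (atom n i - A n) else atom n i - A n)"
    by (auto simp: atom_def)
  then show ?case using Suc A_sets by auto
qed

lemma last_hit_atom: "x \<in> atom n i \<Longrightarrow> last_hit A n x = i"
  by (simp add: atom_def)

lemma atom_measure_pos: "i < n \<Longrightarrow> 0 < measure M (atom n i)"
  using atom_pos by (simp add: atom_def)

lemma atom_Suc_self: "atom (Suc n) n = A n"
proof (cases "n = 0")
  case False
  then have "last_hit A n x \<noteq> n" for x using last_hit_less[of n x] by simp
  then show ?thesis by (auto simp: atom_def)
qed (simp add: atom_def A_0)

lemma A_measure_pos: "0 < measure M (A n)"
  using atom_measure_pos[of n "Suc n"] by (simp add: atom_Suc_self)

lemma last_hit_A: "x \<in> A n \<Longrightarrow> last_hit A n x = parent n"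
  unfolding parent_def by (metis A_nested someI)

lemma parent_less: "0 < n \<Longrightarrow> parent n < n"
  by (simp add: parent_def last_hit_less)

lemma sibling_measure_pos: "0 < n \<Longrightarrow> 0 < measure M (sibling n)"
  unfolding sibling_def using parent_less[of n] by (intro atom_measure_pos) simp

lemma sibling_sets: "sibling n \<in> sets M"
  by (simp add: sibling_def atom_sets)

lemma parent_atom: "0 < n \<Longrightarrow> atom n (parent n) = A n \<union> sibling n"
  and A_sibling_disjoint: "0 < n \<Longrightarrow> A n \<inter> sibling n = {}"
  using parent_less[of n] by (auto simp: atom_def sibling_def last_hit_A)

lemma last_hit_refine: "m \<le> n \<Longrightarrow> last_hit A n x = last_hit A n y \<Longrightarrow> last_hit A m x = last_hit A m y"
proof (induction n rule: dec_induct)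
  case (step n)
  have "last_hit A n x = last_hit A n y"
  proof (cases "n = 0")
    case False
    then have "last_hit A n x \<noteq> n" "last_hit A n y \<noteq> n"
      using last_hit_less[of n x] last_hit_less[of n y] by auto
    with step.prems have "x \<in> A n \<longleftrightarrow> y \<in> A n" by (metis last_hit.simps(2))
    then show ?thesis using step.prems A_nested[of x n y] by (metis last_hit.simps(2))
  qed simp
  then show ?case by (rule step.IH)
qed

definition avg :: "'a set \<Rightarrow> ('a \<Rightarrow> 'k) \<Rightarrow> 'k::{real_normed_field, banach, second_countable_topology}" where
  "avg S g = (LINT x:S|M. g x) / of_real (measure M S)"

text \<open>The conditional expectation onto the partition into \<open>n\<close> atoms. The value 0
  for \<open>n = 0\<close> makes it the empty partial sum of the Haar expansion.\<close>

definition cond_exp :: "nat \<Rightarrow> ('a \<Rightarrow> 'k) \<Rightarrow> 'a \<Rightarrow> 'k::{real_normed_field, banach, second_countable_topology}" where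
  "cond_exp n g x = (if n = 0 then 0 else avg (atom n (last_hit A n x)) g)"

text \<open>With \<open>a\<close> and \<open>d\<close> the measures of \<open>A n\<close> and its
  sibling, the values are \<open>d / (a + d)\<close> and \<open>- a / (a + d)\<close>: the integral
  is 0 and the jump is 1, so that the coefficient is simply the difference of the two
  averages.\<close>

definition haar :: "nat \<Rightarrow> 'a \<Rightarrow> real" where
  "haar n x = (if n = 0 then 1 else
     (measure M (sibling n) * indicator (A n) x - measure M (A n) * indicator (sibling n) x)
       / measure M (atom n (parent n)))"

definition haar_coeff :: "nat \<Rightarrow> ('a \<Rightarrow> 'k) \<Rightarrow> 'k::{real_normed_field, banach, second_countable_topology}" where
  "haar_coeff n g = (if n = 0 then avg UNIV g else avg (A n) g - avg (sibling n) g)"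

lemma integrable_on_sets:
  fixes g :: "'a \<Rightarrow> 'k::{banach, second_countable_topology}"
  shows "integrable M g \<Longrightarrow> S \<in> sets M \<Longrightarrow> set_integrable M S g"
  unfolding set_integrable_def by (rule integrable_mult_indicator)

lemma set_integral_const:
  fixes c :: "'k::{banach, second_countable_topology}"
  assumes "S \<in> sets M"
  shows "(LINT x:S|M. c) = measure M S *\<^sub>R c"
  using assms by (simp add: set_lebesgue_integral_def emeasure_finite flip: less_top)

lemma cond_exp_Suc:
  fixes g :: "'a \<Rightarrow> 'k::{real_normed_field, banach, second_countable_topology}"
  assumes g: "integrable M g"
  shows "cond_exp (Suc n) g x = cond_exp n g x + haar_coeff n g * of_real (haar n x)"
proof (cases "n = 0")
  case True
  then show ?thesis by (auto simp: cond_exp_def haar_coeff_def haar_def atom_def A_0)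
next
  case False
  then have n: "0 < n" by simp
  define a d where "a = measure M (A n)" "d = measure M (sibling n)"
  define I J where "I = (LINT x:A n|M. g x)" "J = (LINT x:sibling n|M. g x)"
  have ad: "a > 0" "d > 0" using A_measure_pos sibling_measure_pos n by (auto simp: a_d_def)
  have nz: "of_real a \<noteq> (0::'k)" "of_real d \<noteq> (0::'k)" "of_real a + of_real d \<noteq> (0::'k)"
    using ad by (auto simp flip: of_real_add)
  have m: "measure M (atom n (parent n)) = a + d"
    unfolding a_d_def parent_atom[OF n]
    by (rule finite_measure_Union[OF A_sets sibling_sets A_sibling_disjoint[OF n]])
  have i: "(LINT x:atom n (parent n)|M. g x) = I + J"
    unfolding I_J_def parent_atom[OF n]
    using A_sets sibling_sets A_sibling_disjoint[OF n] g
    by (intro set_integral_Un integrable_on_sets) auto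
  have c: "haar_coeff n g = I / of_real a - J / of_real d"
    using n by (simp add: haar_coeff_def avg_def I_J_def a_d_def)
  consider "x \<in> A n" | "x \<in> sibling n" | "x \<notin> A n" "x \<notin> sibling n" by blast
  then show ?thesis
  proof cases
    case 1
    have x: "x \<notin> sibling n" using 1 A_sibling_disjoint[OF n] by blast
    have "cond_exp (Suc n) g x = I / of_real a" "cond_exp n g x = (I + J) / (of_real a + of_real d)"
      using 1 n by (auto simp: cond_exp_def atom_Suc_self avg_def I_J_def(1) a_d_def(1) last_hit_A i m)
    moreover have "haar n x = d / (a + d)"
      using 1 n x by (simp add: haar_def m a_d_def)
    moreover note weighted_mean_split[OF nz, of I J]
    ultimately show ?thesis using c by simp
  next
    case 2
    have x: "x \<notin> A n" using 2 A_sibling_disjoint[OF n] by blast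
    have l: "last_hit A (Suc n) x = parent n" using 2 by (simp add: sibling_def atom_def)
    then have "cond_exp (Suc n) g x = J / of_real d" "cond_exp n g x = (I + J) / (of_real a + of_real d)"
      using n x by (auto simp: cond_exp_def sibling_def[symmetric] avg_def I_J_def(2) a_d_def(2) i m)
    moreover have "haar n x = - a / (a + d)"
      using 2 n x by (simp add: haar_def m a_d_def)
    moreover have "J / of_real d = (I + J) / (of_real a + of_real d)
        + (I / of_real a - J / of_real d) * (- of_real a / (of_real a + of_real d))"
      using weighted_mean_split[of "of_real d" "of_real a" J I] nz
      by (simp add: add.commute algebra_simps)
    ultimately show ?thesis using c by simp
  next
    case 3
    then have ne: "last_hit A n x \<noteq> parent n" using n by (auto simp: sibling_def atom_def)
    then have "atom (Suc n) (last_hit A n x) = atom n (last_hit A n x)"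
      using last_hit_less[OF n, of x] last_hit_A by (auto simp: atom_def)
    then show ?thesis using 3 n by (simp add: cond_exp_def haar_def)
  qed
qed

lemma cond_exp_eq_sum:
  fixes g :: "'a \<Rightarrow> 'k::{real_normed_field, banach, second_countable_topology}"
  assumes "integrable M g"
  shows "cond_exp n g x = (\<Sum>k<n. haar_coeff k g * of_real (haar k x))"
  using assms by (induction n) (auto simp: cond_exp_Suc, simp add: cond_exp_def)

lemma cond_exp_id:
  fixes g :: "'a \<Rightarrow> 'k::{real_normed_field, banach, second_countable_topology}"
  assumes n: "0 < n" and g: "\<And>y. last_hit A n x = last_hit A n y \<Longrightarrow> g x = g y"
  shows "cond_exp n g x = g x"
proof -
  define S where "S = atom n (last_hit A n x)"
  have S: "0 < measure M S" using last_hit_less[OF n] by (simp add: S_def atom_measure_pos)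
  have "(LINT y:S|M. g y) = (LINT y:S|M. g x)"
  proof (intro set_lebesgue_integral_cong allI impI)
    fix y assume "y \<in> S"
    then have "last_hit A n x = last_hit A n y" by (simp add: S_def atom_def)
    then show "g y = g x" by (rule g[symmetric])
  qed (simp add: S_def atom_sets)
  then show ?thesis
    using n S by (simp add: cond_exp_def avg_def S_def atom_sets set_integral_const scaleR_conv_of_real)
qed

lemma haar_const: "j < n \<Longrightarrow> last_hit A n x = last_hit A n y \<Longrightarrow> haar j x = haar j y"
proof -
  assume "j < n" "last_hit A n x = last_hit A n y"
  then have "last_hit A (Suc j) x = last_hit A (Suc j) y" by (intro last_hit_refine[of "Suc j" n]) auto
  then have "x \<in> atom (Suc j) i \<longleftrightarrow> y \<in> atom (Suc j) i" for i by (simp add: atom_def del: last_hit.simps)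
  from this[of j] this[of "parent j"] show ?thesis
    by (simp add: haar_def sibling_def indicator_def atom_Suc_self)
qed

lemma haar_measurable [measurable]: "haar n \<in> borel_measurable M"
  unfolding haar_def using A_sets[of n] sibling_sets[of n] by measurable

lemma haar_bounded: "\<exists>B. \<forall>x. \<bar>haar n x\<bar> \<le> B"
proof -
  define B where "B = 1 + (measure M (sibling n) + measure M (A n)) / measure M (atom n (parent n))"
  have B: "1 \<le> B" by (simp add: B_def)
  have "\<bar>haar n x\<bar> \<le> B" for x
  proof (cases "n = 0")
    case False
    have "\<bar>measure M (sibling n) * indicator (A n) x - measure M (A n) * indicator (sibling n) x\<bar>
        \<le> measure M (sibling n) + measure M (A n)"
      by (auto simp: indicator_def abs_le_iff add_increasing add_increasing2)
    then have "\<bar>haar n x\<bar> \<le> (measure M (sibling n) + measure M (A n)) / measure M (atom n (parent n))"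
      using False by (simp add: haar_def abs_divide divide_right_mono)
    then show ?thesis by (simp add: B_def)
  qed (use B in \<open>simp add: haar_def\<close>)
  then show ?thesis by blast
qed

lemma haar_nonzero: "\<exists>x. haar n x \<noteq> 0"
proof -
  obtain x where x: "x \<in> A n" using A_measure_pos[of n] by (metis all_not_in_conv less_irrefl measure_empty)
  have "x \<notin> sibling n" if "n > 0" using x A_sibling_disjoint[OF that] by blast
  then have "haar n x \<noteq> 0"
    using x sibling_measure_pos[of n] atom_measure_pos[OF parent_less, of n]
    by (cases "n = 0") (auto simp: haar_def)
  then show ?thesis by blast
qed

lemma of_real_haar_integrable:
  "integrable M (\<lambda>x. of_real (haar n x) :: 'k::{real_normed_field, banach, second_countable_topology})"
proof -
  obtain B where "\<forall>x. \<bar>haar n x\<bar> \<le> B" using haar_bounded by blast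
  then show ?thesis by (intro integrable_const_bound[of _ B]) auto
qed

lemma cond_exp_haar:
  "cond_exp n (\<lambda>x. of_real (haar j x) :: 'k::{real_normed_field, banach, second_countable_topology}) x =
     (if j < n then of_real (haar j x) else 0)"
proof (cases "j < n")
  case True
  have "of_real (haar j x) = (of_real (haar j y) :: 'k)" if "last_hit A n x = last_hit A n y" for y
    using haar_const[OF True that] by (rule arg_cong)
  from cond_exp_id[of n x "\<lambda>x. of_real (haar j x)", OF _ this] True show ?thesis by simp
next
  case False
  have "(LINT y:atom n i|M. of_real (haar j y) :: 'k) = 0" if n: "0 < n" for i
  proof -
    have j: "0 < j" using False n by simp
    \<comment> \<open>The atom of level \<open>n\<close> that contains both halves of the later
      split number \<open>j\<close>; \<open>haar j\<close> lives inside it and has integral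
      0.\<close>
    define q where "q = last_hit A n (SOME x. x \<in> A j \<union> sibling j)"
    have *: "last_hit A j y = parent j" if "y \<in> A j \<union> sibling j" for y
      using that unfolding parent_atom[OF j, symmetric] by (simp add: atom_def)
    have q: "last_hit A n y = q" if y: "y \<in> A j \<union> sibling j" for y
    proof -
      have "(SOME x. x \<in> A j \<union> sibling j) \<in> A j \<union> sibling j" by (rule someI[of _ y]) (rule y)
      then show ?thesis
        unfolding q_def using False *[OF y] by (intro last_hit_refine[of n j]) (auto simp only: not_less *)
    qed
    define a d S where "a = measure M (A j)" "d = measure M (sibling j)" "S = measure M (atom j (parent j))"
    have "indicator (atom n i) y *\<^sub>R haar j y =
        (of_bool (q = i) / S) * (d * indicator (A j) y - a * indicator (sibling j) y)" for y
      using j q[of y] by (auto simp: haar_def atom_def a_d_S_def indicator_def)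
    then have "(LINT y:atom n i|M. haar j y) =
        (LINT y|M. (of_bool (q = i) / S) * (d * indicator (A j) y - a * indicator (sibling j) y))"
      by (simp add: set_lebesgue_integral_def)
    also have "\<dots> = 0"
      using A_sets[of j] sibling_sets[of j] by (simp add: a_d_S_def emeasure_finite flip: less_top)
    finally have "(LINT y:atom n i|M. haar j y) = 0" .
    moreover have "(LINT y:atom n i|M. of_real (haar j y) :: 'k) = of_real (LINT y:atom n i|M. haar j y)"
    proof -
      have "integrable M (\<lambda>x. indicator (atom n i) x * haar j x)"
        using integrable_mult_indicator[OF atom_sets of_real_haar_integrable[where 'k=real]] by simp
      then show ?thesis
        by (simp add: set_lebesgue_integral_def scaleR_conv_of_real flip: of_real_mult)
    qed
    ultimately show ?thesis by simp
  qed
  then show ?thesis using False by (simp add: cond_exp_def avg_def)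
qed

text \<open>Compare the partial sums of order \<open>i\<close> and \<open>i + 1\<close> of
  \<open>haar j\<close> itself at a point where \<open>haar i\<close> does not vanish.\<close>

lemma haar_biorthogonal:
  "haar_coeff i (\<lambda>x. of_real (haar j x) :: 'k::{real_normed_field, banach, second_countable_topology}) = of_bool (i = j)"
proof -
  obtain x where x: "haar i x \<noteq> 0" using haar_nonzero by blast
  have "haar_coeff i (\<lambda>x. of_real (haar j x) :: 'k) * of_real (haar i x) = of_bool (i = j) * of_real (haar i x)"
    using cond_exp_Suc[OF of_real_haar_integrable, of i j x, where 'k='k]
    by (cases i j rule: linorder_cases) (simp_all add: cond_exp_haar)
  with x show ?thesis by simp
qed

lemma integral_eq_sum_atoms:
  fixes f :: "'a \<Rightarrow> 'k::{banach, second_countable_topology}"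
  assumes "0 < n" "integrable M f"
  shows "(LINT x|M. f x) = (\<Sum>i<n. LINT x:atom n i|M. f x)"
proof -
  have "(\<Union>i<n. atom n i) = UNIV" using last_hit_less[OF assms(1)] by (auto simp: atom_def)
  moreover have disj: "disjoint_family_on (atom n) {..<n}" by (auto simp: disjoint_family_on_def atom_def)
  have "(LINT x:(\<Union>i\<in>{..<n}. atom n i)|M. f x) = (\<Sum>i\<in>{..<n}. LINT x:atom n i|M. f x)"
    by (rule set_integral_finite_Union[OF _ disj integrable_on_sets[OF assms(2) atom_sets] atom_sets]) simp
  ultimately show ?thesis using set_integral_space[OF assms(2)] space_UNIV by simp
qed

lemma cond_exp_measurable [measurable]:
  fixes g :: "'a \<Rightarrow> 'k::{real_normed_field, banach, second_countable_topology}"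
  assumes "integrable M g"
  shows "cond_exp n g \<in> borel_measurable M"
proof -
  have "cond_exp n g = (\<lambda>x. \<Sum>k<n. haar_coeff k g * of_real (haar k x))"
    using cond_exp_eq_sum[OF assms, of n] by (rule ext)
  then show ?thesis by (simp only:) measurable
qed

lemma cond_exp_bounded:
  fixes g :: "'a \<Rightarrow> 'k::{real_normed_field, banach, second_countable_topology}"
  shows "\<exists>B. \<forall>x. norm (cond_exp n g x) \<le> B"
proof (cases "n = 0")
  case False
  then have "norm (cond_exp n g x) \<le> (\<Sum>i<n. norm (avg (atom n i) g))" for x
    unfolding cond_exp_def using last_hit_less[of n x]
    by (simp add: member_le_sum[of _ _ "\<lambda>i. norm (avg (atom n i) g)"])
  then show ?thesis by blast
qed (auto simp: cond_exp_def)

lemma cond_exp_integrable: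
  fixes g :: "'a \<Rightarrow> 'k::{real_normed_field, banach, second_countable_topology}"
  assumes "integrable M g"
  shows "integrable M (cond_exp n g)"
proof -
  obtain B where "\<forall>x. norm (cond_exp n g x) \<le> B" using cond_exp_bounded by blast
  then show ?thesis using cond_exp_measurable[OF assms] by (intro integrable_const_bound[of _ B]) auto
qed

lemma bounded_in_Lp:
  fixes g :: "'a \<Rightarrow> 'k::{real_normed_field, banach, second_countable_topology}"
  assumes "1 \<le> p" "g \<in> borel_measurable M" "\<And>x. norm (g x) \<le> B"
  shows "g \<in> Lp p M"
proof -
  have "norm (norm (g x) powr p) \<le> B powr p" for x
    using assms(1,3) by (auto intro: powr_mono2)
  then have "integrable M (\<lambda>x. norm (g x) powr p)"
    using assms(2) by (intro integrable_const_bound[of _ "B powr p"]) auto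
  then show ?thesis using assms by (simp add: Lp_def)
qed

lemma cond_exp_in_Lp:
  fixes g :: "'a \<Rightarrow> 'k::{real_normed_field, banach, second_countable_topology}"
  assumes "1 \<le> p" "integrable M g"
  shows "cond_exp n g \<in> Lp p M"
  using cond_exp_bounded[of n g] bounded_in_Lp[OF assms(1) cond_exp_measurable[OF assms(2)]] by blast

text \<open>Jensen's inequality on each atom, where the conditional expectation is constant, summed
  over the atoms.\<close>

lemma cond_exp_contraction:
  fixes g :: "'a \<Rightarrow> 'k::{real_normed_field, banach, second_countable_topology}"
  assumes p: "1 \<le> p" and g: "g \<in> Lp p M"
  shows "Lp_norm p M (cond_exp n g) \<le> Lp_norm p M g"
proof (cases "n = 0")
  case True
  then show ?thesis using p Lp_norm_nonneg by (simp add: cond_exp_def Lp_norm_def)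
next
  case False
  then have n: "0 < n" by simp
  have gi: "integrable M g" "integrable M (\<lambda>x. norm (g x) powr p)"
    using Lp_integrable[OF p g] g by (auto simp: Lp_def)
  have Ei: "integrable M (\<lambda>x. norm (cond_exp n g x) powr p)"
    using cond_exp_in_Lp[OF p gi(1)] by (simp add: Lp_def)
  have "(LINT x:atom n i|M. norm (cond_exp n g x) powr p) \<le> (LINT x:atom n i|M. norm (g x) powr p)"
    if i: "i < n" for i
  proof -
    have pos: "0 < measure M (atom n i)" using atom_measure_pos[OF i] .
    have "(LINT x:atom n i|M. norm (cond_exp n g x) powr p) = (LINT x:atom n i|M. norm (avg (atom n i) g) powr p)"
      using n by (intro set_lebesgue_integral_cong) (simp_all add: atom_sets cond_exp_def last_hit_atom)
    also have "\<dots> = norm (avg (atom n i) g) powr p * measure M (atom n i)"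
      by (simp add: set_integral_const atom_sets)
    also have "\<dots> \<le> ((LINT x:atom n i|M. norm (g x)) / measure M (atom n i)) powr p * measure M (atom n i)"
    proof (intro mult_right_mono powr_mono2)
      have "norm (LINT x:atom n i|M. g x) \<le> (LINT x:atom n i|M. norm (g x))"
        using set_integral_norm_bound[OF integrable_on_sets[OF gi(1) atom_sets]] .
      then show "norm (avg (atom n i) g) \<le> (LINT x:atom n i|M. norm (g x)) / measure M (atom n i)"
        using pos by (simp add: avg_def norm_divide divide_right_mono)
    qed (use p in auto)
    also have "\<dots> \<le> (LINT x:atom n i|M. norm (g x) powr p)"
      using gi by (intro set_integral_powr_Jensen p integrable_on_sets)
        (auto simp: atom_sets emeasure_finite simp flip: less_top)
    finally show ?thesis .
  qed
  then have "(LINT x|M. norm (cond_exp n g x) powr p) \<le> (LINT x|M. norm (g x) powr p)"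
    unfolding integral_eq_sum_atoms[OF n gi(2)] integral_eq_sum_atoms[OF n Ei]
    by (intro sum_mono) simp
  then show ?thesis
    unfolding Lp_norm_def using p by (intro powr_mono2) auto
qed

text \<open>\<open>g - cond_exp n g\<close> has mean zero on every atom, so it is orthogonal to the
  step function \<open>\<sigma>\<close> that samples \<open>\<rho>\<close> at one point of each
  atom; only \<open>\<rho> - \<sigma>\<close>, of size at most \<open>\<epsilon>\<close>,
  contributes. This estimate is what makes moment functionals \<open>tail_small\<close>.\<close>

lemma integral_cond_exp_error_le:
  fixes g :: "'a \<Rightarrow> 'k::{real_normed_field, banach, second_countable_topology}" and \<rho> :: "'a \<Rightarrow> real"
  assumes n: "0 < n" and g: "integrable M g"
    and \<rho>: "\<rho> \<in> borel_measurable M" "\<And>x. \<bar>\<rho> x\<bar> \<le> B"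
      "\<And>x y. last_hit A n x = last_hit A n y \<Longrightarrow> \<bar>\<rho> x - \<rho> y\<bar> \<le> \<epsilon>"
  shows "norm (LINT x|M. \<rho> x *\<^sub>R (g x - cond_exp n g x)) \<le> \<epsilon> * (LINT x|M. norm (g x - cond_exp n g x))"
proof -
  define d where "d x = g x - cond_exp n g x" for x
  define rep where "rep i = (SOME x. last_hit A n x = i)" for i
  define \<sigma> where "\<sigma> x = \<rho> (rep (last_hit A n x))" for x
  have rep: "last_hit A n (rep (last_hit A n x)) = last_hit A n x" for x
    unfolding rep_def by (rule someI) (rule refl)
  have d: "integrable M d" unfolding d_def using g cond_exp_integrable[OF g] by auto
  have dmeas[measurable]: "d \<in> borel_measurable M" using d by auto
  note \<rho>(1)[measurable]
  have "\<sigma> x = (\<Sum>i<n. \<rho> (rep i) * indicator (atom n i) x)" for x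
    using last_hit_less[OF n, of x]
    by (simp add: \<sigma>_def atom_def indicator_def if_distrib[of "(*) _"] cong: if_cong)
  then have "\<sigma> = (\<lambda>x. \<Sum>i<n. \<rho> (rep i) * indicator (atom n i) x)" by (rule ext)
  then have \<sigma>_meas[measurable]: "\<sigma> \<in> borel_measurable M" by (simp only:) measurable
  have int: "integrable M (\<lambda>x. s x *\<^sub>R d x)" if "s \<in> borel_measurable M" "\<And>x. \<bar>s x\<bar> \<le> B" for s
  proof (rule Bochner_Integration.integrable_bound)
    show "integrable M (\<lambda>x. B * norm (d x))" using d by auto
    show "AE x in M. norm (s x *\<^sub>R d x) \<le> norm (B * norm (d x))"
    proof (intro AE_I2)
      fix x
      have "\<bar>s x\<bar> \<le> \<bar>B\<bar>" using that(2)[of x] by linarith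
      then show "norm (s x *\<^sub>R d x) \<le> norm (B * norm (d x))" by (simp add: abs_mult mult_right_mono)
    qed
  qed (use that in measurable)
  have "(LINT x:atom n i|M. \<sigma> x *\<^sub>R d x) = 0" if i: "i < n" for i
  proof -
    have pos: "0 < measure M (atom n i)" using atom_measure_pos[OF i] .
    have "(LINT x:atom n i|M. \<sigma> x *\<^sub>R d x) = (LINT x:atom n i|M. \<rho> (rep i) *\<^sub>R (g x - avg (atom n i) g))"
      using n by (intro set_lebesgue_integral_cong)
        (simp_all add: atom_sets cond_exp_def last_hit_atom \<sigma>_def d_def)
    also have "\<dots> = \<rho> (rep i) *\<^sub>R (LINT x:atom n i|M. g x - avg (atom n i) g)"
      by (rule set_integral_scaleR_right)
    also have "(LINT x:atom n i|M. g x - avg (atom n i) g) = (LINT x:atom n i|M. g x) - (LINT x:atom n i|M. avg (atom n i) g)"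
      using g by (intro set_integral_diff integrable_on_sets) (auto simp: atom_sets)
    also have "\<dots> = 0"
      using pos by (simp add: set_integral_const atom_sets avg_def scaleR_conv_of_real)
    finally show ?thesis by simp
  qed
  then have "(LINT x|M. \<sigma> x *\<^sub>R d x) = 0"
    using integral_eq_sum_atoms[OF n int[of \<sigma>]] \<rho>(2) by (simp add: \<sigma>_def[symmetric]) (simp add: \<sigma>_def)
  then have "(LINT x|M. \<rho> x *\<^sub>R d x) = (LINT x|M. (\<rho> x - \<sigma> x) *\<^sub>R d x)"
    using int[of \<sigma>] int[of \<rho>] \<rho>(2) by (simp add: scaleR_diff_left \<sigma>_def)
  also have "norm \<dots> \<le> (LINT x|M. norm ((\<rho> x - \<sigma> x) *\<^sub>R d x))" by (rule integral_norm_bound)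
  also have "\<dots> \<le> (LINT x|M. \<epsilon> * norm (d x))"
  proof (rule integral_mono_AE')
    show "AE x in M. norm ((\<rho> x - \<sigma> x) *\<^sub>R d x) \<le> \<epsilon> * norm (d x)"
      using \<rho>(3) rep by (intro AE_I2) (simp add: \<sigma>_def mult_right_mono)
    have "0 \<le> \<epsilon>" using \<rho>(3)[of undefined undefined] by simp
    then show "AE x in M. 0 \<le> \<epsilon> * norm (d x)" by simp
  qed (use d in auto)
  finally show ?thesis by (simp add: d_def)
qed

end

section \<open>A Haar system on Euclidean space\<close>

text \<open>In binary, \<open>code G t x\<close> records the membership of \<open>x\<close> in \<open>G 0, \<dots>, G (t - 1)\<close>; so \<open>code_set G n\<close> is a cell of
  level \<open>t\<close> whenever \<open>2 ^ (t - 1) \<le> n < 2 ^ t\<close>, namely the half inside \<open>G (t - 1)\<close> of its parent cell.\<close>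

definition code :: "(nat \<Rightarrow> 'a set) \<Rightarrow> nat \<Rightarrow> 'a \<Rightarrow> nat" where
  "code G t x = set_encode {i. i < t \<and> x \<in> G i}"

definition code_set :: "(nat \<Rightarrow> 'a set) \<Rightarrow> nat \<Rightarrow> 'a set" where
  "code_set G n = {x. \<exists>t. code G t x = n}"

lemma code_0: "code G 0 x = 0"
  by (simp add: code_def)

lemma code_Suc: "code G (Suc t) x = code G t x + (if x \<in> G t then 2 ^ t else 0)"
proof -
  have "{i. i < Suc t \<and> x \<in> G i} = (if x \<in> G t then insert t {i. i < t \<and> x \<in> G i} else {i. i < t \<and> x \<in> G i})"
    by (auto simp: less_Suc_eq)
  then show ?thesis by (simp add: code_def)
qed

lemma code_less: "code G t x < 2 ^ t"
  by (induction t) (auto simp: code_0 code_Suc)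

lemma code_mono: "s \<le> t \<Longrightarrow> code G s x \<le> code G t x"
  by (induction t rule: dec_induct) (auto simp: code_Suc)

lemma code_eq_iff: "code G t x = code G t y \<longleftrightarrow> (\<forall>i<t. x \<in> G i \<longleftrightarrow> y \<in> G i)"
  unfolding code_def by (subst set_encode_eq) auto

lemma code_truncate: "s \<le> t \<Longrightarrow> code G t x < 2 ^ s \<Longrightarrow> code G t x = code G s x"
proof (induction t rule: dec_induct)
  case (step t)
  have "x \<notin> G t"
  proof
    assume "x \<in> G t"
    then have "code G t x + 2 ^ t < 2 ^ s" using step.prems by (simp add: code_Suc)
    then have "2 ^ t < (2 ^ s :: nat)" by (rule le_less_trans[OF le_add2])
    moreover have "(2 ^ s :: nat) \<le> 2 ^ t" using step.hyps by (intro power_increasing) auto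
    ultimately show False by simp
  qed
  then show ?case using step by (simp add: code_Suc)
qed simp

lemma code_eqI:
  assumes "i < 2 ^ T" "\<And>k. k < T \<Longrightarrow> x \<in> G k \<longleftrightarrow> k \<in> set_decode i"
  shows "code G T x = i"
proof -
  have "k < T" if "k \<in> set_decode i" for k
  proof (rule ccontr)
    assume "\<not> k < T"
    then have "i < 2 ^ k" using assms(1) by (meson less_le_trans not_less one_le_numeral power_increasing)
    then show False using that by (simp add: set_decode_def)
  qed
  then have "{k. k < T \<and> x \<in> G k} = set_decode i" using assms(2) by blast
  then show ?thesis by (simp add: code_def)
qed

lemma mem_set_decode_code: "k \<in> set_decode (code G t x) \<longleftrightarrow> k < t \<and> x \<in> G k"
  by (simp add: code_def)

lemma code_set_0: "code_set G 0 = UNIV"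
  by (auto simp: code_set_def intro: exI[of _ 0] code_0)

lemma last_hit_eqI:
  assumes "i < n" "x \<in> A i" "\<And>j. i < j \<Longrightarrow> j < n \<Longrightarrow> x \<notin> A j"
  shows "last_hit A n x = i"
  using assms
proof (induction n)
  case (Suc n)
  then show ?case by (cases "i = n") auto
qed simp

text \<open>A later code of \<open>x\<close> that differs from \<open>code G t x\<close> has a digit
  at place \<open>t\<close> or beyond, so it is at least \<open>2 ^ t\<close>; by monotonicity it is
  also at least \<open>code G (Suc t) x\<close>. Under either alternative no index strictly between
  \<open>code G t x\<close> and \<open>n\<close> hits \<open>x\<close>.\<close>

lemma last_hit_code_set:
  assumes "code G t x < n" "n \<le> code G (Suc t) x \<or> n \<le> 2 ^ t"
  shows "last_hit (code_set G) n x = code G t x"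
proof (rule last_hit_eqI)
  show "x \<in> code_set G (code G t x)" by (auto simp: code_set_def)
  fix j assume j: "code G t x < j" "j < n"
  show "x \<notin> code_set G j"
  proof
    assume "x \<in> code_set G j"
    then obtain t' where t': "code G t' x = j" by (auto simp: code_set_def)
    have "t < t'" using code_mono[of t' t G x] j t' by (metis not_less)
    then have "code G (Suc t) x \<le> j" using code_mono[of "Suc t" t' G x] t' by simp
    then have "j < 2 ^ t" using assms(2) j by linarith
    then show False using code_truncate[of t t' G x] \<open>t < t'\<close> j t' by simp
  qed
qed (rule assms)

text \<open>If \<open>2 ^ t \<le> n < 2 ^ Suc t\<close>, the points of \<open>code_set G n\<close>
  have code \<open>n\<close> at level \<open>Suc t\<close>; removing the top digit shows that their
  common atom is the one with index \<open>n - 2 ^ t\<close>.\<close>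

lemma code_set_nested:
  assumes "x \<in> code_set G n" "y \<in> code_set G n"
  shows "last_hit (code_set G) n x = last_hit (code_set G) n y"
proof (cases "n = 0")
  case False
  obtain t where t: "2 ^ t \<le> n" "n < 2 ^ Suc t"
    using ex_power_ivl1[of 2 n] False by auto
  have "last_hit (code_set G) n z = n - 2 ^ t" if z: "z \<in> code_set G n" for z
  proof -
    obtain t' where t': "code G t' z = n" using z unfolding code_set_def by blast
    have "Suc t \<le> t'"
    proof (rule ccontr)
      assume "\<not> Suc t \<le> t'"
      then have "(2::nat) ^ t' \<le> 2 ^ t" by (intro power_increasing) auto
      then have "n < 2 ^ t" using code_less[of G t' z] t' by (metis less_le_trans)
      then show False using t by simp
    qed
    then have c: "code G (Suc t) z = n" using code_truncate[of "Suc t" t' G z] t t' by simp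
    then have "code G t z = n - 2 ^ t" "code G t z < n"
      using t code_less[of G t z] by (auto simp: code_Suc split: if_splits)
    then show ?thesis using last_hit_code_set[of G t z n] c by simp
  qed
  then show ?thesis using assms by simp
qed simp

lemma haar_system_code_set:
  fixes M :: "'a measure"
  assumes "finite_measure M" "space M = UNIV"
    and G[measurable]: "\<And>k. G k \<in> sets M"
    and pos: "\<And>T I. \<exists>U\<in>sets M. U \<subseteq> {x. \<forall>k<T. x \<in> G k \<longleftrightarrow> k \<in> I} \<and> 0 < measure M U"
  shows "haar_system M (code_set G)"
proof -
  interpret finite_measure M by fact
  have cell[measurable]: "{x. \<forall>k<T. x \<in> G k \<longleftrightarrow> k \<in> I} \<in> sets M" for T I
  proof -
    have "{x. \<forall>k<T. x \<in> G k \<longleftrightarrow> k \<in> I} = {x\<in>space M. \<forall>k\<in>{..<T}. x \<in> G k \<longleftrightarrow> k \<in> I}"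
      using assms(2) by auto
    also have "\<dots> \<in> sets M" by measurable
    finally show ?thesis .
  qed
  have code_sets: "{x. code G t x = n} \<in> sets M" for t n
  proof (cases "n < 2 ^ t")
    case True
    have "{x. code G t x = n} = {x. \<forall>k<t. x \<in> G k \<longleftrightarrow> k \<in> set_decode n}"
      using mem_set_decode_code[of _ G t] by (intro Collect_cong iffI code_eqI[OF True]) auto
    then show ?thesis by simp
  next
    case False
    then have "{x. code G t x = n} = {}" using code_less[of G t] by force
    then show ?thesis by simp
  qed
  have A_sets: "code_set G n \<in> sets M" for n
  proof -
    have "code_set G n = (\<Union>t. {x. code G t x = n})" by (auto simp: code_set_def)
    then show ?thesis using code_sets by auto
  qed
  have "0 < measure M {x. last_hit (code_set G) n x = i}" if "i < n" for n i
  proof -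
    \<comment> \<open>Level \<open>n\<close> is deep enough: \<open>i < n \<le> 2 ^ n\<close> is a
      possible code there, and the points with that code lie in atom \<open>i\<close>.\<close>
    define T where "T = n"
    have T: "n \<le> 2 ^ T" unfolding T_def by (simp add: less_imp_le)
    have lh_sets: "{x. last_hit (code_set G) n x = i} \<in> sets M" for n i
    proof (induction n arbitrary: i)
      case 0
      show ?case using sets.top[of M] assms(2) by auto
    next
      case (Suc n)
      have "{x. last_hit (code_set G) (Suc n) x = i} =
        (if i = n then code_set G n \<union> ({x. last_hit (code_set G) n x = i} - code_set G n)
         else {x. last_hit (code_set G) n x = i} - code_set G n)"
        by auto
      then show ?case using Suc A_sets by auto
    qed
    obtain U where U: "U \<in> sets M" "U \<subseteq> {x. \<forall>k<T. x \<in> G k \<longleftrightarrow> k \<in> set_decode i}" "0 < measure M U"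
      using pos[of T "set_decode i"] by auto
    note U(3)
    also have "\<dots> \<le> measure M {x. last_hit (code_set G) n x = i}"
    proof (rule finite_measure_mono)
      have "last_hit (code_set G) n x = i" if x: "\<forall>k<T. x \<in> G k \<longleftrightarrow> k \<in> set_decode i" for x
      proof -
        have "code G T x = i" using x \<open>i < n\<close> T by (intro code_eqI) auto
        then show ?thesis using last_hit_code_set[of G T x n] \<open>i < n\<close> T by simp
      qed
      then show "U \<subseteq> {x. last_hit (code_set G) n x = i}" using U(2) by blast
    qed (rule lh_sets)
    finally show ?thesis .
  qed
  then show ?thesis
    unfolding haar_system_def haar_system_axioms_def
    using assms(1,2) A_sets code_set_0[of G] code_set_nested[of _ G] by blast
qed

section \<open>Dyadic cells in coordinates squashed to the unit interval\<close>

definition squash :: "real \<Rightarrow> real" where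
  "squash r = 1 / 2 + arctan r / pi"

lemma squash_bounds: "0 < squash r" "squash r < 1"
  using arctan_bounded[of r] by (auto simp: squash_def field_simps)

lemma squash_tan: "0 < v \<Longrightarrow> v < 1 \<Longrightarrow> squash (tan (pi * (v - 1 / 2))) = v"
  by (subst squash_def, subst arctan_tan) (auto simp: field_simps)

lemma continuous_squash [continuous_intros]:
  "continuous_on S f \<Longrightarrow> continuous_on S (\<lambda>x. squash (f x))"
  unfolding squash_def by (intro continuous_intros) auto

lemma squash_less_iff: "squash a < squash b \<longleftrightarrow> a < b"
  by (simp add: squash_def divide_less_cancel arctan_less_iff)

text \<open>The inverse of \<open>squash\<close> is uniformly continuous only away from 0 and 1, but
  it suffices that one of the two points is bounded. \<open>m a\<close> is the smaller change of
  \<open>squash\<close> over a move by \<open>d\<close> to either side of \<open>a\<close>; it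
  attains a positive minimum on a compact interval, which \<open>\<bar>R\<bar>\<close> keeps
  nonempty.\<close>

lemma squash_inverse_uniform:
  assumes "0 < d"
  obtains \<eta> where "0 < \<eta>" "\<And>a b. \<bar>a\<bar> \<le> R \<Longrightarrow> \<bar>squash a - squash b\<bar> < \<eta> \<Longrightarrow> \<bar>a - b\<bar> < d"
proof -
  define m where "m a = min (squash (a + d) - squash a) (squash a - squash (a - d))" for a
  have "continuous_on {-\<bar>R\<bar>..\<bar>R\<bar>} m"
    unfolding m_def by (intro continuous_intros)
  then obtain a0 where a0: "\<And>a. \<bar>a\<bar> \<le> \<bar>R\<bar> \<Longrightarrow> m a0 \<le> m a"
    using continuous_attains_inf[of "{-\<bar>R\<bar>..\<bar>R\<bar>}" m] by (force simp: abs_le_iff minus_le_iff)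
  show ?thesis
  proof
    show "0 < m a0" using assms by (simp add: m_def squash_less_iff)
    fix a b assume ab: "\<bar>a\<bar> \<le> R" "\<bar>squash a - squash b\<bar> < m a0"
    have le: "squash u \<le> squash v" if "u \<le> v" for u v using that squash_less_iff[of v u] by linarith
    have "m a0 \<le> m a" using a0 ab(1) by simp
    then show "\<bar>a - b\<bar> < d"
      using ab(2) le[of "a + d" b] le[of b "a - d"] by (simp add: m_def) linarith
  qed
qed

text \<open>The parity of \<open>\<lfloor>2 ^ Suc k * v\<rfloor>\<close> is the binary digit
  \<open>k + 1\<close> of \<open>v\<close>. Reading the prescribed digits as an integer
  \<open>m\<close> gives the dyadic interval, starting at \<open>m / 2 ^ K\<close> and of length
  \<open>1 / 2 ^ K\<close>, on which all of them are realised.\<close>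

lemma binary_digits:
  fixes b :: "nat \<Rightarrow> bool"
  obtains m :: int where "0 \<le> m" "m < 2 ^ K"
    "\<And>v k. of_int m \<le> 2 ^ K * v \<Longrightarrow> 2 ^ K * v < of_int m + (1::real) \<Longrightarrow> k < K \<Longrightarrow> odd \<lfloor>2 ^ Suc k * v\<rfloor> = b k"
proof -
  have "\<exists>m::int. 0 \<le> m \<and> m < 2 ^ K \<and> (\<forall>v. of_int m \<le> 2 ^ K * v \<and> 2 ^ K * v < of_int m + (1::real) \<longrightarrow>
      (\<forall>k<K. odd \<lfloor>2 ^ Suc k * v\<rfloor> = b k))"
  proof (induction K)
    case (Suc K)
    then obtain m :: int where m: "0 \<le> m" "m < 2 ^ K"
      "\<And>v k. of_int m \<le> 2 ^ K * v \<Longrightarrow> 2 ^ K * v < of_int m + (1::real) \<Longrightarrow> k < K \<Longrightarrow> odd \<lfloor>2 ^ Suc k * v\<rfloor> = b k"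
      by blast
    define m' where "m' = 2 * m + of_bool (b K)"
    have "odd \<lfloor>2 ^ Suc k * v\<rfloor> = b k"
      if v: "of_int m' \<le> 2 ^ Suc K * v" "2 ^ Suc K * v < of_int m' + (1::real)" and k: "k < Suc K" for v k
    proof (cases "k = K")
      case True
      have "\<lfloor>2 ^ Suc K * v\<rfloor> = m'" using v by (intro floor_unique) auto
      then show ?thesis by (simp add: True m'_def)
    next
      case False
      have "of_int m \<le> 2 ^ K * v" "2 ^ K * v < of_int m + 1"
        using v by (auto simp: m'_def split: if_splits) (cases "b K"; simp)+
      with m(3)[of v k] False k show ?thesis by simp
    qed
    moreover have "0 \<le> m'" "m' < 2 ^ Suc K" using m(1,2) by (auto simp: m'_def)
    ultimately show ?case by blast
  qed (auto intro: exI[of _ 0])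
  then show ?thesis using that by blast
qed

text \<open>The converse direction: equal integer parts and equal digits put two points into the
  same dyadic interval.\<close>

lemma floor_dyadic_eq:
  fixes u v :: real
  assumes "\<lfloor>u\<rfloor> = \<lfloor>v\<rfloor>" "\<And>k. k < K \<Longrightarrow> odd \<lfloor>2 ^ Suc k * u\<rfloor> = odd \<lfloor>2 ^ Suc k * v\<rfloor>"
  shows "\<lfloor>2 ^ K * u\<rfloor> = \<lfloor>2 ^ K * v\<rfloor>"
  using assms(2)
proof (induction K)
  case (Suc K)
  have double: "\<lfloor>2 * r\<rfloor> = 2 * \<lfloor>r\<rfloor> \<or> \<lfloor>2 * r\<rfloor> = 2 * \<lfloor>r\<rfloor> + 1" for r :: real
    by linarith
  have "\<lfloor>2 ^ K * u\<rfloor> = \<lfloor>2 ^ K * v\<rfloor>" using Suc by simp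
  moreover have "odd \<lfloor>2 * (2 ^ K * u)\<rfloor> = odd \<lfloor>2 * (2 ^ K * v)\<rfloor>"
    using Suc.prems[of K] by (simp add: mult.assoc)
  ultimately have "\<lfloor>2 * (2 ^ K * u)\<rfloor> = \<lfloor>2 * (2 ^ K * v)\<rfloor>"
    using double[of "2 ^ K * u"] double[of "2 ^ K * v"] by auto
  then show ?case by (simp add: mult.assoc)
qed (use assms(1) in simp)

definition basis_enum :: "nat \<Rightarrow> 'a::euclidean_space" where
  "basis_enum = (SOME \<beta>. bij_betw \<beta> {0..<DIM('a)} Basis)"

lemma bij_basis_enum: "bij_betw basis_enum {0..<DIM('a)} (Basis :: 'a::euclidean_space set)"
  unfolding basis_enum_def using ex_bij_betw_nat_finite[OF finite_Basis] by (rule someI_ex)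

text \<open>The set with index \<open>k * DIM('a) + r\<close> prescribes the binary digit \<open>k + 1\<close> of the squashed coordinate \<open>r\<close>.\<close>

definition grid :: "nat \<Rightarrow> 'a::euclidean_space set" where
  "grid s = {x. odd \<lfloor>2 ^ Suc (s div DIM('a)) * squash (x \<bullet> basis_enum (s mod DIM('a)))\<rfloor>}"

lemma grid_borel: "grid s \<in> sets borel"
proof -
  have [measurable]: "(\<lambda>x::'a. squash (x \<bullet> basis_enum (s mod DIM('a)))) \<in> borel_measurable borel"
    by (intro borel_measurable_continuous_onI continuous_intros)
  show ?thesis unfolding grid_def by measurable
qed

text \<open>Supplies the positive measure that a Haar system requires of its cells. Fixing the first
  \<open>T\<close> digits of every coordinate decides at least the first \<open>T\<close> grid sets;
  \<open>U\<close> is the interior of the resulting dyadic box in squashed coordinates, and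
  \<open>z\<close> corresponds to its centre.\<close>

lemma grid_cell_contains_open:
  obtains U :: "'a::euclidean_space set" where "open U" "U \<noteq> {}" "U \<subseteq> {x. \<forall>k<T. x \<in> grid k \<longleftrightarrow> k \<in> I}"
proof -
  let ?N = "DIM('a)"
  let ?\<beta> = "basis_enum :: nat \<Rightarrow> 'a"
  have "\<exists>m::int. 0 \<le> m \<and> m < 2 ^ T \<and> (\<forall>v k. of_int m \<le> 2 ^ T * v \<longrightarrow> 2 ^ T * v < of_int m + (1::real) \<longrightarrow>
      k < T \<longrightarrow> odd \<lfloor>2 ^ Suc k * v\<rfloor> = (k * ?N + r \<in> I))" for r
    using binary_digits[of T "\<lambda>k. k * ?N + r \<in> I"] by metis
  then obtain m :: "nat \<Rightarrow> int" where m: "\<And>r. 0 \<le> m r" "\<And>r. m r < 2 ^ T"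
    "\<And>r v k. of_int (m r) \<le> 2 ^ T * v \<Longrightarrow> 2 ^ T * v < of_int (m r) + (1::real) \<Longrightarrow>
      k < T \<Longrightarrow> odd \<lfloor>2 ^ Suc k * v\<rfloor> = (k * ?N + r \<in> I)"
    by metis
  define U where "U = (\<Inter>r<?N. {x. of_int (m r) < 2 ^ T * squash (x \<bullet> ?\<beta> r)} \<inter>
      {x. 2 ^ T * squash (x \<bullet> ?\<beta> r) < of_int (m r) + 1})"
  show ?thesis
  proof
    show "open U" unfolding U_def
      by (intro open_INT open_Int ballI open_Collect_less continuous_intros) auto
    define \<xi> where "\<xi> r = tan (pi * ((of_int (m r) + 1 / 2) / 2 ^ T - 1 / 2))" for r
    define z where "z = (\<Sum>r<?N. \<xi> r *\<^sub>R ?\<beta> r)"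
    have z: "z \<bullet> ?\<beta> r = \<xi> r" if "r < ?N" for r
    proof -
      have "?\<beta> i \<bullet> ?\<beta> r = of_bool (i = r)" if "i < ?N" for i
        using bij_basis_enum[where 'a='a] that \<open>r < ?N\<close>
        by (subst inner_Basis) (auto simp: bij_betw_def inj_on_def)
      then have "z \<bullet> ?\<beta> r = (\<Sum>i<?N. \<xi> i * of_bool (i = r))"
        by (simp add: z_def inner_sum_left)
      then show ?thesis using that by (simp add: of_bool_def if_distrib cong: if_cong)
    qed
    have "squash (\<xi> r) = (of_int (m r) + 1 / 2) / 2 ^ T" for r
    proof -
      have "of_int (m r + 1) \<le> (of_int (2 ^ T) :: real)" "0 \<le> (of_int (m r) :: real)"
        using m(1,2)[of r] by (auto simp del: of_int_power of_int_add)
      then show ?thesis unfolding \<xi>_def by (intro squash_tan) (auto simp: field_simps)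
    qed
    then have "z \<in> U" by (auto simp: U_def z)
    then show "U \<noteq> {}" by blast
    show "U \<subseteq> {x. \<forall>k<T. x \<in> grid k \<longleftrightarrow> k \<in> I}"
    proof (intro subsetI CollectI allI impI)
      fix x k assume x: "x \<in> U" and k: "k < T"
      have "k div ?N < T" using k by (meson div_le_dividend le_less_trans)
      moreover have "k mod ?N < ?N" by simp
      moreover have "k div ?N * ?N + k mod ?N = k" by simp
      moreover from this have "of_int (m (k mod ?N)) < 2 ^ T * squash (x \<bullet> ?\<beta> (k mod ?N))"
        "2 ^ T * squash (x \<bullet> ?\<beta> (k mod ?N)) < of_int (m (k mod ?N)) + 1"
        using x by (auto simp: U_def)
      ultimately show "x \<in> grid k \<longleftrightarrow> k \<in> I"
        using m(3)[of "k mod ?N" "squash (x \<bullet> ?\<beta> (k mod ?N))" "k div ?N"]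
        by (simp add: grid_def)
    qed
  qed
qed

text \<open>Points of one cell of level \<open>K * DIM('a)\<close> share the first \<open>K\<close>
  digits of every coordinate. If one of them lies in the ball of radius \<open>R\<close>, they are
  close in the usual distance and uniform continuity applies; otherwise both values are below
  \<open>\<epsilon> / 2\<close>. The radius \<open>\<bar>R\<bar> + 1\<close> and
  \<open>\<delta> \<le> 1\<close> keep the second point inside the compact ball.\<close>

lemma grid_oscillation:
  fixes g :: "'a::euclidean_space \<Rightarrow> 'b::real_normed_vector"
  assumes cont: "continuous_on UNIV g" and lim: "(g \<longlongrightarrow> 0) at_infinity" and e: "0 < \<epsilon>"
  obtains s where "\<And>x y. code grid s x = code grid s y \<Longrightarrow> norm (g x - g y) < \<epsilon>"
proof -
  let ?N = "DIM('a)"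
  let ?\<beta> = "basis_enum :: nat \<Rightarrow> 'a"
  obtain R where R: "\<And>x. R \<le> norm x \<Longrightarrow> norm (g x) < \<epsilon> / 2"
    using tendstoD[OF lim, of "\<epsilon> / 2"] e by (auto simp: eventually_at_infinity)
  have "uniformly_continuous_on (cball 0 (\<bar>R\<bar> + 1)) g"
    by (intro compact_uniformly_continuous continuous_on_subset[OF cont]) auto
  then obtain \<delta>0 where \<delta>0: "0 < \<delta>0" "\<And>x y. norm x \<le> \<bar>R\<bar> + 1 \<Longrightarrow> norm y \<le> \<bar>R\<bar> + 1 \<Longrightarrow> dist y x < \<delta>0 \<Longrightarrow> dist (g y) (g x) < \<epsilon>"
    using e unfolding uniformly_continuous_on_def by (metis mem_cball_0)
  define \<delta> where "\<delta> = min \<delta>0 1"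
  have \<delta>: "0 < \<delta>" "\<delta> \<le> 1" "\<delta> \<le> \<delta>0" using \<delta>0(1) by (auto simp: \<delta>_def)
  have "0 < \<delta> / ?N" using \<delta> by simp
  then obtain \<eta> where \<eta>: "0 < \<eta>" "\<And>a b. \<bar>a\<bar> \<le> R \<Longrightarrow> \<bar>squash a - squash b\<bar> < \<eta> \<Longrightarrow> \<bar>a - b\<bar> < \<delta> / ?N"
    using squash_inverse_uniform[of "\<delta> / ?N" R] by metis
  obtain K where K: "(1 / 2) ^ K < \<eta>" using real_arch_pow_inv[OF \<eta>(1), of "1 / 2"] by auto
  have near: "norm (g x - g y) < \<epsilon>" if c: "code grid (K * ?N) x = code grid (K * ?N) y" and x: "norm x < R" for x y :: 'a
  proof -
    have coord: "\<bar>x \<bullet> ?\<beta> r - y \<bullet> ?\<beta> r\<bar> < \<delta> / ?N" if r: "r < ?N" for r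
    proof (rule \<eta>(2))
      have "?\<beta> r \<in> Basis" using bij_basis_enum[where 'a='a] r by (auto simp: bij_betw_def)
      then show "\<bar>x \<bullet> ?\<beta> r\<bar> \<le> R" using Basis_le_norm[of "?\<beta> r" x] x by linarith
      define u v where "u = squash (x \<bullet> ?\<beta> r)" "v = squash (y \<bullet> ?\<beta> r)"
      have fl: "\<lfloor>u\<rfloor> = 0" "\<lfloor>v\<rfloor> = 0"
        using squash_bounds by (auto simp: u_v_def floor_eq_iff less_imp_le)
      have "\<lfloor>2 ^ K * u\<rfloor> = \<lfloor>2 ^ K * v\<rfloor>"
      proof (rule floor_dyadic_eq)
        fix k assume k: "k < K"
        have "k * ?N + r < Suc k * ?N" using r by simp
        also have "\<dots> \<le> K * ?N" using k by (intro mult_right_mono) auto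
        finally have "x \<in> grid (k * ?N + r) \<longleftrightarrow> y \<in> grid (k * ?N + r)"
          using c unfolding code_eq_iff by blast
        then show "odd \<lfloor>2 ^ Suc k * u\<rfloor> = odd \<lfloor>2 ^ Suc k * v\<rfloor>"
          using r by (simp add: grid_def u_v_def)
      qed (simp add: fl)
      then have "\<bar>2 ^ K * u - 2 ^ K * v\<bar> < 1" by linarith
      then have "2 ^ K * \<bar>u - v\<bar> < 1" by (simp add: abs_mult flip: right_diff_distrib)
      then have "\<bar>u - v\<bar> < (1 / 2) ^ K" by (simp add: field_simps power_divide)
      then show "\<bar>squash (x \<bullet> ?\<beta> r) - squash (y \<bullet> ?\<beta> r)\<bar> < \<eta>" using K by (simp add: u_v_def)
    qed
    have "norm (y - x) \<le> (\<Sum>b\<in>Basis. \<bar>(y - x) \<bullet> b\<bar>)" by (rule norm_le_l1)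
    also have "\<dots> = (\<Sum>r<?N. \<bar>(y - x) \<bullet> ?\<beta> r\<bar>)"
      using sum.reindex_bij_betw[OF bij_basis_enum[where 'a='a], of "\<lambda>b. \<bar>(y - x) \<bullet> b\<bar>"] by (simp add: atLeast0LessThan)
    also have "\<dots> < (\<Sum>r<?N. \<delta> / ?N)"
      using coord by (intro sum_strict_mono) (auto simp: inner_diff_left abs_minus_commute lessThan_empty_iff)
    also have "\<dots> = \<delta>" by simp
    finally have "norm (y - x) < \<delta>" .
    moreover have "norm y \<le> norm x + norm (y - x)" using norm_triangle_ineq[of x "y - x"] by simp
    ultimately have "dist (g y) (g x) < \<epsilon>"
      using x \<delta> by (intro \<delta>0(2)) (auto simp: dist_norm)
    then show ?thesis by (simp add: dist_norm norm_minus_commute)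
  qed
  have "norm (g x - g y) < \<epsilon>" if c: "code grid (K * ?N) x = code grid (K * ?N) y" for x y :: 'a
  proof (cases "norm x < R \<or> norm y < R")
    case True
    then show ?thesis using near[OF c] near[OF c[symmetric]] by (auto simp: norm_minus_commute)
  next
    case False
    then have "norm (g x) < \<epsilon> / 2" "norm (g y) < \<epsilon> / 2" using R by auto
    then show ?thesis using norm_triangle_ineq4[of "g x" "g y"] by linarith
  qed
  then show ?thesis using that by blast
qed

section \<open>Heat flow and vanishing moments\<close>

text \<open>The derivatives of \<open>exp (- u\<^sup>2)\<close>, up to sign the Hermite polynomials
  times the Gaussian, in the form of their three-term recurrence.\<close>

fun gauss_deriv :: "nat \<Rightarrow> real \<Rightarrow> real" where
  "gauss_deriv 0 u = exp (- u\<^sup>2)"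
| "gauss_deriv (Suc 0) u = - 2 * u * exp (- u\<^sup>2)"
| "gauss_deriv (Suc (Suc k)) u = - 2 * u * gauss_deriv (Suc k) u - 2 * (real k + 1) * gauss_deriv k u"

lemma has_field_derivative_gauss_deriv:
  "(gauss_deriv k has_field_derivative gauss_deriv (Suc k) u) (at u)"
proof (induction k u rule: gauss_deriv.induct)
  case (1 u)
  show ?case by (auto intro!: derivative_eq_intros simp: gauss_deriv.simps(1)[abs_def])
next
  case (2 u)
  show ?case
    by (auto intro!: derivative_eq_intros simp: gauss_deriv.simps(2)[abs_def] algebra_simps power2_eq_square)
next
  case (3 k u)
  note [derivative_intros] = 3
  show ?case unfolding gauss_deriv.simps(3)[abs_def, of k]
    by (auto intro!: derivative_eq_intros simp: algebra_simps)
qed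

text \<open>The factor \<open>\<bar>u\<bar> ^ j\<close> is for the induction, as the recurrence
  multiplies by \<open>u\<close>; the heat estimate takes \<open>j = 0\<close>.\<close>

lemma gauss_deriv_bounded: "\<exists>C. \<forall>u. \<bar>u\<bar> ^ j * \<bar>gauss_deriv k u\<bar> \<le> C"
proof (induction k arbitrary: j rule: less_induct)
  case (less k)
  have g: "\<exists>C. \<forall>u::real. \<bar>u\<bar> ^ j * exp (- u\<^sup>2) \<le> C" for j
  proof -
    have "\<bar>u\<bar> ^ j * exp (- u\<^sup>2) \<le> 1 + fact j" for u :: real
    proof -
      have e: "(u\<^sup>2) ^ j / fact j \<le> exp (u\<^sup>2)"
        using sum_le_suminf[OF summable_exp_generic[of "u\<^sup>2"], of "{j}"] by (simp add: exp_def scaleR_conv_of_real field_simps)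
      have "\<bar>u\<bar> ^ j \<le> 1 + (u\<^sup>2) ^ j"
      proof (cases "\<bar>u\<bar> \<le> 1")
        case True
        then show ?thesis by (simp add: power_le_one add_increasing2)
      next
        case False
        then have "\<bar>u\<bar> ^ j \<le> \<bar>u\<bar> ^ (2 * j)" by (intro power_increasing) auto
        then show ?thesis by (simp add: power_mult)
      qed
      also have "\<dots> \<le> exp (u\<^sup>2) + fact j * exp (u\<^sup>2)"
        using e by (intro add_mono) (auto simp: field_simps)
      finally have "\<bar>u\<bar> ^ j * exp (- u\<^sup>2) \<le> (exp (u\<^sup>2) + fact j * exp (u\<^sup>2)) * exp (- u\<^sup>2)"
        by (intro mult_right_mono) auto
      also have "\<dots> = 1 + fact j" by (simp add: distrib_right exp_minus mult.assoc)
      finally show ?thesis .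
    qed
    then show ?thesis by blast
  qed
  consider "k = 0" | "k = Suc 0" | k' where "k = Suc (Suc k')" by (metis not0_implies_Suc)
  then show ?case
  proof cases
    case 1
    then show ?thesis using g by simp
  next
    case 2
    obtain C where "\<And>u::real. \<bar>u\<bar> ^ Suc j * exp (- u\<^sup>2) \<le> C" using g by blast
    then have "\<bar>u\<bar> ^ j * \<bar>gauss_deriv k u\<bar> \<le> 2 * C" for u
      using 2 by (simp add: abs_mult mult_ac)
    then show ?thesis by blast
  next
    case 3
    obtain C where C: "\<And>u. \<bar>u\<bar> ^ Suc j * \<bar>gauss_deriv (Suc k') u\<bar> \<le> C" using less[of "Suc k'" "Suc j"] 3 by auto
    obtain D where D: "\<And>u. \<bar>u\<bar> ^ j * \<bar>gauss_deriv k' u\<bar> \<le> D" using less[of k' j] 3 by auto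
    have "\<bar>u\<bar> ^ j * \<bar>gauss_deriv k u\<bar> \<le> 2 * C + 2 * (real k' + 1) * D" for u
    proof -
      have "\<bar>gauss_deriv k u\<bar> \<le> 2 * \<bar>u\<bar> * \<bar>gauss_deriv (Suc k') u\<bar> + 2 * (real k' + 1) * \<bar>gauss_deriv k' u\<bar>"
        using abs_triangle_ineq4[of "- 2 * u * gauss_deriv (Suc k') u" "2 * (real k' + 1) * gauss_deriv k' u"]
        by (simp add: 3 abs_mult)
      then have "\<bar>u\<bar> ^ j * \<bar>gauss_deriv k u\<bar>
          \<le> \<bar>u\<bar> ^ j * (2 * \<bar>u\<bar> * \<bar>gauss_deriv (Suc k') u\<bar> + 2 * (real k' + 1) * \<bar>gauss_deriv k' u\<bar>)"
        by (rule mult_left_mono) simp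
      also have "\<dots> = 2 * (\<bar>u\<bar> ^ Suc j * \<bar>gauss_deriv (Suc k') u\<bar>) + 2 * (real k' + 1) * (\<bar>u\<bar> ^ j * \<bar>gauss_deriv k' u\<bar>)"
        by (simp add: algebra_simps)
      also have "\<dots> \<le> 2 * C + 2 * (real k' + 1) * D"
        by (intro add_mono mult_left_mono C D) auto
      finally show ?thesis .
    qed
    then show ?thesis by blast
  qed
qed

text \<open>A list of basis vectors stands for a multi-index, and its length is the degree.
  Multiplying by a coordinate is then a Cons; that reordered lists give the same monomial is
  harmless.\<close>

definition monomial :: "'a::euclidean_space list \<Rightarrow> 'a \<Rightarrow> real" where
  "monomial L y = (\<Prod>b\<leftarrow>L. y \<bullet> b)"

lemma monomial_simps [simp]: "monomial [] y = 1" "monomial (b # L) y = (y \<bullet> b) * monomial L y"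
  by (simp_all add: monomial_def)

lemma continuous_monomial: "continuous_on UNIV (monomial L)"
  by (induction L) (auto intro!: continuous_intros simp: monomial_def[abs_def])

lemma measurable_monomial [measurable]: "monomial L \<in> borel_measurable lebesgue"
  by (intro measurable_completion) (simp add: borel_measurable_continuous_onI continuous_monomial)

lemma monomial_bound: "set L \<subseteq> Basis \<Longrightarrow> \<bar>monomial L y\<bar> \<le> (1 + norm y) ^ length L"
proof (induction L)
  case (Cons b L)
  have "\<bar>y \<bullet> b\<bar> \<le> 1 + norm y" using Basis_le_norm[of b y] Cons.prems by simp
  then show ?case using Cons by (auto simp: abs_mult intro!: mult_mono)
qed simp

section \<open>Polynomials annihilated by a rapidly decaying function\<close>

locale rapidly_decaying =
  fixes f :: "'a::euclidean_space \<Rightarrow> 'k::{real_normed_field, banach, second_countable_topology}"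
  assumes f_measurable [measurable]: "f \<in> borel_measurable lebesgue"
    and f_integrable: "\<And>j. integrable lebesgue (\<lambda>y. (1 + norm y) ^ j * norm (f y))"
begin

definition poly_growth :: "('a \<Rightarrow> real) \<Rightarrow> bool" where
  "poly_growth q \<longleftrightarrow> q \<in> borel_measurable lebesgue \<and> (\<exists>C j. \<forall>y. \<bar>q y\<bar> \<le> C * (1 + norm y) ^ j)"

lemma poly_growth_integrable:
  assumes "poly_growth q"
  shows "integrable lebesgue (\<lambda>y. q y *\<^sub>R f y)"
proof -
  obtain C j where C: "\<And>y. \<bar>q y\<bar> \<le> C * (1 + norm y) ^ j" and [measurable]: "q \<in> borel_measurable lebesgue"
    using assms by (auto simp: poly_growth_def)
  show ?thesis
  proof (rule Bochner_Integration.integrable_bound)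
    show "integrable lebesgue (\<lambda>y. C * ((1 + norm y) ^ j * norm (f y)))" using f_integrable by simp
    show "AE y in lebesgue. norm (q y *\<^sub>R f y) \<le> norm (C * ((1 + norm y) ^ j * norm (f y)))"
    proof (intro AE_I2)
      fix y
      have "\<bar>q y\<bar> * norm (f y) \<le> C * (1 + norm y) ^ j * norm (f y)" using C by (intro mult_right_mono) auto
      then show "norm (q y *\<^sub>R f y) \<le> norm (C * ((1 + norm y) ^ j * norm (f y)))" by (simp add: mult.assoc)
    qed
  qed measurable
qed

lemma poly_growth_const: "poly_growth (\<lambda>_. c)"
  unfolding poly_growth_def by (intro conjI exI[of _ "\<bar>c\<bar>"] exI[of _ 0]) auto

lemma poly_growth_monomial: "set L \<subseteq> Basis \<Longrightarrow> poly_growth (monomial L)"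
  unfolding poly_growth_def using monomial_bound[of L] by (auto intro!: exI[of _ 1] exI[of _ "length L"])

lemma poly_growth_norm_power: "poly_growth (\<lambda>y. norm y ^ j)"
proof -
  have "(\<lambda>y::'a. norm y ^ j) \<in> borel_measurable lebesgue" by (intro measurable_completion) simp
  then show ?thesis unfolding poly_growth_def
    by (auto intro!: exI[of _ 1] exI[of _ j] power_mono)
qed

lemma poly_growth_mult:
  assumes "poly_growth q" "poly_growth r"
  shows "poly_growth (\<lambda>y. q y * r y)"
proof -
  obtain C j D k where C: "\<And>y. \<bar>q y\<bar> \<le> C * (1 + norm y) ^ j" and D: "\<And>y. \<bar>r y\<bar> \<le> D * (1 + norm y) ^ k"
    and [measurable]: "q \<in> borel_measurable lebesgue" "r \<in> borel_measurable lebesgue"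
    using assms by (auto simp: poly_growth_def)
  have "\<bar>q y * r y\<bar> \<le> (C * D) * (1 + norm y) ^ (j + k)" for y
  proof -
    have "\<bar>q y * r y\<bar> \<le> (C * (1 + norm y) ^ j) * (D * (1 + norm y) ^ k)"
      unfolding abs_mult using C[of y] D[of y] by (intro mult_mono) (auto intro: order_trans[OF abs_ge_zero])
    then show ?thesis by (simp add: power_add mult_ac)
  qed
  then show ?thesis unfolding poly_growth_def by (intro conjI exI allI) measurable
qed

lemma poly_growth_add:
  assumes "poly_growth q" "poly_growth r"
  shows "poly_growth (\<lambda>y. q y + r y)"
proof -
  obtain C j D k where C: "\<And>y. \<bar>q y\<bar> \<le> C * (1 + norm y) ^ j" and D: "\<And>y. \<bar>r y\<bar> \<le> D * (1 + norm y) ^ k"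
    and [measurable]: "q \<in> borel_measurable lebesgue" "r \<in> borel_measurable lebesgue"
    using assms by (auto simp: poly_growth_def)
  have "\<bar>q y + r y\<bar> \<le> (\<bar>C\<bar> + \<bar>D\<bar>) * (1 + norm y) ^ (j + k)" for y
  proof -
    have 1: "(1 + norm y) ^ j \<le> (1 + norm y) ^ (j + k)" "(1 + norm y) ^ k \<le> (1 + norm y) ^ (j + k)"
      by (intro power_increasing; simp)+
    have "\<bar>q y\<bar> \<le> \<bar>C\<bar> * (1 + norm y) ^ j" "\<bar>r y\<bar> \<le> \<bar>D\<bar> * (1 + norm y) ^ k"
      by (rule order_trans[OF C] order_trans[OF D], intro mult_right_mono, simp, simp)+
    moreover have "\<bar>C\<bar> * (1 + norm y) ^ j \<le> \<bar>C\<bar> * (1 + norm y) ^ (j + k)"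
      "\<bar>D\<bar> * (1 + norm y) ^ k \<le> \<bar>D\<bar> * (1 + norm y) ^ (j + k)"
      using 1 by (intro mult_left_mono; simp)+
    ultimately show ?thesis using abs_triangle_ineq[of "q y" "r y"] unfolding distrib_right by linarith
  qed
  then show ?thesis unfolding poly_growth_def by (intro conjI exI allI) measurable
qed

text \<open>\<open>annihilates M k q\<close>: the polynomial \<open>q\<close>, thought of as homogeneous of degree \<open>k\<close>, is killed by
  \<open>f\<close> even after multiplication with any monomial that keeps the degree below \<open>M\<close>.\<close>

definition annihilates :: "nat \<Rightarrow> nat \<Rightarrow> ('a \<Rightarrow> real) \<Rightarrow> bool" where
  "annihilates M k q \<longleftrightarrow> poly_growth q \<and>
     (\<forall>L. set L \<subseteq> Basis \<longrightarrow> length L + k < M \<longrightarrow> (LINT y|lebesgue. (monomial L y * q y) *\<^sub>R f y) = 0)"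

lemma annihilates_integral: "annihilates M k q \<Longrightarrow> k < M \<Longrightarrow> (LINT y|lebesgue. q y *\<^sub>R f y) = 0"
  unfolding annihilates_def by (auto dest: spec[of _ "[]"])

lemma annihilates_cmult:
  assumes "annihilates M k q"
  shows "annihilates M k (\<lambda>y. c * q y)"
proof -
  have "(LINT y|lebesgue. (monomial L y * (c * q y)) *\<^sub>R f y) = c *\<^sub>R (LINT y|lebesgue. (monomial L y * q y) *\<^sub>R f y)" for L
    by (simp add: mult.left_commute flip: scaleR_scaleR integral_scaleR_right)
  then show ?thesis
    using assms by (auto simp: annihilates_def intro: poly_growth_mult poly_growth_const)
qed

lemma annihilates_add:
  assumes "annihilates M k q" "annihilates M k r"
  shows "annihilates M k (\<lambda>y. q y + r y)"
proof -
  have "(LINT y|lebesgue. (monomial L y * (q y + r y)) *\<^sub>R f y) =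
      (LINT y|lebesgue. (monomial L y * q y) *\<^sub>R f y) + (LINT y|lebesgue. (monomial L y * r y) *\<^sub>R f y)"
    if "set L \<subseteq> Basis" for L
    using assms that unfolding annihilates_def distrib_left scaleR_add_left
    by (intro Bochner_Integration.integral_add poly_growth_integrable poly_growth_mult poly_growth_monomial) auto
  then show ?thesis
    using assms by (auto simp: annihilates_def intro: poly_growth_add)
qed

lemma annihilates_sum:
  assumes "finite I" "\<And>i. i \<in> I \<Longrightarrow> annihilates M k (q i)"
  shows "annihilates M k (\<lambda>y. \<Sum>i\<in>I. q i y)"
  using assms
proof (induction I)
  case empty
  show ?case by (simp add: annihilates_def poly_growth_const)
qed (auto intro: annihilates_add)

lemma annihilates_coord:
  assumes q: "annihilates M k q" and b: "b \<in> Basis"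
  shows "annihilates M (Suc k) (\<lambda>y. (y \<bullet> b) * q y)"
  unfolding annihilates_def
proof (intro conjI allI impI)
  show "poly_growth (\<lambda>y. y \<bullet> b * q y)"
    using poly_growth_monomial[of "[b]"] b q
    by (intro poly_growth_mult) (auto simp: annihilates_def monomial_def[abs_def])
  fix L :: "'a list" assume L: "set L \<subseteq> Basis" "length L + Suc k < M"
  have "\<And>L. set L \<subseteq> Basis \<Longrightarrow> length L + k < M \<Longrightarrow> (LINT y|lebesgue. (monomial L y * q y) *\<^sub>R f y) = 0"
    using q by (simp add: annihilates_def)
  then have "(LINT y|lebesgue. (monomial (b # L) y * q y) *\<^sub>R f y) = 0"
    by this (use b L in auto)
  then show "(LINT y|lebesgue. (monomial L y * (y \<bullet> b * q y)) *\<^sub>R f y) = 0"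
    by (simp add: mult_ac)
qed

lemma annihilates_inner:
  assumes "annihilates M k q"
  shows "annihilates M (Suc k) (\<lambda>y. (x \<bullet> y) * q y)"
proof -
  have "annihilates M (Suc k) (\<lambda>y. \<Sum>b\<in>Basis. (x \<bullet> b) * ((y \<bullet> b) * q y))"
    using assms by (intro annihilates_sum annihilates_cmult annihilates_coord) auto
  also have "(\<lambda>y. \<Sum>b\<in>Basis. (x \<bullet> b) * ((y \<bullet> b) * q y)) = (\<lambda>y. (x \<bullet> y) * q y)"
    by (subst euclidean_inner) (simp add: sum_distrib_right mult.assoc)
  finally show ?thesis .
qed

lemma annihilates_norm_sq:
  assumes "annihilates M k q"
  shows "annihilates M (Suc (Suc k)) (\<lambda>y. (norm y)\<^sup>2 * q y)"
proof -
  have "annihilates M (Suc (Suc k)) (\<lambda>y. \<Sum>b\<in>Basis. (y \<bullet> b) * ((y \<bullet> b) * q y))"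
    using assms by (intro annihilates_sum annihilates_coord) auto
  also have "(\<lambda>y. \<Sum>b\<in>Basis. (y \<bullet> b) * ((y \<bullet> b) * q y)) = (\<lambda>y. (norm y)\<^sup>2 * q y)"
    by (subst power2_norm_eq_inner, subst euclidean_inner) (simp add: sum_distrib_right mult.assoc)
  finally show ?thesis .
qed

end

text \<open>\<open>q k y\<close> is the \<open>k\<close>-th derivative of \<open>exp (- |x - s y|\<^sup>2 / (4 t))\<close> in \<open>s\<close> at \<open>0\<close>. The recurrence shows that it is a
  homogeneous polynomial of degree \<open>k\<close> in \<open>y\<close>.\<close>

lemma heat_kernel_Taylor:
  fixes x :: "'a::euclidean_space" and t :: real
  assumes t: "0 < t"
  obtains q :: "nat \<Rightarrow> 'a \<Rightarrow> real" where
    "q 0 = (\<lambda>_. exp (- (norm x)\<^sup>2 / (4 * t)))"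
    "q (Suc 0) = (\<lambda>y. (1 / (2 * t)) * ((x \<bullet> y) * q 0 y))"
    "\<And>k. q (Suc (Suc k)) = (\<lambda>y. (1 / (2 * t)) * ((x \<bullet> y) * q (Suc k) y) + (- (real k + 1) / (2 * t)) * ((norm y)\<^sup>2 * q k y))"
    "\<And>M C y. (\<And>u. \<bar>gauss_deriv M u\<bar> \<le> C) \<Longrightarrow>
      \<bar>exp (- (norm (x - y))\<^sup>2 / (4 * t)) - (\<Sum>k<M. q k y / fact k)\<bar> \<le> C * (norm y / (2 * sqrt t)) ^ M / fact M"
proof -
  \<comment> \<open>Completing the square in \<open>s\<close>: \<open>(norm (x - s y))\<^sup>2 / (4
    t) = (\<beta> s + u)\<^sup>2 + d / (4 t)\<close>, where \<open>d\<close> is the squared distance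
    of \<open>x\<close> from the line spanned by \<open>y\<close>. So the kernel is a
    one-dimensional Gaussian in \<open>s\<close> times a factor \<open>e \<le> 1\<close>, which
    makes the remainder bound uniform in \<open>x\<close>. For \<open>y = 0\<close> division by zero
    returns 0, giving \<open>\<beta> = u = 0\<close> and
    \<open>d = (norm x)\<^sup>2\<close>.\<close>
  define \<beta> where "\<beta> y = norm y / (2 * sqrt t)" for y :: 'a
  define u where "u y = - (x \<bullet> y) / (norm y * (2 * sqrt t))" for y :: 'a
  define d where "d y = (norm x)\<^sup>2 - (x \<bullet> y)\<^sup>2 / (norm y)\<^sup>2" for y :: 'a
  define e where "e y = exp (- d y / (4 * t))" for y :: 'a
  define q where "q k y = e y * \<beta> y ^ k * gauss_deriv k (u y)" for k :: nat and y :: 'a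
  have sq: "(sqrt t)\<^sup>2 = t" using t by simp
  have u2: "(u y)\<^sup>2 = (x \<bullet> y)\<^sup>2 / (norm y)\<^sup>2 / (4 * t)" for y
    by (simp add: u_def power_divide power_mult_distrib sq)
  have \<beta>2: "(\<beta> y)\<^sup>2 = (norm y)\<^sup>2 / (4 * t)" for y
    by (simp add: \<beta>_def power_divide power_mult_distrib sq)
  have \<beta>u: "\<beta> y * u y = - (x \<bullet> y) / (4 * t)" for y
  proof (cases "y = 0")
    case False
    then have "\<beta> y * u y = - (x \<bullet> y) / (4 * (sqrt t)\<^sup>2)"
      by (simp add: \<beta>_def u_def power2_eq_square)
    then show ?thesis by (simp add: sq)
  qed (simp add: \<beta>_def)
  have q0: "q 0 y = exp (- (norm x)\<^sup>2 / (4 * t))" for y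
    by (simp add: q_def e_def u2 d_def diff_divide_distrib flip: exp_add)
  have "0 \<le> d y" for y
    using Cauchy_Schwarz_ineq[of x y]
    by (cases "y = 0") (auto simp: d_def power2_norm_eq_inner divide_le_eq)
  then have e: "0 \<le> e y" "e y \<le> 1" for y using t by (auto simp: e_def)
  show ?thesis
  proof
    show "q 0 = (\<lambda>_. exp (- (norm x)\<^sup>2 / (4 * t)))" using q0 by auto
    show "q (Suc 0) = (\<lambda>y. (1 / (2 * t)) * ((x \<bullet> y) * q 0 y))"
    proof
      fix y
      have "q (Suc 0) y = - 2 * (\<beta> y * u y) * q 0 y" by (simp add: q_def)
      then show "q (Suc 0) y = (1 / (2 * t)) * ((x \<bullet> y) * q 0 y)" unfolding \<beta>u by (simp add: field_simps)
    qed
    show "q (Suc (Suc k)) = (\<lambda>y. (1 / (2 * t)) * ((x \<bullet> y) * q (Suc k) y) + (- (real k + 1) / (2 * t)) * ((norm y)\<^sup>2 * q k y))" for k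
    proof
      fix y
      have "q (Suc (Suc k)) y = - 2 * (\<beta> y * u y) * q (Suc k) y - 2 * (real k + 1) * (\<beta> y)\<^sup>2 * q k y"
        by (simp add: q_def power2_eq_square algebra_simps)
      then show "q (Suc (Suc k)) y = (1 / (2 * t)) * ((x \<bullet> y) * q (Suc k) y) + (- (real k + 1) / (2 * t)) * ((norm y)\<^sup>2 * q k y)"
        unfolding \<beta>u \<beta>2 using t by (simp add: field_simps)
    qed
    fix M C y assume C: "\<And>u. \<bar>gauss_deriv M u\<bar> \<le> C"
    define D where "D k s = e y * \<beta> y ^ k * gauss_deriv k (\<beta> y * s + u y)" for k s
    have "(D k has_real_derivative D (Suc k) s) (at s)" for k s
    proof -
      have "((\<lambda>s. gauss_deriv k (\<beta> y * s + u y)) has_real_derivative gauss_deriv (Suc k) (\<beta> y * s + u y) * \<beta> y) (at s)"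
        by (rule DERIV_chain2[OF has_field_derivative_gauss_deriv]) (auto intro!: derivative_eq_intros)
      then show ?thesis unfolding D_def by (auto intro!: derivative_eq_intros)
    qed
    then obtain s where s: "D 0 1 = (\<Sum>k<M. D k 0 / fact k * 1 ^ k) + D M s / fact M * 1 ^ M"
      using Maclaurin_all_le[of D "D 0" 1 M] by auto
    have "D 0 1 = exp (- (norm (x - y))\<^sup>2 / (4 * t))"
    proof -
      have "(\<beta> y + u y)\<^sup>2 + d y / (4 * t) = (norm (x - y))\<^sup>2 / (4 * t)"
        using \<beta>u[of y] by (simp add: power2_sum \<beta>2 u2 d_def power2_norm_eq_inner[of "x - y"] inner_diff_left
            inner_diff_right inner_commute power2_norm_eq_inner add_divide_distrib diff_divide_distrib)
      then have "- (norm (x - y))\<^sup>2 / (4 * t) = - d y / (4 * t) + - (\<beta> y + u y)\<^sup>2" by linarith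
      then show ?thesis by (simp add: D_def e_def flip: exp_add)
    qed
    moreover have "D k 0 = q k y" for k by (simp add: D_def q_def)
    ultimately have "exp (- (norm (x - y))\<^sup>2 / (4 * t)) - (\<Sum>k<M. q k y / fact k) = D M s / fact M"
      using s by simp
    moreover have "\<bar>D M s\<bar> \<le> C * \<beta> y ^ M"
    proof -
      have b: "0 \<le> \<beta> y" using t by (simp add: \<beta>_def)
      have "\<bar>D M s\<bar> = e y * (\<beta> y ^ M * \<bar>gauss_deriv M (\<beta> y * s + u y)\<bar>)"
        using e(1)[of y] b by (simp add: D_def abs_mult)
      also have "\<dots> \<le> 1 * (\<beta> y ^ M * C)"
        using e[of y] b C by (intro mult_mono) auto
      finally show ?thesis by (simp add: mult.commute)
    qed
    ultimately show "\<bar>exp (- (norm (x - y))\<^sup>2 / (4 * t)) - (\<Sum>k<M. q k y / fact k)\<bar> \<le> C * (norm y / (2 * sqrt t)) ^ M / fact M"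
      by (simp add: \<beta>_def divide_right_mono)
  qed
qed

lemma heat_decay_of_vanishing_moments:
  obtains C where "0 < C"
    "\<And>(f :: 'a::euclidean_space \<Rightarrow> 'k::{real_normed_field, banach, second_countable_topology}) t x.
      rapidly_decaying f \<Longrightarrow>
      (\<And>L. set L \<subseteq> Basis \<Longrightarrow> length L < 2 * m \<Longrightarrow> (LINT y|lebesgue. monomial L y *\<^sub>R f y) = 0) \<Longrightarrow>
      1 \<le> t \<Longrightarrow> norm (heat t f x) \<le> C / t ^ m * (LINT y|lebesgue. norm y ^ (2 * m) * norm (f y))"
proof -
  obtain C0 where C0: "\<And>u. \<bar>gauss_deriv (2 * m) u\<bar> \<le> C0"
    using gauss_deriv_bounded[of 0 "2 * m"] by auto
  define C where "C = \<bar>C0\<bar> + 1"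
  have C: "\<bar>gauss_deriv (2 * m) u\<bar> \<le> C" for u using C0[of u] by (simp add: C_def)
  have "norm (heat t f x) \<le> C / t ^ m * (LINT y|lebesgue. norm y ^ (2 * m) * norm (f y))"
    if f: "rapidly_decaying f" and t: "1 \<le> t"
      and mom: "\<And>L. set L \<subseteq> Basis \<Longrightarrow> length L < 2 * m \<Longrightarrow> (LINT y|lebesgue. monomial L y *\<^sub>R f y) = 0"
    for f :: "'a \<Rightarrow> 'k" and t x
  proof -
    interpret rapidly_decaying f by (rule f)
    have t0: "0 < t" using t by simp
    obtain q where q: "q 0 = (\<lambda>_. exp (- (norm x)\<^sup>2 / (4 * t)))"
      "q (Suc 0) = (\<lambda>y. (1 / (2 * t)) * ((x \<bullet> y) * q 0 y))"
      "\<And>k. q (Suc (Suc k)) = (\<lambda>y. (1 / (2 * t)) * ((x \<bullet> y) * q (Suc k) y) + (- (real k + 1) / (2 * t)) * ((norm y)\<^sup>2 * q k y))"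
      "\<And>M C y. (\<And>u. \<bar>gauss_deriv M u\<bar> \<le> C) \<Longrightarrow>
        \<bar>exp (- (norm (x - y))\<^sup>2 / (4 * t)) - (\<Sum>k<M. q k y / fact k)\<bar> \<le> C * (norm y / (2 * sqrt t)) ^ M / fact M"
    proof (rule heat_kernel_Taylor[OF t0, of x], goal_cases)
      case (1 q)
      show ?case by (rule 1(1)[OF 1(2-5)])
    qed
    have one: "annihilates (2 * m) 0 (\<lambda>_. 1)"
      using mom by (simp add: annihilates_def poly_growth_const)
    \<comment> \<open>Two consecutive indices at once, as the recurrence for \<open>q\<close>
      reaches back two steps.\<close>
    have ann: "annihilates (2 * m) k (q k) \<and> annihilates (2 * m) (Suc k) (q (Suc k))" for k
    proof (induction k)
      case 0
      have "annihilates (2 * m) 0 (q 0)"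
        using annihilates_cmult[OF one, of "exp (- (norm x)\<^sup>2 / (4 * t))"] by (simp add: q(1))
      moreover from this have "annihilates (2 * m) (Suc 0) (q (Suc 0))"
        unfolding q(2) by (intro annihilates_cmult annihilates_inner)
      ultimately show ?case by simp
    next
      case (Suc k)
      then have "annihilates (2 * m) (Suc (Suc k)) (q (Suc (Suc k)))"
        unfolding q(3) by (intro annihilates_add annihilates_cmult annihilates_inner annihilates_norm_sq) auto
      with Suc show ?case by simp
    qed
    define T where "T y = (\<Sum>k<2 * m. q k y / fact k)" for y
    define G where "G y = exp (- (norm (x - y))\<^sup>2 / (4 * t))" for y
    have qi: "integrable lebesgue (\<lambda>y. (q k y / fact k) *\<^sub>R f y)" for k
      using poly_growth_integrable[OF poly_growth_mult[OF poly_growth_const, of "q k" "1 / fact k"]] ann[of k]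
      by (simp add: annihilates_def)
    have "(LINT y|lebesgue. (q k y / fact k) *\<^sub>R f y) = 0" if "k < 2 * m" for k
      using annihilates_integral[OF annihilates_cmult[of "2 * m" k "q k" "1 / fact k"] that] ann[of k] by simp
    then have T0: "(LINT y|lebesgue. T y *\<^sub>R f y) = 0"
      unfolding T_def scaleR_sum_left using qi by (subst Bochner_Integration.integral_sum) auto
    have Ti: "integrable lebesgue (\<lambda>y. T y *\<^sub>R f y)"
      unfolding T_def scaleR_sum_left using qi by (intro Bochner_Integration.integrable_sum) auto
    have "poly_growth G"
    proof -
      have "G \<in> borel_measurable lebesgue"
        unfolding G_def by (intro measurable_completion borel_measurable_continuous_onI continuous_intros) (use t in auto)
      moreover have "\<bar>G y\<bar> \<le> 1 * (1 + norm y) ^ 0" for y using t by (simp add: G_def)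
      ultimately show ?thesis unfolding poly_growth_def by blast
    qed
    then have Gi: "integrable lebesgue (\<lambda>y. G y *\<^sub>R f y)" by (rule poly_growth_integrable)
    have Ri: "integrable lebesgue (\<lambda>y. norm y ^ (2 * m) * norm (f y))"
      using integrable_norm[OF poly_growth_integrable[OF poly_growth_norm_power[of "2 * m"]]] by simp
    have "norm (LINT y|lebesgue. G y *\<^sub>R f y) = norm (LINT y|lebesgue. (G y - T y) *\<^sub>R f y)"
      using Gi Ti by (simp add: scaleR_diff_left T0)
    also have "\<dots> \<le> (LINT y|lebesgue. norm ((G y - T y) *\<^sub>R f y))" by (rule integral_norm_bound)
    also have "\<dots> \<le> (LINT y|lebesgue. C / t ^ m * (norm y ^ (2 * m) * norm (f y)))"
    proof (rule integral_mono)
      show "integrable lebesgue (\<lambda>y. norm ((G y - T y) *\<^sub>R f y))"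
        using Gi Ti by (simp add: scaleR_diff_left)
      show "integrable lebesgue (\<lambda>y. C / t ^ m * (norm y ^ (2 * m) * norm (f y)))" using Ri by simp
      fix y
      have "\<bar>G y - T y\<bar> \<le> C * (norm y / (2 * sqrt t)) ^ (2 * m) / fact (2 * m)"
        unfolding G_def T_def by (rule q(4)[OF C])
      also have "\<dots> \<le> C * (norm y / (2 * sqrt t)) ^ (2 * m) / 1"
        using t by (intro divide_left_mono) (auto simp: C_def fact_ge_1)
      also have "(norm y / (2 * sqrt t)) ^ (2 * m) = norm y ^ (2 * m) / (4 ^ m * t ^ m)"
        using t by (simp add: power_mult power_divide power_mult_distrib)
      also have "C * (norm y ^ (2 * m) / (4 ^ m * t ^ m)) / 1 \<le> C / t ^ m * norm y ^ (2 * m)"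
      proof -
        have "norm y ^ (2 * m) / (4 ^ m * t ^ m) \<le> norm y ^ (2 * m) / (1 * t ^ m)"
          using t by (intro divide_left_mono mult_right_mono) auto
        then have "C * (norm y ^ (2 * m) / (4 ^ m * t ^ m)) \<le> C * (norm y ^ (2 * m) / (1 * t ^ m))"
          by (intro mult_left_mono) (auto simp: C_def)
        then show ?thesis by simp
      qed
      finally have "\<bar>G y - T y\<bar> * norm (f y) \<le> C / t ^ m * norm y ^ (2 * m) * norm (f y)"
        by (rule mult_right_mono) simp
      then show "norm ((G y - T y) *\<^sub>R f y) \<le> C / t ^ m * (norm y ^ (2 * m) * norm (f y))"
        by (simp add: mult.assoc)
    qed
    also have "\<dots> = C / t ^ m * (LINT y|lebesgue. norm y ^ (2 * m) * norm (f y))" by simp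
    finally have main: "norm (LINT y|lebesgue. G y *\<^sub>R f y) \<le> C / t ^ m * (LINT y|lebesgue. norm y ^ (2 * m) * norm (f y))" .
    \<comment> \<open>For \<open>t \<ge> 1\<close> the prefactor of the heat kernel is at most 1;
      its own decay in \<open>t\<close> is given away.\<close>
    have "1 * 1 \<le> 4 * pi * t" using t pi_ge_two by (intro mult_mono) auto
    then have "1 \<le> (4 * pi * t) powr (real DIM('a) / 2)" by (intro ge_one_powr_ge_zero) auto
    then have "norm (LINT y|lebesgue. G y *\<^sub>R f y) / (4 * pi * t) powr (real DIM('a) / 2)
        \<le> norm (LINT y|lebesgue. G y *\<^sub>R f y) / 1"
      by (intro divide_left_mono) auto
    then have "norm (heat t f x) \<le> norm (LINT y|lebesgue. G y *\<^sub>R f y)"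
      by (simp add: heat_def G_def)
    with main show ?thesis by linarith
  qed
  moreover have "0 < C" by (simp add: C_def)
  ultimately show ?thesis using that by blast
qed

section \<open>Density and weights\<close>

lemma Lp_norm_tendsto_0:
  fixes d :: "nat \<Rightarrow> 'a \<Rightarrow> 'k::{real_normed_field, second_countable_topology}"
  assumes p: "1 \<le> p" and d: "\<And>n. d n \<in> borel_measurable M"
    and D: "integrable M (\<lambda>x. D x powr p)" "\<And>n x. norm (d n x) \<le> D x"
    and lim: "AE x in M. (\<lambda>n. d n x) \<longlonglongrightarrow> 0"
  shows "(\<lambda>n. Lp_norm p M (d n)) \<longlonglongrightarrow> 0"
proof -
  note d[measurable]
  have "(\<lambda>n. LINT x|M. norm (d n x) powr p) \<longlonglongrightarrow> (LINT x|M. 0)"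
  proof (rule integral_dominated_convergence[OF _ _ D(1)])
    show "AE x in M. (\<lambda>n. norm (d n x) powr p) \<longlonglongrightarrow> 0"
      using lim
    proof eventually_elim
      case (elim x)
      have "(\<lambda>n. norm (d n x)) \<longlonglongrightarrow> 0" using tendsto_norm[OF elim] by simp
      from tendsto_powr'[OF this tendsto_const[of p]] show ?case using p by auto
    qed
    show "AE x in M. norm (norm (d n x) powr p) \<le> D x powr p" for n
      using D(2) p by (intro AE_I2) (auto intro: powr_mono2)
  qed measurable
  then have "(\<lambda>n. (LINT x|M. norm (d n x) powr p) powr (1 / p)) \<longlonglongrightarrow> 0 powr (1 / p)"
    using p by (intro tendsto_powr') auto
  then show ?thesis by (simp add: Lp_norm_def)
qed

definition clamp_norm :: "real \<Rightarrow> 'b::real_normed_vector \<Rightarrow> 'b" where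
  "clamp_norm R v = (1 / max 1 (norm v / R)) *\<^sub>R v"

lemma norm_clamp_norm_le: "norm (clamp_norm R v) \<le> norm v"
  using mult_right_mono[of "1 / max 1 (norm v / R)" 1 "norm v"] by (simp add: clamp_norm_def)

lemma norm_clamp_norm_le_radius: "0 < R \<Longrightarrow> norm (clamp_norm R v) \<le> R"
  by (auto simp: clamp_norm_def max_def field_simps)

lemma clamp_norm_id: "0 < R \<Longrightarrow> norm v \<le> R \<Longrightarrow> clamp_norm R v = v"
  by (simp add: clamp_norm_def max_def)

lemma continuous_clamp_norm: "0 < R \<Longrightarrow> continuous_on UNIV (clamp_norm R)"
  unfolding clamp_norm_def by (intro continuous_intros) (auto simp: max_def)

definition cutoff :: "real \<Rightarrow> 'a::real_normed_vector \<Rightarrow> real" where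
  "cutoff R x = max 0 (min 1 (R + 1 - norm x))"

lemma cutoff_bounds: "0 \<le> cutoff R x" "cutoff R x \<le> 1"
  by (auto simp: cutoff_def)

lemma continuous_cutoff: "continuous_on S (cutoff R)"
  unfolding cutoff_def by (intro continuous_intros)

text \<open>Two dominated limits. Cutting \<open>g\<close> off in space and in size costs an error
  below \<open>2 * norm (g x)\<close>. Moreover \<open>g\<close> is the limit of continuous
  functions \<open>G k\<close> off a negligible set, and the same cut applied to \<open>G k\<close>
  makes the differences bounded by the constant \<open>2 * real (Suc n)\<close>, whose power is
  integrable as \<open>M\<close> is finite.\<close>

lemma Lp_continuous_dense:
  fixes g :: "'a::euclidean_space \<Rightarrow> 'k::{real_normed_field, euclidean_space}"
  assumes "finite_measure M" and sets: "sets M = sets lebesgue"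
    and null: "null_sets lebesgue \<subseteq> null_sets M"
    and p: "1 \<le> p" and g: "g \<in> Lp p M" and \<epsilon>: "0 < \<epsilon>"
  obtains c B where "continuous_on UNIV c" "(c \<longlongrightarrow> 0) at_infinity" "\<And>x. norm (c x) \<le> B"
    "Lp_norm p M (\<lambda>x. g x - c x) < \<epsilon>"
proof -
  interpret finite_measure M by fact
  have meas: "borel_measurable M = borel_measurable lebesgue"
    by (rule measurable_cong_sets) (simp_all add: sets)
  have cont_meas: "continuous_on UNIV f \<Longrightarrow> f \<in> borel_measurable M" for f :: "'a \<Rightarrow> 'z::topological_space"
    unfolding meas by (intro measurable_completion) (simp add: borel_measurable_continuous_onI)
  have [measurable]: "g \<in> borel_measurable M" and gp: "integrable M (\<lambda>x. norm (g x) powr p)"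
    using g by (auto simp: Lp_def)
  define cut where "cut n f x = cutoff (real n) x *\<^sub>R clamp_norm (real n) (f x)" for n and f :: "'a \<Rightarrow> 'k" and x
  have cut_le: "norm (cut n f x) \<le> norm (f x)" for n f x
    using mult_mono[OF cutoff_bounds(2)[of "real n" x] norm_clamp_norm_le[of "real n" "f x"]] cutoff_bounds(1)[of "real n" x]
    by (simp add: cut_def)
  have cut_le': "norm (cut n f x) \<le> real n" if "0 < n" for n f x
    using mult_mono[OF cutoff_bounds(2)[of "real n" x] norm_clamp_norm_le_radius[of "real n" "f x"]] cutoff_bounds(1)[of "real n" x] that
    by (simp add: cut_def)
  have cut_meas: "cut n f \<in> borel_measurable M" if "0 < n" "f \<in> borel_measurable M" for n f
  proof -
    have [measurable]: "f \<in> borel_measurable M" "cutoff (real n) \<in> borel_measurable M"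
      "clamp_norm (real n) \<in> borel_measurable (borel :: 'k measure)"
      using that by (auto intro!: cont_meas continuous_cutoff borel_measurable_continuous_onI continuous_clamp_norm)
    show ?thesis unfolding cut_def by measurable
  qed
  have "(\<lambda>n. Lp_norm p M (\<lambda>x. g x - cut (Suc n) g x)) \<longlonglongrightarrow> 0"
  proof (rule Lp_norm_tendsto_0[OF p])
    show "integrable M (\<lambda>x. (2 * norm (g x)) powr p)" using gp by (simp add: powr_mult)
    show "norm (g x - cut (Suc n) g x) \<le> 2 * norm (g x)" for n x
      using norm_triangle_ineq4[of "g x" "cut (Suc n) g x"] cut_le[of "Suc n" g x] by simp
    show "AE x in M. (\<lambda>n. g x - cut (Suc n) g x) \<longlonglongrightarrow> 0"
    proof (intro AE_I2)
      fix x
      obtain n0 where n0: "max (norm x) (norm (g x)) \<le> real n0" using real_arch_simple by blast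
      have "g x - cut (Suc n) g x = 0" if "n \<ge> n0" for n
        using n0 that by (simp add: cut_def cutoff_def clamp_norm_id)
      then show "(\<lambda>n. g x - cut (Suc n) g x) \<longlonglongrightarrow> 0"
        by (intro tendsto_eventually eventually_sequentiallyI)
    qed
  qed (use cut_meas in measurable)
  then have "eventually (\<lambda>n. Lp_norm p M (\<lambda>x. g x - cut (Suc n) g x) < \<epsilon> / 2) sequentially"
    using \<epsilon> by (intro order_tendstoD(2)[of _ 0]) auto
  then obtain n where n: "Lp_norm p M (\<lambda>x. g x - cut (Suc n) g x) < \<epsilon> / 2"
    by (auto simp: eventually_sequentially)
  have "g measurable_on UNIV"
    using g by (simp add: measurable_on_UNIV lebesgue_measurable_imp_measurable_on Lp_def meas)
  then obtain Z G where Z: "negligible Z" and G: "\<And>k. continuous_on UNIV (G k)"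
    and G_lim: "\<And>x. x \<notin> Z \<Longrightarrow> (\<lambda>k. G k x) \<longlonglongrightarrow> g x"
    unfolding measurable_on_def by auto
  have cont: "continuous_on UNIV (cut (Suc n) (G k))" for k
    unfolding cut_def
    by (intro continuous_intros continuous_cutoff continuous_on_compose2[OF continuous_clamp_norm G]) auto
  have "(\<lambda>k. Lp_norm p M (\<lambda>x. cut (Suc n) g x - cut (Suc n) (G k) x)) \<longlonglongrightarrow> 0"
  proof (rule Lp_norm_tendsto_0[OF p])
    show "integrable M (\<lambda>x. (2 * real (Suc n)) powr p)" by simp
    show "norm (cut (Suc n) g x - cut (Suc n) (G k) x) \<le> 2 * real (Suc n)" for k x
      using norm_triangle_ineq4[of "cut (Suc n) g x" "cut (Suc n) (G k) x"]
        cut_le'[of "Suc n" g x] cut_le'[of "Suc n" "G k" x] by simp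
    have "(\<lambda>k. cut (Suc n) g x - cut (Suc n) (G k) x) \<longlonglongrightarrow> 0" if "x \<notin> Z" for x
    proof -
      have "isCont (clamp_norm (real (Suc n))) (g x)"
        by (rule continuous_on_interior[OF continuous_clamp_norm]) auto
      then have "(\<lambda>k. clamp_norm (real (Suc n)) (G k x)) \<longlonglongrightarrow> clamp_norm (real (Suc n)) (g x)"
        using G_lim[OF that] by (rule isCont_tendsto_compose)
      then have "(\<lambda>k. cut (Suc n) (G k) x) \<longlonglongrightarrow> cut (Suc n) g x"
        unfolding cut_def by (intro tendsto_intros)
      from tendsto_diff[OF tendsto_const[of "cut (Suc n) g x"] this] show ?thesis by simp
    qed
    moreover have "Z \<in> null_sets M" using Z null by (auto simp: negligible_iff_null_sets)
    ultimately show "AE x in M. (\<lambda>k. cut (Suc n) g x - cut (Suc n) (G k) x) \<longlonglongrightarrow> 0"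
      by (intro AE_I'[of Z]) auto
  qed (use cut_meas[of "Suc n" g] cont_meas[OF cont] in measurable)
  then have "eventually (\<lambda>k. Lp_norm p M (\<lambda>x. cut (Suc n) g x - cut (Suc n) (G k) x) < \<epsilon> / 2) sequentially"
    using \<epsilon> by (intro order_tendstoD(2)[of _ 0]) auto
  then obtain k where k: "Lp_norm p M (\<lambda>x. cut (Suc n) g x - cut (Suc n) (G k) x) < \<epsilon> / 2"
    by (auto simp: eventually_sequentially)
  have in_Lp: "cut (Suc n) f \<in> Lp p M" if "f \<in> borel_measurable M" for f
  proof -
    have "integrable M (\<lambda>x. norm (cut (Suc n) f x) powr p)"
    proof (rule integrable_const_bound)
      show "AE x in M. norm (norm (cut (Suc n) f x) powr p) \<le> real (Suc n) powr p"
        using p cut_le'[of "Suc n"] by (intro AE_I2) (auto intro!: powr_mono2)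
    qed (use cut_meas[of "Suc n" f] that in measurable)
    then show ?thesis using cut_meas[of "Suc n" f] that by (simp add: Lp_def)
  qed
  have diff: "(\<lambda>x. u x - v x) \<in> Lp p M" if "u \<in> Lp p M" "v \<in> Lp p M" for u v :: "'a \<Rightarrow> 'k"
    using Lp_add[OF p that(1) Lp_cmult[OF that(2), of "-1"]] by simp
  have "Lp_norm p M (\<lambda>x. g x - cut (Suc n) (G k) x) \<le>
      Lp_norm p M (\<lambda>x. g x - cut (Suc n) g x) + Lp_norm p M (\<lambda>x. cut (Suc n) g x - cut (Suc n) (G k) x)"
    using Lp_norm_triangle[OF p diff[OF g in_Lp] diff[OF in_Lp in_Lp], of g g "G k"] cont_meas[OF G]
    by simp
  then have "Lp_norm p M (\<lambda>x. g x - cut (Suc n) (G k) x) < \<epsilon>" using n k by linarith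
  moreover have "(cut (Suc n) (G k) \<longlongrightarrow> 0) at_infinity"
  proof (rule tendsto_eventually)
    have "cut (Suc n) (G k) x = 0" if "real (Suc n) + 1 \<le> norm x" for x
      using that by (simp add: cut_def cutoff_def)
    then show "\<forall>\<^sub>F x in at_infinity. cut (Suc n) (G k) x = 0"
      unfolding eventually_at_infinity by blast
  qed
  ultimately show ?thesis using cont cut_le'[of "Suc n" "G k"] that by blast
qed

text \<open>Majorise by multiples of indicators of the balls of radius \<open>n + 1\<close>. Their
  volumes are proportional to \<open>(n + 1) ^ DIM('a)\<close>, so the exponent
  \<open>DIM('a) + 2\<close> leaves the convergent series of \<open>1 / (n + 1) ^ 2\<close>.\<close>

lemma integrable_inverse_power:
  "integrable lebesgue (\<lambda>x::'a::euclidean_space. 1 / (1 + norm x) ^ (DIM('a) + 2))"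
proof -
  let ?N = "DIM('a)" and ?v = "unit_ball_vol (real DIM('a))"
  let ?a = "\<lambda>n (x::'a). ennreal (1 / (real n + 1) ^ (?N + 2)) * indicator (cball 0 (real n + 1)) x"
  let ?f = "\<lambda>x::'a. 1 / (1 + norm x) ^ (?N + 2)"
  have meas: "?f \<in> borel_measurable borel"
    by (intro borel_measurable_continuous_onI continuous_intros) (auto simp: add_nonneg_eq_0_iff)
  have "(\<integral>\<^sup>+x. ennreal (norm (?f x)) \<partial>lborel) \<le>
      (\<integral>\<^sup>+x. (\<Sum>n. ?a n x) \<partial>lborel)"
  proof (rule nn_integral_mono)
    fix x :: 'a
    define n where "n = nat \<lfloor>norm x\<rfloor>"
    have n: "real n \<le> norm x" "norm x \<le> real n + 1"
      using of_nat_floor[of "norm x"] by (simp_all add: n_def)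
    have "ennreal (norm (?f x)) \<le> ?a n x"
    proof -
      have "?f x \<le> 1 / (real n + 1) ^ (?N + 2)"
        using n by (intro divide_left_mono power_mono mult_pos_pos zero_less_power) auto
      then show ?thesis using n by (simp add: ennreal_leI del: power_add power_Suc)
    qed
    also have "\<dots> = sum (\<lambda>n. ?a n x) {n}"
      by (simp only: sum.insert sum.empty finite.emptyI empty_iff add_0_right not_False_eq_True)
    also have "\<dots> \<le> (\<Sum>n. ?a n x)"
      by (rule sum_le_suminf) auto
    finally show "ennreal (norm (?f x)) \<le> (\<Sum>n. ?a n x)" .
  qed
  also have "\<dots> = (\<Sum>n. \<integral>\<^sup>+x. ?a n x \<partial>lborel)"
    by (intro nn_integral_suminf borel_measurable_times_ennreal borel_measurable_const
        borel_measurable_indicator) (simp add: borel_closed)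
  also have "\<dots> = (\<Sum>n. ennreal (?v * (1 / (real n + 1) ^ 2)))"
  proof (rule suminf_cong)
    fix n
    have "(\<integral>\<^sup>+x. ?a n x \<partial>lborel)
        = ennreal (1 / (real n + 1) ^ (?N + 2)) * ennreal (?v * (real n + 1) ^ ?N)"
      by (simp add: nn_integral_cmult_indicator emeasure_cball)
    also have "\<dots> = ennreal (1 / (real n + 1) ^ (?N + 2) * (?v * (real n + 1) ^ ?N))"
      by (rule ennreal_mult[symmetric]) auto
    also have "1 / (real n + 1) ^ (?N + 2) * (?v * (real n + 1) ^ ?N) = ?v * (1 / (real n + 1) ^ 2)"
      by (simp add: power_add power2_eq_square)
    finally show "(\<integral>\<^sup>+x. ?a n x \<partial>lborel)
        = ennreal (?v * (1 / (real n + 1) ^ 2))" .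
  qed
  also have "\<dots> < \<infinity>"
  proof -
    have "summable (\<lambda>n. 1 / (real n + 1) ^ 2)"
      using inverse_power_summable[of 2, where 'a=real] summable_Suc_iff[of "\<lambda>n. inverse (real n ^ 2)"]
      by (simp add: inverse_eq_divide add.commute)
    then have "summable (\<lambda>n. ?v * (1 / (real n + 1) ^ 2))" by (rule summable_mult)
    then show ?thesis by (subst suminf_ennreal2) auto
  qed
  finally have "integrable lborel ?f"
    using meas by (intro integrableI_bounded) auto
  then show ?thesis by (simp add: integrable_completion meas)
qed

text \<open>Take the bound on \<open>w\<close> for an exponent \<open>m \<ge> j / a\<close> and
  raise it to the power \<open>a\<close>. Thus every positive power of an admissible weight still
  dominates all polynomials.\<close>

lemma admissible_weight_powr_bound:
  assumes w: "admissible_weight w" and a: "0 < a"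
  obtains B where "0 < B" "\<And>x. (1 + norm x) ^ j \<le> B * w x powr a"
proof -
  obtain m :: nat where m: "real j / a \<le> real m" using real_arch_simple by blast
  obtain B where B: "\<And>x. (1 + norm x) ^ m / w x \<le> B"
    using w unfolding admissible_weight_def bdd_above_def by blast
  have pos: "0 < w x" for x using w by (simp add: admissible_weight_def)
  have "0 < (1 + norm (0::'a)) ^ m / w 0" using pos by simp
  then have Bpos: "0 < B" using B[of 0] by linarith
  have "(1 + norm x) ^ j \<le> B powr a * w x powr a" for x
  proof -
    have "real j \<le> real m * a" using m a by (simp add: field_simps)
    have "(1 + norm x) ^ j = (1 + norm x) powr real j" by (simp add: powr_realpow add_pos_nonneg)
    also have "\<dots> \<le> (1 + norm x) powr (real m * a)"
      using \<open>real j \<le> real m * a\<close> by (intro powr_mono) auto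
    also have "\<dots> = ((1 + norm x) ^ m) powr a" by (simp add: powr_powr powr_realpow add_pos_nonneg flip: powr_powr)
    also have "\<dots> \<le> (B * w x) powr a"
      using B[of x] pos[of x] a by (intro powr_mono2) (auto simp: field_simps)
    also have "\<dots> = B powr a * w x powr a" by (rule powr_mult)
    finally show ?thesis .
  qed
  then show ?thesis using that[of "B powr a"] Bpos by simp
qed

section \<open>Haar coefficients as bounded linear functionals\<close>

context haar_system
begin

lemma UNIV_sets: "UNIV \<in> sets M"
  using sets.top[of M] by (simp add: space_UNIV)

lemma avg_linear:
  fixes f g :: "'a \<Rightarrow> 'k::{real_normed_field, banach, second_countable_topology}"
  assumes "S \<in> sets M"
  shows "integrable M f \<Longrightarrow> integrable M g \<Longrightarrow> avg S (\<lambda>x. f x + g x) = avg S f + avg S g"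
    and "avg S (\<lambda>x. c * f x) = c * avg S f"
  using assms by (simp_all add: avg_def set_integral_add(2) integrable_on_sets add_divide_distrib)

lemma norm_avg_le:
  fixes f :: "'a \<Rightarrow> 'k::{real_normed_field, banach, second_countable_topology}"
  assumes "S \<in> sets M" "integrable M f"
  shows "norm (avg S f) \<le> (LINT x|M. norm (f x)) / measure M S"
proof -
  have "norm (LINT x:S|M. f x) \<le> (LINT x:S|M. norm (f x))"
    by (intro set_integral_norm_bound integrable_on_sets assms)
  also have "\<dots> \<le> (LINT x|M. norm (f x))"
    unfolding set_lebesgue_integral_def
    using assms by (intro integral_mono integrable_mult_indicator integrable_norm) (auto simp: indicator_def)
  finally show ?thesis by (simp add: avg_def norm_divide divide_right_mono)
qed

lemma haar_coeff_linear:
  fixes f g :: "'a \<Rightarrow> 'k::{real_normed_field, banach, second_countable_topology}"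
  shows "integrable M f \<Longrightarrow> integrable M g \<Longrightarrow> haar_coeff n (\<lambda>x. f x + g x) = haar_coeff n f + haar_coeff n g"
    and "haar_coeff n (\<lambda>x. c * f x) = c * haar_coeff n f"
  by (simp_all add: haar_coeff_def avg_linear A_sets sibling_sets UNIV_sets right_diff_distrib)

lemma haar_coeff_bound:
  obtains B where "\<And>f :: 'a \<Rightarrow> 'k::{real_normed_field, banach, second_countable_topology}.
    integrable M f \<Longrightarrow> norm (haar_coeff n f) \<le> B * (LINT x|M. norm (f x))"
proof
  fix f :: "'a \<Rightarrow> 'k" assume f: "integrable M f"
  let ?I = "LINT x|M. norm (f x)"
  have "norm (haar_coeff n f) \<le> norm (avg UNIV f) + (norm (avg (A n) f) + norm (avg (sibling n) f))"
    using norm_triangle_ineq4[of "avg (A n) f" "avg (sibling n) f"]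
    by (cases "n = 0") (simp_all add: haar_coeff_def add_increasing)
  also have "\<dots> \<le> ?I / measure M UNIV + (?I / measure M (A n) + ?I / measure M (sibling n))"
    by (intro add_mono norm_avg_le f A_sets sibling_sets UNIV_sets)
  finally show "norm (haar_coeff n f) \<le>
      (1 / measure M UNIV + 1 / measure M (A n) + 1 / measure M (sibling n)) * ?I"
    by (simp add: distrib_right)
qed

text \<open>The error at \<open>x\<close> is the mean of \<open>g x - g y\<close> over the points
  \<open>y\<close> of the atom of \<open>x\<close>.\<close>

lemma cond_exp_close:
  fixes g :: "'a \<Rightarrow> 'k::{real_normed_field, banach, second_countable_topology}"
  assumes n: "0 < n" and g: "integrable M g"
    and osc: "\<And>y. last_hit A n x = last_hit A n y \<Longrightarrow> norm (g x - g y) \<le> \<eta>"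
  shows "norm (g x - cond_exp n g x) \<le> \<eta>"
proof -
  define S where "S = atom n (last_hit A n x)"
  have pos: "0 < measure M S" using last_hit_less[OF n] by (simp add: S_def atom_measure_pos)
  have S: "S \<in> sets M" by (simp add: S_def atom_sets)
  have "integrable M (\<lambda>y. g x - g y)" using g by auto
  then have gi: "integrable M (\<lambda>y. norm (g x - g y))" "set_integrable M S (\<lambda>y. g x - g y)" "set_integrable M S (\<lambda>y. g x)" "set_integrable M S g"
    using g S by (auto intro!: integrable_on_sets)
  have "(LINT y:S|M. g x - g y) = measure M S *\<^sub>R g x - (LINT y:S|M. g y)"
    by (simp add: set_integral_diff(2)[OF gi(3,4)] set_integral_const[OF S])
  then have "g x - cond_exp n g x = (LINT y:S|M. g x - g y) / of_real (measure M S)"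
    using n pos by (simp add: cond_exp_def avg_def S_def[symmetric] scaleR_conv_of_real diff_divide_distrib)
  moreover have "norm (LINT y:S|M. g x - g y) \<le> (LINT y:S|M. norm (g x - g y))"
    by (rule set_integral_norm_bound[OF gi(2)])
  moreover have "(LINT y:S|M. norm (g x - g y)) \<le> (LINT y:S|M. \<eta>)"
    using gi(1) S osc by (intro set_integral_mono integrable_on_sets) (auto simp: S_def atom_def)
  moreover have "(LINT y:S|M. \<eta>) = measure M S * \<eta>" by (simp add: set_integral_const[OF S])
  ultimately show ?thesis using pos by (simp add: norm_divide divide_le_eq mult.commute)
qed

end

lemma sum_fun_apply: "(\<Sum>i\<in>I. f i) x = (\<Sum>i\<in>I. f i x)"
  by (induction I rule: infinite_finite_induct) auto

section \<open>The finite measure with density \<open>decay\<close> and its Haar system\<close>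

definition decay :: "'a::euclidean_space \<Rightarrow> real" where
  "decay x = 1 / (1 + norm x) ^ (DIM('a) + 2)"

lemma decay_pos: "0 < decay x"
  by (simp add: decay_def add_pos_nonneg)

lemma decay_le_1: "decay (x::'a::euclidean_space) \<le> 1"
  using divide_left_mono[OF one_le_power[of "1 + norm x" "DIM('a) + 2"], of 1] by (simp add: decay_def add_pos_nonneg)

lemma continuous_decay: "continuous_on S decay"
  unfolding decay_def by (intro continuous_intros) (auto simp: add_nonneg_eq_0_iff)

lemma continuous_lebesgue_measurable:
  "continuous_on UNIV f \<Longrightarrow> f \<in> borel_measurable (lebesgue :: 'a::euclidean_space measure)"
  by (intro measurable_completion) (simp add: borel_measurable_continuous_onI)

text \<open>Finite, which gives the inclusion of \<open>L^p\<close> in \<open>L^1\<close> and hence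
  all conditional expectations; its null sets are those of Lebesgue measure, so nonempty open sets
  have positive measure.\<close>

definition decay_measure :: "'a::euclidean_space measure" where
  "decay_measure = density lebesgue (\<lambda>x. ennreal (decay x))"

lemma decay_measurable [measurable]: "decay \<in> borel_measurable lebesgue"
  by (intro continuous_lebesgue_measurable continuous_decay)

lemma sets_decay_measure [simp, measurable_cong]: "sets decay_measure = sets lebesgue"
  and space_decay_measure [simp]: "space decay_measure = UNIV"
  by (simp_all add: decay_measure_def)

lemma measurable_decay_measure:
  "borel_measurable decay_measure = (borel_measurable lebesgue :: ('a::euclidean_space \<Rightarrow> 'b::topological_space) set)"
  by (rule measurable_cong_sets) simp_all

lemma integrable_decay_measure:
  fixes f :: "'a::euclidean_space \<Rightarrow> 'b::{banach, second_countable_topology}"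
  assumes "f \<in> borel_measurable lebesgue"
  shows "integrable decay_measure f \<longleftrightarrow> integrable lebesgue (\<lambda>x. decay x *\<^sub>R f x)"
    and "(LINT x|decay_measure. f x) = (LINT x|lebesgue. decay x *\<^sub>R f x)"
proof -
  have "AE x in lebesgue. 0 \<le> decay (x::'a)" by (intro AE_I2 less_imp_le decay_pos)
  then show "integrable decay_measure f \<longleftrightarrow> integrable lebesgue (\<lambda>x. decay x *\<^sub>R f x)"
    and "(LINT x|decay_measure. f x) = (LINT x|lebesgue. decay x *\<^sub>R f x)"
    unfolding decay_measure_def
    by (rule integrable_density[OF assms decay_measurable] integral_density[OF assms decay_measurable])+
qed

lemma finite_measure_decay: "finite_measure decay_measure"
proof
  have "integrable lebesgue (\<lambda>x::'a. decay x)"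
    using integrable_inverse_power[where 'a='a] by (simp add: decay_def[abs_def])
  then have "(\<integral>\<^sup>+x. ennreal (decay (x::'a)) \<partial>lebesgue) \<noteq> \<infinity>"
    using nn_integral_eq_integral[of lebesgue "decay :: 'a \<Rightarrow> real"] by (simp add: decay_pos less_imp_le)
  moreover have "emeasure decay_measure (space decay_measure :: 'a set) = (\<integral>\<^sup>+x. ennreal (decay (x::'a)) \<partial>lebesgue)"
    unfolding decay_measure_def by (subst emeasure_density) simp_all
  ultimately show "emeasure decay_measure (space decay_measure :: 'a set) \<noteq> \<infinity>" by simp
qed

lemma null_sets_decay_measure: "null_sets decay_measure = null_sets lebesgue"
proof -
  have "ennreal (decay x) \<noteq> 0" for x :: 'a
    using decay_pos[of x] by simp
  then have "S \<in> null_sets decay_measure \<longleftrightarrow> S \<in> sets lebesgue \<and> (AE x in lebesgue. x \<notin> S)" for S :: "'a set"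
    unfolding decay_measure_def by (subst null_sets_density_iff) simp_all
  then have "S \<in> null_sets decay_measure \<longleftrightarrow> S \<in> null_sets lebesgue" for S :: "'a set"
    using AE_iff_null_sets[of S lebesgue] null_setsD2[of S lebesgue] by blast
  then show ?thesis by blast
qed

interpretation decay: haar_system decay_measure "code_set (grid :: nat \<Rightarrow> 'a::euclidean_space set)"
proof (rule haar_system_code_set)
  show "finite_measure (decay_measure :: 'a measure)" by (rule finite_measure_decay)
  then interpret finite_measure "decay_measure :: 'a measure" .
  show "grid k \<in> sets (decay_measure :: 'a measure)" for k
    unfolding sets_decay_measure by (rule sets_completionI_sets) (simp add: grid_borel)
  fix T I
  obtain U :: "'a set" where U: "open U" "U \<noteq> {}" "U \<subseteq> {x. \<forall>k<T. x \<in> grid k \<longleftrightarrow> k \<in> I}"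
    by (rule grid_cell_contains_open)
  have Us: "U \<in> sets (decay_measure :: 'a measure)"
    unfolding sets_decay_measure by (rule sets_completionI_sets) (simp add: U(1))
  have "U \<notin> null_sets decay_measure"
  proof
    assume "U \<in> null_sets decay_measure"
    then have "negligible U" by (simp add: null_sets_decay_measure negligible_iff_null_sets)
    moreover obtain x e where "0 < e" "ball x e \<subseteq> U" using U by (meson equals0I openE)
    ultimately have "negligible (ball x e)" by (meson negligible_subset)
    then have "measure lebesgue (ball x e) = 0" by (rule negligible_imp_measure0)
    then show False using content_ball_pos[OF \<open>0 < e\<close>, of x] by simp
  qed
  then have "0 < measure decay_measure U"
    using Us by (auto simp: null_sets_def emeasure_eq_measure zero_less_measure_iff)
  then show "\<exists>U\<in>sets (decay_measure :: 'a measure). U \<subseteq> {x. \<forall>k<T. x \<in> grid k \<longleftrightarrow> k \<in> I} \<and> 0 < measure decay_measure U"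
    using U(3) Us by blast
qed simp

lemma code_eq_of_last_hit:
  assumes "2 ^ s \<le> n" "last_hit (code_set (grid :: nat \<Rightarrow> 'a::euclidean_space set)) n x = last_hit (code_set grid) n y"
  shows "code grid s x = code grid s (y :: 'a)"
proof -
  have "last_hit (code_set grid) (2 ^ s) x = last_hit (code_set grid) (2 ^ s) y"
    by (rule decay.last_hit_refine[OF assms])
  moreover have "last_hit (code_set grid) (2 ^ s) z = code grid s z" for z :: 'a
    by (rule last_hit_code_set) (simp_all add: code_less)
  ultimately show ?thesis by simp
qed

lemma vanishing_function_oscillation:
  fixes g :: "'a::euclidean_space \<Rightarrow> 'b::real_normed_vector"
  assumes "continuous_on UNIV g" "(g \<longlongrightarrow> 0) at_infinity" "0 < \<epsilon>"
  obtains n\<^sub>0 where "0 < n\<^sub>0"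
    "\<And>n x y. n\<^sub>0 \<le> n \<Longrightarrow> last_hit (code_set grid) n x = last_hit (code_set grid) n y \<Longrightarrow> norm (g x - g y) \<le> \<epsilon>"
proof -
  obtain s where s: "\<And>x y. code grid s x = code grid s y \<Longrightarrow> norm (g x - g y) < \<epsilon>"
    using grid_oscillation[OF assms] by blast
  show ?thesis
  proof (rule that[of "2 ^ s"])
    show "norm (g x - g y) \<le> \<epsilon>" if "2 ^ s \<le> n" "last_hit (code_set grid) n x = last_hit (code_set grid) n y" for n x y
      using s[OF code_eq_of_last_hit[OF that]] by simp
  qed simp
qed

lemma Lp_diff:
  fixes f g :: "'a \<Rightarrow> 'k::{real_normed_field, second_countable_topology}"
  assumes "1 \<le> p" "f \<in> Lp p M" "g \<in> Lp p M"
  shows "(\<lambda>x. f x - g x) \<in> Lp p M"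
    and "Lp_norm p M (\<lambda>x. f x - g x) \<le> Lp_norm p M f + Lp_norm p M g"
  using Lp_add[OF assms(1,2) Lp_cmult[OF assms(3), of "-1"]]
    Lp_norm_triangle[OF assms(1,2) Lp_cmult[OF assms(3), of "-1"]] Lp_norm_cmult[OF assms(1), of M "-1" g]
  by simp_all

text \<open>Replace \<open>g\<close> by a continuous \<open>c\<close> vanishing at infinity, for
  which the conditional expectations converge uniformly. As \<open>cond_exp\<close> is a
  contraction, the error \<open>d = g - c\<close> enters at most twice.\<close>

lemma cond_exp_dense:
  fixes g :: "'a::euclidean_space \<Rightarrow> 'k::{real_normed_field, euclidean_space}"
  assumes p: "1 \<le> p" and g: "g \<in> Lp p decay_measure" and \<epsilon>: "0 < \<epsilon>"
  shows "\<exists>n. Lp_norm p decay_measure (\<lambda>x. g x - decay.cond_exp n g x) < \<epsilon>"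
proof -
  let ?M = "decay_measure :: 'a measure"
  \<comment> \<open>Turns the uniform bound \<open>\<epsilon> / 3 / V\<close> into the bound
    \<open>\<epsilon> / 3\<close> on the \<open>L^p\<close> norm; the \<open>+ 1\<close> keeps
    \<open>V\<close> positive.\<close>
  define V where "V = measure ?M UNIV powr (1 / p) + 1"
  have V: "0 < V" by (simp add: V_def add_nonneg_pos)
  have e3: "0 < \<epsilon> / 3" "0 < \<epsilon> / 3 / V" using \<epsilon> V by simp_all
  have null: "null_sets lebesgue \<subseteq> null_sets ?M" by (simp add: null_sets_decay_measure)
  obtain c B where c: "continuous_on UNIV c" "(c \<longlongrightarrow> 0) at_infinity" "\<And>x. norm (c x) \<le> B"
    and close: "Lp_norm p ?M (\<lambda>x. g x - c x) < \<epsilon> / 3"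
    by (rule Lp_continuous_dense[OF finite_measure_decay sets_decay_measure null p g e3(1)], rule that)
  obtain n where n: "0 < n" "\<And>x y. last_hit (code_set grid) n x = last_hit (code_set grid) n y \<Longrightarrow> norm (c x - c y) \<le> \<epsilon> / 3 / V"
  proof (rule vanishing_function_oscillation[OF c(1,2) e3(2)], goal_cases)
    case (1 n0)
    show ?case by (rule 1(1)[OF 1(2) 1(3)[OF order_refl]])
  qed
  have cm: "c \<in> borel_measurable ?M"
    unfolding measurable_decay_measure by (rule continuous_lebesgue_measurable[OF c(1)])
  have cL: "c \<in> Lp p ?M" by (rule decay.bounded_in_Lp[OF p cm c(3)])
  have ci: "integrable ?M c" and gi: "integrable ?M g"
    using decay.Lp_integrable[OF p cL] decay.Lp_integrable[OF p g] by auto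
  define d where "d x = g x - c x" for x
  have dL: "d \<in> Lp p ?M" unfolding d_def by (rule Lp_diff(1)[OF p g cL])
  have di: "integrable ?M d" using decay.Lp_integrable[OF p dL] .
  define r where "r x = c x - decay.cond_exp n c x" for x
  have EL: "decay.cond_exp n u \<in> Lp p ?M" if "integrable ?M u" for u :: "'a \<Rightarrow> 'k"
    by (rule decay.cond_exp_in_Lp[OF p that])
  have rL: "r \<in> Lp p ?M" unfolding r_def by (rule Lp_diff(1)[OF p cL EL[OF ci]])
  have "norm (r x) \<le> \<epsilon> / 3 / V" for x
    unfolding r_def by (rule decay.cond_exp_close[OF n(1) ci n(2)])
  have r_small: "Lp_norm p ?M r \<le> \<epsilon> / 3"
  proof (rule Lp_norm_le[OF p])
    have "(LINT x|?M. norm (r x) powr p) \<le> (LINT x|?M. (\<epsilon> / 3 / V) powr p)"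
      using rL p \<open>\<And>x. norm (r x) \<le> \<epsilon> / 3 / V\<close> by (intro integral_mono) (auto simp: Lp_def intro!: powr_mono2)
    also have "\<dots> = measure ?M UNIV * (\<epsilon> / 3 / V) powr p" by simp
    also have "measure ?M UNIV \<le> V powr p"
    proof -
      have "measure ?M UNIV = (measure ?M UNIV powr (1 / p)) powr p" using p by (simp add: powr_powr)
      also have "\<dots> \<le> V powr p" using p by (intro powr_mono2) (auto simp: V_def)
      finally show ?thesis .
    qed
    then have "measure ?M UNIV * (\<epsilon> / 3 / V) powr p \<le> V powr p * (\<epsilon> / 3 / V) powr p"
      by (rule mult_right_mono) simp
    also have "\<dots> = (\<epsilon> / 3) powr p" using V by (simp flip: powr_mult)
    finally show "(LINT x|?M. norm (r x) powr p) \<le> (\<epsilon> / 3) powr p" .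
  qed (use \<epsilon> in simp)
  have "decay.cond_exp n d x = decay.cond_exp n g x - decay.cond_exp n c x" for x
    using decay.haar_coeff_linear(1)[OF di ci]
    unfolding decay.cond_exp_eq_sum[OF di] decay.cond_exp_eq_sum[OF gi] decay.cond_exp_eq_sum[OF ci]
    by (simp add: d_def distrib_right sum.distrib)
  then have "(\<lambda>x. g x - decay.cond_exp n g x) = (\<lambda>x. (d x - decay.cond_exp n d x) + r x)"
    by (auto simp: d_def r_def)
  then have "Lp_norm p ?M (\<lambda>x. g x - decay.cond_exp n g x) = Lp_norm p ?M (\<lambda>x. (d x - decay.cond_exp n d x) + r x)"
    by simp
  also have "\<dots> \<le> Lp_norm p ?M (\<lambda>x. d x - decay.cond_exp n d x) + Lp_norm p ?M r"
    by (rule Lp_norm_triangle[OF p Lp_diff(1)[OF p dL EL[OF di]] rL])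
  also have "\<dots> \<le> (Lp_norm p ?M d + Lp_norm p ?M (decay.cond_exp n d)) + Lp_norm p ?M r"
    using Lp_diff(2)[OF p dL EL[OF di]] by simp
  also have "\<dots> \<le> (Lp_norm p ?M d + Lp_norm p ?M d) + \<epsilon> / 3"
    using decay.cond_exp_contraction[OF p dL, of n] r_small by simp
  also have "\<dots> < \<epsilon>" using close by (simp add: d_def[abs_def])
  finally show ?thesis by blast
qed

section \<open>The perturbed Haar basis\<close>

lemma seminormed_space_Lp:
  assumes p: "1 \<le> p"
  shows "seminormed_space (\<lambda>(c::'k::{real_normed_field, second_countable_topology}) f x. c * f x)
    (Lp p M :: ('a \<Rightarrow> 'k) set) (Lp_norm p M)"
proof
  let ?scale = "\<lambda>(c::'k) f (x::'a). c * f x"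
  interpret vector_space ?scale
    by standard (auto simp: fun_eq_iff algebra_simps)
  show "module.subspace ?scale (Lp p M :: ('a \<Rightarrow> 'k) set)"
    unfolding subspace_def using Lp_add[OF p] Lp_cmult[of _ p M] p
    by (auto simp: plus_fun_def zero_fun_def Lp_def[of p M, THEN eqset_imp_iff, of "\<lambda>x. 0"])
  show "Lp_norm p M (f + g) \<le> Lp_norm p M f + Lp_norm p M g" if "f \<in> Lp p M" "g \<in> Lp p M" for f g :: "'a \<Rightarrow> 'k"
    using Lp_norm_triangle[OF p that] by (simp add: plus_fun_def)
  show "Lp_norm p M (\<lambda>x. c * f x) = norm c * Lp_norm p M f" for c and f :: "'a \<Rightarrow> 'k"
    by (rule Lp_norm_cmult[OF p])
qed (auto simp: fun_eq_iff algebra_simps)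

text \<open>Feeds the Haar system, whose basis constant is 1, into \<open>perturbed_basis\<close>.
  The behaviour of \<open>\<rho> j\<close> at infinity and its continuity make its functional
  \<open>tail_small\<close>; for a merely bounded weight and \<open>p = 1\<close> this fails in
  general.\<close>

lemma perturbed_haar_basis:
  fixes \<rho> :: "nat \<Rightarrow> 'a::euclidean_space \<Rightarrow> real"
  assumes p: "1 \<le> p" and \<rho>: "\<And>j. continuous_on UNIV (\<rho> j)" "\<And>j. (\<rho> j \<longlongrightarrow> 0) at_infinity"
    and \<rho>_bounded: "\<And>j. \<exists>B. \<forall>x. \<bar>\<rho> j x\<bar> \<le> B"
  obtains e :: "nat \<Rightarrow> 'a \<Rightarrow> 'k::{real_normed_field, euclidean_space}" and c where
    "\<And>k. e k \<in> Lp p decay_measure"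
    "\<And>g. g \<in> Lp p decay_measure \<Longrightarrow> (\<lambda>n. Lp_norm p decay_measure (\<lambda>x. g x - (\<Sum>k<n. c k g * e k x))) \<longlonglongrightarrow> 0"
    "\<And>g d k. g \<in> Lp p decay_measure \<Longrightarrow>
      (\<lambda>n. Lp_norm p decay_measure (\<lambda>x. g x - (\<Sum>k<n. d k * e k x))) \<longlonglongrightarrow> 0 \<Longrightarrow> d k = c k g"
    "\<And>j. \<exists>m. \<forall>g\<in>Lp p decay_measure. (\<forall>k<m. c k g = 0) \<longrightarrow> (LINT x|decay_measure. \<rho> j x *\<^sub>R g x) = 0"
proof -
  let ?M = "decay_measure :: 'a measure"
  let ?X = "Lp p ?M :: ('a \<Rightarrow> 'k) set"
  let ?V = "measure ?M UNIV powr (1 - 1 / p)"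
  interpret seminormed_space "\<lambda>(c::'k) f (x::'a). c * f x" ?X "Lp_norm p ?M"
    by (rule seminormed_space_Lp[OF p])
  define b where "b k = (\<lambda>x::'a. of_real (decay.haar k x) :: 'k)" for k
  define \<phi> where "\<phi> j g = (LINT x|?M. \<rho> j x *\<^sub>R g x)" for j and g :: "'a \<Rightarrow> 'k"
  have int: "integrable ?M g" if "g \<in> ?X" for g using decay.Lp_integrable[OF p that] .
  have int_le: "(LINT x|?M. norm (g x)) \<le> ?V * Lp_norm p ?M g" if "g \<in> ?X" for g
    using decay.integral_norm_le_Lp_norm[OF p that] by simp
  have psum: "partial_sum b decay.haar_coeff n g = decay.cond_exp n g" if "g \<in> ?X" for n g
    using decay.cond_exp_eq_sum[OF int[OF that]] by (simp add: fun_eq_iff partial_sum_def sum_fun_apply b_def)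
  have bX: "b k \<in> ?X" for k
  proof -
    obtain B where "\<forall>x. \<bar>decay.haar k (x::'a)\<bar> \<le> B" using decay.haar_bounded by blast
    then show ?thesis unfolding b_def by (intro decay.bounded_in_Lp[OF p, of _ B]) auto
  qed
  have sys: "basic_system b decay.haar_coeff 1"
    unfolding basic_system_def
  proof (intro conjI allI ballI)
    fix i
    show "bounded_functional (decay.haar_coeff i)"
      unfolding bounded_functional_def
    proof (intro conjI ballI allI)
      obtain B where B: "\<And>f :: 'a \<Rightarrow> 'k. integrable ?M f \<Longrightarrow> norm (decay.haar_coeff i f) \<le> B * (LINT x|?M. norm (f x))"
        by (rule decay.haar_coeff_bound, rule that)
      have "norm (decay.haar_coeff i f) \<le> (\<bar>B\<bar> * ?V) * Lp_norm p ?M f" if "f \<in> ?X" for f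
      proof -
        have "norm (decay.haar_coeff i f) \<le> \<bar>B\<bar> * (LINT x|?M. norm (f x))"
          by (rule order_trans[OF B[OF int[OF that]]], rule mult_right_mono) simp_all
        also have "\<dots> \<le> \<bar>B\<bar> * (?V * Lp_norm p ?M f)" by (rule mult_left_mono[OF int_le[OF that]]) simp
        finally show ?thesis by simp
      qed
      then show "\<exists>B. \<forall>f\<in>?X. norm (decay.haar_coeff i f) \<le> B * Lp_norm p ?M f" by blast
    qed (simp_all add: plus_fun_def decay.haar_coeff_linear int)
    show "decay.haar_coeff i (b j) = of_bool (i = j)" for j
      unfolding b_def by (rule decay.haar_biorthogonal)
  qed (use decay.cond_exp_contraction[OF p] in \<open>simp_all add: psum bX\<close>)
  have dense: "\<exists>n. Lp_norm p ?M (g - partial_sum b decay.haar_coeff n g) < \<epsilon>" if "g \<in> ?X" "0 < \<epsilon>" for g \<epsilon>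
    using cond_exp_dense[OF p that] by (simp add: psum[OF that(1)] fun_diff_def)
  have \<rho>m: "\<rho> j \<in> borel_measurable ?M" for j
    unfolding measurable_decay_measure by (rule continuous_lebesgue_measurable[OF \<rho>(1)])
  have \<rho>i: "integrable ?M (\<lambda>x. \<rho> j x *\<^sub>R g x)" "norm (\<phi> j g) \<le> B * (LINT x|?M. norm (g x))"
    if g: "integrable ?M g" and B: "\<And>x. \<bar>\<rho> j x\<bar> \<le> B" for j g B
  proof -
    have le: "norm (\<rho> j x *\<^sub>R g x) \<le> B * norm (g x)" for x
      using B[of x] by (simp add: mult_right_mono)
    have "0 \<le> B" using B[of 0] by linarith
    show 1: "integrable ?M (\<lambda>x. \<rho> j x *\<^sub>R g x)"
    proof (rule Bochner_Integration.integrable_bound)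
      show "integrable ?M (\<lambda>x. B * norm (g x))" using g by simp
      show "(\<lambda>x. \<rho> j x *\<^sub>R g x) \<in> borel_measurable ?M"
        using \<rho>m[of j] borel_measurable_integrable[OF g] by (rule borel_measurable_scaleR)
      show "AE x in ?M. norm (\<rho> j x *\<^sub>R g x) \<le> norm (B * norm (g x))"
        using le \<open>0 \<le> B\<close> by (intro AE_I2) simp
    qed
    have "norm (\<phi> j g) \<le> (LINT x|?M. norm (\<rho> j x *\<^sub>R g x))"
      unfolding \<phi>_def by (rule integral_norm_bound)
    also have "\<dots> \<le> (LINT x|?M. B * norm (g x))"
      by (intro integral_mono integrable_norm[OF 1] integrable_mult_right integrable_norm[OF g] le)
    finally show "norm (\<phi> j g) \<le> B * (LINT x|?M. norm (g x))" by simp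
  qed
  have \<phi>_fun: "bounded_functional (\<phi> j)" for j
  proof -
    obtain B where B: "\<And>x. \<bar>\<rho> j x\<bar> \<le> B" using \<rho>_bounded by blast
    have "0 \<le> B" using B[of 0] by linarith
    have "norm (\<phi> j f) \<le> (B * ?V) * Lp_norm p ?M f" if "f \<in> ?X" for f
      using \<rho>i(2)[OF int[OF that] B] mult_left_mono[OF int_le[OF that] \<open>0 \<le> B\<close>] by (simp add: mult.assoc)
    then show ?thesis
      unfolding bounded_functional_def
      using \<rho>i(1)[OF int B]
      by (intro conjI exI[of _ "B * ?V"])
         (auto simp: \<phi>_def plus_fun_def scaleR_add_right simp flip: mult_scaleR_right)
  qed
  have tail: "tail_small b decay.haar_coeff (\<phi> j)" for j
    unfolding tail_small_def
  proof (intro allI impI)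
    fix \<epsilon> :: real assume \<epsilon>: "0 < \<epsilon>"
    obtain B where B: "\<And>x. \<bar>\<rho> j x\<bar> \<le> B" using \<rho>_bounded by blast
    \<comment> \<open>The error \<open>g - cond_exp n g\<close> has at most twice the norm of
      \<open>g\<close>, and \<open>?V\<close> is the cost of passing from the \<open>L^1\<close> to
      the \<open>L^p\<close> norm; the \<open>+ 1\<close> avoids a zero denominator.\<close>
    define \<delta> where "\<delta> = \<epsilon> / (2 * ?V + 1)"
    have \<delta>: "0 < \<delta>" "\<delta> * (2 * ?V) \<le> \<epsilon>" using \<epsilon> by (auto simp: \<delta>_def field_simps add_pos_nonneg)
    obtain n0 where n0: "0 < n0"
      "\<And>n x y. n0 \<le> n \<Longrightarrow> last_hit (code_set grid) n x = last_hit (code_set grid) n y \<Longrightarrow> norm (\<rho> j x - \<rho> j y) \<le> \<delta>"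
      by (rule vanishing_function_oscillation[OF \<rho> \<delta>(1)], rule that)
    have "norm (\<phi> j (g - partial_sum b decay.haar_coeff n g)) \<le> \<epsilon> * Lp_norm p ?M g" if n: "n0 \<le> n" and g: "g \<in> ?X" for n g
    proof -
      define d where "d x = g x - decay.cond_exp n g x" for x
      have EX: "decay.cond_exp n g \<in> ?X" by (rule decay.cond_exp_in_Lp[OF p int[OF g]])
      have dX: "d \<in> ?X" unfolding d_def by (rule Lp_diff(1)[OF p g EX])
      have "0 < n" using n n0(1) by simp
      have "\<phi> j (g - partial_sum b decay.haar_coeff n g) = (LINT x|?M. \<rho> j x *\<^sub>R (g x - decay.cond_exp n g x))"
        by (simp add: \<phi>_def psum[OF g])
      also have "norm \<dots> \<le> \<delta> * (LINT x|?M. norm (g x - decay.cond_exp n g x))"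
        by (rule decay.integral_cond_exp_error_le[OF \<open>0 < n\<close> int[OF g] \<rho>m B]) (use n0(2)[OF n] in simp)
      also have "\<dots> \<le> \<delta> * (?V * Lp_norm p ?M d)"
        using int_le[OF dX] \<delta>(1) by (intro mult_left_mono) (auto simp: d_def)
      also have "\<dots> \<le> \<delta> * (?V * (2 * Lp_norm p ?M g))"
        using Lp_diff(2)[OF p g EX] decay.cond_exp_contraction[OF p g, of n] \<delta>(1)
        by (intro mult_left_mono) (auto simp: d_def[abs_def])
      also have "\<dots> = (\<delta> * (2 * ?V)) * Lp_norm p ?M g" by simp
      also have "\<dots> \<le> \<epsilon> * Lp_norm p ?M g" by (rule mult_right_mono[OF \<delta>(2) Lp_norm_nonneg])
      finally show ?thesis .
    qed
    then show "\<exists>n\<^sub>0. \<forall>n\<ge>n\<^sub>0. \<forall>g\<in>?X. norm (\<phi> j (g - partial_sum b decay.haar_coeff n g)) \<le> \<epsilon> * Lp_norm p ?M g" by blast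
  qed
  obtain e c where ec: "basic_system e c (1 + 1)"
    "\<And>f. f \<in> ?X \<Longrightarrow> (\<lambda>n. Lp_norm p ?M (f - partial_sum e c n f)) \<longlonglongrightarrow> 0"
    "\<And>j. \<exists>m. \<forall>f\<in>?X. (\<forall>k<m. c k f = 0) \<longrightarrow> \<phi> j f = 0"
    by (rule perturbed_basis[where \<phi> = \<phi>, OF sys zero_less_one dense \<phi>_fun tail], assumption, assumption, rule that)
  have sum_eq: "g - (\<Sum>k<n. (\<lambda>x. d k * e k x)) = (\<lambda>x. g x - (\<Sum>k<n. d k * e k x))" for g d n
    by (simp add: fun_eq_iff sum_fun_apply)
  show ?thesis
  proof (rule that[of e c])
    show "e k \<in> ?X" for k by (rule basic_in[OF ec(1)])
    show "(\<lambda>n. Lp_norm p ?M (\<lambda>x. g x - (\<Sum>k<n. c k g * e k x))) \<longlonglongrightarrow> 0" if "g \<in> ?X" for g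
      using ec(2)[OF that] unfolding partial_sum_def sum_eq .
    show "d k = c k g" if "g \<in> ?X" "(\<lambda>n. Lp_norm p ?M (\<lambda>x. g x - (\<Sum>k<n. d k * e k x))) \<longlonglongrightarrow> 0" for g d k
      using expansion_unique[OF ec(1) that(1), of d k] that(2) unfolding sum_eq .
    show "\<exists>m. \<forall>g\<in>?X. (\<forall>k<m. c k g = 0) \<longrightarrow> (LINT x|?M. \<rho> j x *\<^sub>R g x) = 0" for j
      using ec(3)[of j] by (simp add: \<phi>_def)
  qed
qed

section \<open>Transfer to weighted spaces\<close>

locale weighted_space =
  fixes p :: real and w :: "'a::euclidean_space \<Rightarrow> real"
  assumes p: "1 \<le> p" and w: "admissible_weight w"
begin

text \<open>Multiplication by \<open>h\<close> is an isometry of \<open>L\<^sup>p(decay_measure)\<close> onto \<open>L\<^sup>p\<^sub>w\<close>.\<close>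

definition h :: "'a \<Rightarrow> real" where
  "h x = (decay x / w x) powr (1 / p)"

lemma w_pos: "0 < w x"
  using w by (simp add: admissible_weight_def)

lemma h_pos: "0 < h x"
  using w_pos[of x] decay_pos[of x] by (auto simp: h_def)

lemma nonzero [simp]: "w x \<noteq> 0" "h x \<noteq> 0" "decay x \<noteq> 0"
  using w_pos[of x] h_pos[of x] decay_pos[of x] by simp_all

lemma h_powr: "h x powr p = decay x / w x"
  using p w_pos[of x] decay_pos[of x] by (simp add: h_def powr_powr)

lemma continuous_h: "continuous_on UNIV h"
  unfolding h_def using w
  by (intro continuous_on_powr continuous_intros continuous_decay)
     (auto simp: admissible_weight_def)

text \<open>For \<open>f = h g\<close> the Lebesgue integral of \<open>q f\<close> is the integral
  of \<open>q (h / decay) g\<close> over \<open>decay_measure\<close>, so \<open>h / decay\<close>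
  is the factor through which moments of \<open>f\<close> are seen from \<open>g\<close>. It beats
  every power because \<open>1 / w powr (1 / p)\<close> does; the extra exponent
  \<open>DIM('a) + 2\<close> pays for \<open>1 / decay\<close>.\<close>

lemma ratio_bound: "\<exists>B>0. \<forall>x. (1 + norm x) ^ j * (h x / decay x) \<le> B"
proof -
  have a: "0 < 1 / p" using p by simp
  obtain B where B: "0 < B" "\<And>x. (1 + norm x) ^ (j + DIM('a) + 2) \<le> B * w x powr (1 / p)"
    by (rule admissible_weight_powr_bound[OF w a, where j = "j + DIM('a) + 2"], rule that)
  have "(1 + norm x) ^ j * (h x / decay x) \<le> B" for x
  proof -
    have "decay x powr (1 / p) \<le> 1" using p decay_pos[of x] decay_le_1[of x] by (intro powr_le1) auto
    then have "h x \<le> 1 / w x powr (1 / p)"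
      using decay_pos[of x] w_pos[of x] by (simp add: h_def powr_divide divide_right_mono)
    then have "h x * (1 / decay x) \<le> 1 / w x powr (1 / p) * (1 / decay x)"
      by (rule mult_right_mono) (use decay_pos[of x] in simp)
    moreover have d: "1 / decay x = (1 + norm x) ^ (DIM('a) + 2)" by (simp add: decay_def)
    ultimately have "h x / decay x \<le> (1 + norm x) ^ (DIM('a) + 2) / w x powr (1 / p)"
      unfolding d[symmetric] by (simp add: mult.commute)
    then have "(1 + norm x) ^ j * (h x / decay x) \<le> (1 + norm x) ^ j * ((1 + norm x) ^ (DIM('a) + 2) / w x powr (1 / p))"
      by (rule mult_left_mono) simp
    also have "\<dots> = (1 + norm x) ^ (j + DIM('a) + 2) / w x powr (1 / p)" by (simp add: power_add)
    also have "\<dots> \<le> B" using B(2)[of x] w_pos[of x] by (simp add: pos_divide_le_eq)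
    finally show ?thesis .
  qed
  then show ?thesis using B(1) by blast
qed

lemma h_measurable: "(\<lambda>x. of_real (h x) :: 'k::{real_normed_field, second_countable_topology}) \<in> borel_measurable lebesgue"
  by (intro continuous_lebesgue_measurable continuous_on_of_real continuous_h)

lemma measurable_times_h_iff:
  fixes g :: "'a \<Rightarrow> 'k::{real_normed_field, second_countable_topology}"
  shows "(\<lambda>x. of_real (h x) * g x) \<in> borel_measurable lebesgue \<longleftrightarrow> g \<in> borel_measurable lebesgue"
proof
  assume hg: "(\<lambda>x. of_real (h x) * g x) \<in> borel_measurable lebesgue"
  have "(\<lambda>x. of_real (1 / h x) :: 'k) \<in> borel_measurable lebesgue"
    using h_pos by (intro continuous_lebesgue_measurable continuous_on_of_real continuous_on_divide continuous_h
        continuous_on_const) simp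
  then have "(\<lambda>x. of_real (1 / h x) * (of_real (h x) * g x)) \<in> borel_measurable lebesgue"
    using hg by (rule borel_measurable_times)
  moreover have "of_real (1 / h x) * (of_real (h x) * g x) = g x" for x
    using h_pos[of x] by simp
  ultimately show "g \<in> borel_measurable lebesgue" by simp
qed (intro borel_measurable_times h_measurable)

lemma norm_times_h_powr:
  "norm (of_real (h x) * g x :: 'k::real_normed_field) powr p * w x = decay x * norm (g x) powr p"
  using h_pos[of x] w_pos[of x] by (simp add: norm_mult powr_mult h_powr)

lemma times_h_in_Lpw_iff:
  fixes g :: "'a \<Rightarrow> 'k::{real_normed_field, second_countable_topology}"
  shows "(\<lambda>x. of_real (h x) * g x) \<in> Lpw p w \<longleftrightarrow> g \<in> Lp p decay_measure"
proof (cases "g \<in> borel_measurable lebesgue")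
  case True
  then have "(\<lambda>x. norm (g x) powr p) \<in> borel_measurable lebesgue" by measurable
  then show ?thesis
    using True by (simp add: Lpw_def Lp_def measurable_times_h_iff norm_times_h_powr
        measurable_decay_measure integrable_decay_measure)
next
  case False
  then show ?thesis by (simp add: Lpw_def Lp_def measurable_times_h_iff measurable_decay_measure)
qed

lemma Lpw_norm_times_h:
  fixes g :: "'a \<Rightarrow> 'k::{real_normed_field, second_countable_topology}"
  assumes "g \<in> borel_measurable lebesgue"
  shows "Lpw_norm p w (\<lambda>x. of_real (h x) * g x) = Lp_norm p decay_measure g"
proof -
  have "(\<lambda>x. norm (g x) powr p) \<in> borel_measurable lebesgue" using assms by measurable
  then show ?thesis
    by (simp add: Lpw_norm_def Lp_norm_def norm_times_h_powr integrable_decay_measure(2))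
qed

lemma Lpw_cases:
  fixes f :: "'a \<Rightarrow> 'k::{real_normed_field, second_countable_topology}"
  assumes "f \<in> Lpw p w"
  obtains g where "g \<in> Lp p decay_measure" "f = (\<lambda>x. of_real (h x) * g x)"
proof -
  have "f = (\<lambda>x. of_real (h x) * (f x / of_real (h x)))"
    using h_pos by (simp add: fun_eq_iff)
  then show ?thesis using assms that times_h_in_Lpw_iff by metis
qed

text \<open>One estimate with two uses: elements of \<open>Lpw p w\<close> decay rapidly, and the
  integral left over in the heat bound is controlled by the weighted norm, with \<open>B\<close>
  independent of \<open>f\<close>.\<close>

lemma Lpw_polynomial_bound:
  obtains B where "0 < B"
    "\<And>f :: 'a \<Rightarrow> 'k::{real_normed_field, banach, second_countable_topology}. f \<in> Lpw p w \<Longrightarrow>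
      integrable lebesgue (\<lambda>y. (1 + norm y) ^ j * norm (f y)) \<and>
      (LINT y|lebesgue. (1 + norm y) ^ j * norm (f y)) \<le> B * Lpw_norm p w f"
proof -
  let ?M = "decay_measure :: 'a measure"
  let ?V = "measure ?M UNIV powr (1 - 1 / p)"
  obtain B where B: "0 < B" "\<And>x. (1 + norm x) ^ j * (h x / decay x) \<le> B" using ratio_bound by blast
  have "integrable lebesgue (\<lambda>y. (1 + norm y) ^ j * norm (f y)) \<and>
      (LINT y|lebesgue. (1 + norm y) ^ j * norm (f y)) \<le> B * (?V + 1) * Lpw_norm p w f"
    if f: "f \<in> Lpw p w" for f :: "'a \<Rightarrow> 'k"
  proof -
    obtain g where g: "g \<in> Lp p ?M" "f = (\<lambda>x. of_real (h x) * g x)" using Lpw_cases[OF f] by blast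
    define r where "r y = (1 + norm y) ^ j * (h y / decay y)" for y
    have r: "0 \<le> r y" "r y \<le> B" for y
      using B(2)[of y] h_pos[of y] decay_pos[of y] by (auto simp: r_def)
    have gi: "integrable ?M g" by (rule decay.Lp_integrable[OF p g(1)])
    have gm: "g \<in> borel_measurable lebesgue" using g(1) by (simp add: Lp_def measurable_decay_measure)
    have "r \<in> borel_measurable lebesgue"
      unfolding r_def using decay_pos
      by (intro continuous_lebesgue_measurable continuous_intros continuous_h continuous_decay)
         simp
    then have m: "(\<lambda>y. r y * norm (g y)) \<in> borel_measurable lebesgue" using gm by measurable
    have le: "r y * norm (g y) \<le> B * norm (g y)" for y using r by (intro mult_right_mono) auto
    have ri: "integrable ?M (\<lambda>y. r y * norm (g y))"
    proof (rule Bochner_Integration.integrable_bound)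
      show "integrable ?M (\<lambda>y. B * norm (g y))" using gi by simp
      show "(\<lambda>y. r y * norm (g y)) \<in> borel_measurable ?M" using m by (simp add: measurable_decay_measure)
      show "AE y in ?M. norm (r y * norm (g y)) \<le> norm (B * norm (g y))"
        using le r B(1) by (intro AE_I2) (simp add: abs_mult)
    qed
    have eq: "decay y * (r y * norm (g y)) = (1 + norm y) ^ j * norm (f y)" for y
      using decay_pos[of y] h_pos[of y] by (simp add: r_def g(2) norm_mult)
    have "(LINT y|?M. r y * norm (g y)) \<le> (LINT y|?M. B * norm (g y))"
      by (intro integral_mono ri integrable_mult_right integrable_norm gi le)
    also have "\<dots> \<le> B * (?V * Lp_norm p ?M g)"
      using decay.integral_norm_le_Lp_norm[OF p g(1)] B(1) by (simp add: mult_left_mono)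
    also have "\<dots> \<le> B * ((?V + 1) * Lp_norm p ?M g)"
      using B(1) Lp_norm_nonneg[of p ?M g] by (intro mult_left_mono mult_right_mono) auto
    also have "\<dots> = B * (?V + 1) * Lpw_norm p w f"
      using Lpw_norm_times_h[OF gm] by (simp add: g(2))
    finally show ?thesis
      using ri integrable_decay_measure[OF m] by (simp add: eq)
  qed
  then show ?thesis using that[of "B * (?V + 1)"] B(1) by (simp add: add_nonneg_pos)
qed

lemma Lpw_rapidly_decaying:
  fixes f :: "'a \<Rightarrow> 'k::{real_normed_field, banach, second_countable_topology}"
  assumes "f \<in> Lpw p w"
  shows "rapidly_decaying f"
proof
  show "f \<in> borel_measurable lebesgue" using assms by (simp add: Lpw_def)
  fix j
  obtain B where "\<And>f :: 'a \<Rightarrow> 'k. f \<in> Lpw p w \<Longrightarrow> integrable lebesgue (\<lambda>y. (1 + norm y) ^ j * norm (f y)) \<and>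
      (LINT y|lebesgue. (1 + norm y) ^ j * norm (f y)) \<le> B * Lpw_norm p w f"
    by (rule Lpw_polynomial_bound, rule that)
  then show "integrable lebesgue (\<lambda>y. (1 + norm y) ^ j * norm (f y))" using assms by blast
qed

text \<open>One power of \<open>1 + norm x\<close> beyond the degree gives the bound
  \<open>B / (1 + norm x)\<close>, hence vanishing at infinity.\<close>

lemma moment_weight:
  assumes "set L \<subseteq> Basis"
  defines "\<rho> \<equiv> \<lambda>x. monomial L x * (h x / decay x)"
  shows "continuous_on UNIV \<rho>" "(\<rho> \<longlongrightarrow> 0) at_infinity" "\<exists>B. \<forall>x. \<bar>\<rho> x\<bar> \<le> B"
proof -
  show "continuous_on UNIV \<rho>"
    unfolding \<rho>_def using decay_pos
    by (intro continuous_intros continuous_monomial continuous_h continuous_decay) simp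
  obtain B where B: "0 < B" "\<And>x. (1 + norm x) ^ Suc (length L) * (h x / decay x) \<le> B" using ratio_bound by blast
  have le: "\<bar>\<rho> x\<bar> \<le> B / (1 + norm x)" for x
  proof -
    have "\<bar>\<rho> x\<bar> \<le> (1 + norm x) ^ length L * (h x / decay x)"
    proof -
      have r: "0 \<le> h x / decay x" using h_pos[of x] decay_pos[of x] by simp
      then have "\<bar>\<rho> x\<bar> = \<bar>monomial L x\<bar> * (h x / decay x)" by (simp only: \<rho>_def abs_mult abs_of_nonneg)
      then show ?thesis using mult_right_mono[OF monomial_bound[OF assms(1), of x] r] by (simp only:)
    qed
    also have "\<dots> \<le> B / (1 + norm x)"
      using B(2)[of x] by (subst pos_le_divide_eq) (simp_all add: add_pos_nonneg mult_ac)
    finally show ?thesis .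
  qed
  have "B / (1 + norm x) \<le> B" for x using B(1) by (simp add: divide_le_eq add_pos_nonneg)
  then show "\<exists>B. \<forall>x. \<bar>\<rho> x\<bar> \<le> B" using le order_trans by blast
  show "(\<rho> \<longlongrightarrow> 0) at_infinity"
  proof (rule Lim_null_comparison)
    show "\<forall>\<^sub>F x in at_infinity. norm (\<rho> x) \<le> B / (1 + norm x)" using le by simp
    have "filterlim (\<lambda>x::'a. 1 + norm x) at_top at_infinity"
      by (intro filterlim_tendsto_add_at_top[OF tendsto_const] filterlim_norm_at_top)
    then have "filterlim (\<lambda>x::'a. 1 + norm x) at_infinity at_infinity"
      by (rule filterlim_at_top_imp_at_infinity)
    then show "((\<lambda>x::'a. B / (1 + norm x)) \<longlongrightarrow> 0) at_infinity" by (rule tendsto_divide_0[OF tendsto_const])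
  qed
qed

lemma moment_eq:
  fixes g :: "'a \<Rightarrow> 'k::{real_normed_field, banach, second_countable_topology}"
  assumes L: "set L \<subseteq> Basis" and g: "g \<in> Lp p decay_measure"
  shows "(LINT x|decay_measure. (monomial L x * (h x / decay x)) *\<^sub>R g x) =
    (LINT x|lebesgue. monomial L x *\<^sub>R (of_real (h x) * g x))"
proof -
  have "(\<lambda>x. monomial L x * (h x / decay x)) \<in> borel_measurable lebesgue"
    by (rule continuous_lebesgue_measurable[OF moment_weight(1)[OF L]])
  moreover have "g \<in> borel_measurable lebesgue" using g by (simp add: Lp_def measurable_decay_measure)
  ultimately have m: "(\<lambda>x. (monomial L x * (h x / decay x)) *\<^sub>R g x) \<in> borel_measurable lebesgue"
    by (rule borel_measurable_scaleR)
  have "decay x *\<^sub>R (monomial L x * (h x / decay x)) *\<^sub>R g x = monomial L x *\<^sub>R (of_real (h x) * g x)" for x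
    using decay_pos[of x] by (simp add: scaleR_conv_of_real)
  then show ?thesis by (simp only: integrable_decay_measure(2)[OF m])
qed

theorem schauder_basis_with_heat_decay:
  "\<exists>e :: nat \<Rightarrow> 'a \<Rightarrow> 'k::{real_normed_field, euclidean_space}.
    schauder_basis_Lpw p w e \<and> heat_decay_property p w e"
proof -
  let ?M = "decay_measure :: 'a measure"
  \<comment> \<open>The perturbation handles a sequence of functionals, so the monomials of all
    degrees are listed in one sequence.\<close>
  define \<L> where "\<L> = from_nat_into {L. set L \<subseteq> (Basis :: 'a set)}"
  have countable: "countable {L. set L \<subseteq> (Basis :: 'a set)}"
    using countable_lists[of "Basis :: 'a set"] countable_finite[OF finite_Basis] by (simp add: lists_eq_set)
  have \<L>: "set (\<L> j) \<subseteq> Basis" for j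
    using from_nat_into[of "{L. set L \<subseteq> (Basis :: 'a set)}" j] unfolding \<L>_def
    by (metis (mono_tags, lifting) empty_iff empty_set empty_subsetI mem_Collect_eq)
  define \<rho> where "\<rho> j x = monomial (\<L> j) x * (h x / decay x)" for j x
  have \<rho>: "continuous_on UNIV (\<rho> j)" "(\<rho> j \<longlongrightarrow> 0) at_infinity" "\<exists>B. \<forall>x. \<bar>\<rho> j x\<bar> \<le> B" for j
    using moment_weight[OF \<L>[of j]] by (simp_all only: \<rho>_def[abs_def])
  obtain e :: "nat \<Rightarrow> 'a \<Rightarrow> 'k" and c where e: "\<And>k. e k \<in> Lp p ?M"
    "\<And>g. g \<in> Lp p ?M \<Longrightarrow> (\<lambda>n. Lp_norm p ?M (\<lambda>x. g x - (\<Sum>k<n. c k g * e k x))) \<longlonglongrightarrow> 0"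
    "\<And>g d k. g \<in> Lp p ?M \<Longrightarrow>
      (\<lambda>n. Lp_norm p ?M (\<lambda>x. g x - (\<Sum>k<n. d k * e k x))) \<longlonglongrightarrow> 0 \<Longrightarrow> d k = c k g"
    "\<And>j. \<exists>m. \<forall>g\<in>Lp p ?M. (\<forall>k<m. c k g = 0) \<longrightarrow> (LINT x|?M. \<rho> j x *\<^sub>R g x) = 0"
    by (rule perturbed_haar_basis[OF p \<rho>], rule that)
  define e' where "e' k x = of_real (h x) * e k x" for k x
  have em: "e k \<in> borel_measurable lebesgue" for k using e(1)[of k] by (simp add: Lp_def measurable_decay_measure)
  have expansion: "Lpw_expansion p w e' (\<lambda>x. of_real (h x) * g x) d \<longleftrightarrow>
      (\<lambda>n. Lp_norm p ?M (\<lambda>x. g x - (\<Sum>k<n. d k * e k x))) \<longlonglongrightarrow> 0" if g: "g \<in> Lp p ?M" for g d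
  proof -
    have "(\<lambda>x. of_real (h x) * g x - (\<Sum>k<n. d k * e' k x)) = (\<lambda>x. of_real (h x) * (g x - (\<Sum>k<n. d k * e k x)))" for n
      by (simp add: e'_def right_diff_distrib sum_distrib_left mult.left_commute)
    moreover have "(\<lambda>x. g x - (\<Sum>k<n. d k * e k x)) \<in> borel_measurable lebesgue" for n
      using g em by (intro borel_measurable_diff borel_measurable_sum borel_measurable_times)
        (simp_all add: Lp_def measurable_decay_measure)
    ultimately show ?thesis unfolding Lpw_expansion_def by (simp add: Lpw_norm_times_h)
  qed
  have "schauder_basis_Lpw p w e'"
    unfolding schauder_basis_Lpw_def
  proof (intro conjI allI ballI)
    show "e' k \<in> Lpw p w" for k using e(1)[of k] times_h_in_Lpw_iff[of "e k"] by (simp add: e'_def[abs_def])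
    fix f :: "'a \<Rightarrow> 'k" assume "f \<in> Lpw p w"
    then obtain g where g: "g \<in> Lp p ?M" "f = (\<lambda>x. of_real (h x) * g x)" by (rule Lpw_cases)
    show "\<exists>!d. Lpw_expansion p w e' f d"
    proof (rule ex1I)
      show "Lpw_expansion p w e' f (\<lambda>k. c k g)" unfolding g(2) expansion[OF g(1)] by (rule e(2)[OF g(1)])
      show "d = (\<lambda>k. c k g)" if "Lpw_expansion p w e' f d" for d
        using that e(3)[OF g(1), of d] unfolding g(2) expansion[OF g(1)] by blast
    qed
  qed
  moreover have "heat_decay_property p w e'"
    unfolding heat_decay_property_def
  proof
    fix m :: nat
    obtain K where K: "\<And>j g. g \<in> Lp p ?M \<Longrightarrow> (\<forall>k<K j. c k g = 0) \<Longrightarrow> (LINT x|?M. \<rho> j x *\<^sub>R g x) = 0"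
      using e(4) by metis
    define S where "S = {L :: 'a list. set L \<subseteq> Basis \<and> length L < 2 * m}"
    have "finite S"
      by (rule finite_subset[OF _ finite_lists_length_le[OF finite_Basis, of "2 * m"]]) (auto simp: S_def)
    define idx where "idx L = (SOME j. \<L> j = L)" for L
    have idx: "\<L> (idx L) = L" if "set L \<subseteq> Basis" for L
    proof -
      have "\<exists>j. \<L> j = L" using from_nat_into_surj[OF countable, of L] that by (simp add: \<L>_def)
      then show ?thesis unfolding idx_def by (rule someI_ex)
    qed
    \<comment> \<open>The sum is a convenient upper bound for the \<open>K (idx L)\<close> of the
      finitely many monomials of degree below \<open>2 * m\<close>.\<close>
    define n\<^sub>m where "n\<^sub>m = (\<Sum>L\<in>S. K (idx L))"
    have K_le: "K (idx L) \<le> n\<^sub>m" if "L \<in> S" for L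
      unfolding n\<^sub>m_def using \<open>finite S\<close> that by (rule member_le_sum[rotated 2]) simp
    obtain C where C: "0 < C" "\<And>(f :: 'a \<Rightarrow> 'k) t x. rapidly_decaying f \<Longrightarrow>
      (\<And>L. set L \<subseteq> Basis \<Longrightarrow> length L < 2 * m \<Longrightarrow> (LINT y|lebesgue. monomial L y *\<^sub>R f y) = 0) \<Longrightarrow>
      1 \<le> t \<Longrightarrow> norm (heat t f x) \<le> C / t ^ m * (LINT y|lebesgue. norm y ^ (2 * m) * norm (f y))"
    proof (rule heat_decay_of_vanishing_moments[where m = m and 'a = 'a and 'k = 'k], goal_cases)
      case (1 C)
      show ?case by (rule 1(1)[OF 1(2,3)])
    qed
    obtain B where B: "0 < B" "\<And>f :: 'a \<Rightarrow> 'k. f \<in> Lpw p w \<Longrightarrow>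
        integrable lebesgue (\<lambda>y. (1 + norm y) ^ (2 * m) * norm (f y)) \<and>
        (LINT y|lebesgue. (1 + norm y) ^ (2 * m) * norm (f y)) \<le> B * Lpw_norm p w f"
      by (rule Lpw_polynomial_bound, rule that)
    have "sup_norm (heat t f) \<le> ereal (C * B / t ^ m * Lpw_norm p w f)"
      if f: "f \<in> Lpw p w" and d: "Lpw_expansion p w e' f d" "\<forall>n<n\<^sub>m. d n = 0" and t: "1 \<le> t" for f d t
    proof -
      obtain g where g: "g \<in> Lp p ?M" "f = (\<lambda>x. of_real (h x) * g x)" using Lpw_cases[OF f] by blast
      have dc: "d k = c k g" for k
        using e(3)[OF g(1), of d k] d(1) unfolding g(2) expansion[OF g(1)] by blast
      have mom: "(LINT y|lebesgue. monomial L y *\<^sub>R f y) = 0" if L: "set L \<subseteq> Basis" "length L < 2 * m" for L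
      proof -
        have "L \<in> S" using L by (simp add: S_def)
        then have "\<forall>k<K (idx L). c k g = 0" using K_le d(2) dc by (metis less_le_trans)
        then have "(LINT x|?M. \<rho> (idx L) x *\<^sub>R g x) = 0" by (rule K[OF g(1)])
        then show ?thesis by (simp only: \<rho>_def idx[OF L(1)] moment_eq[OF L(1) g(1)] g(2))
      qed
      interpret rapidly_decaying f by (rule Lpw_rapidly_decaying[OF f])
      have le: "(LINT y|lebesgue. norm y ^ (2 * m) * norm (f y)) \<le> B * Lpw_norm p w f"
      proof -
        have "integrable lebesgue (\<lambda>y. norm y ^ (2 * m) * norm (f y))"
          using integrable_norm[OF poly_growth_integrable[OF poly_growth_norm_power[of "2 * m"]]] by simp
        then have "(LINT y|lebesgue. norm y ^ (2 * m) * norm (f y)) \<le> (LINT y|lebesgue. (1 + norm y) ^ (2 * m) * norm (f y))"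
          using B(2)[OF f] by (intro integral_mono mult_right_mono power_mono) auto
        with B(2)[OF f] show ?thesis by linarith
      qed
      have "norm (heat t f x) \<le> C * B / t ^ m * Lpw_norm p w f" for x
      proof -
        have "norm (heat t f x) \<le> C / t ^ m * (LINT y|lebesgue. norm y ^ (2 * m) * norm (f y))"
          by (rule C(2)[OF rapidly_decaying_axioms mom t])
        also have "\<dots> \<le> C / t ^ m * (B * Lpw_norm p w f)"
          using C(1) t by (intro mult_left_mono[OF le]) auto
        finally show ?thesis by simp
      qed
      then show ?thesis unfolding sup_norm_def by (intro SUP_least) simp
    qed
    then show "\<exists>n\<^sub>m C. 0 < C \<and> (\<forall>f\<in>Lpw p w. \<forall>d. Lpw_expansion p w e' f d \<and> (\<forall>n<n\<^sub>m. d n = 0) \<longrightarrow>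
        (\<forall>t\<ge>1. sup_norm (heat t f) \<le> ereal (C / t ^ m * Lpw_norm p w f)))"
      using B(1) C(1) by (intro exI[of _ n\<^sub>m] exI[of _ "C * B"]) auto
  qed
  ultimately show ?thesis by blast
qed

section \<open>The auxiliary weight for higher dimension\<close>

lemma admissible_weight_root: "admissible_weight (\<lambda>x. w x powr (1 / (2 * p)))"
  unfolding admissible_weight_def
proof (intro conjI allI)
  show "continuous_on UNIV (\<lambda>x. w x powr (1 / (2 * p)))"
    using w w_pos by (intro continuous_on_powr continuous_intros) (auto simp: admissible_weight_def)
  show "0 < w x powr (1 / (2 * p))" for x using w_pos[of x] by simp
  show "w (- x) powr (1 / (2 * p)) = w x powr (1 / (2 * p))" for x using w by (simp add: admissible_weight_def)
  fix m
  have a: "0 < 1 / (2 * p)" using p by simp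
  obtain B where B: "\<And>x. (1 + norm x) ^ m \<le> B * w x powr (1 / (2 * p))"
    by (rule admissible_weight_powr_bound[OF w a, where j = m], rule that)
  then have "(1 + norm x) ^ m / w x powr (1 / (2 * p)) \<le> B" for x
    using w_pos[of x] by (simp add: pos_divide_le_eq)
  then show "bdd_above (range (\<lambda>x. (1 + norm x) ^ m / w x powr (1 / (2 * p))))"
    by (intro bdd_aboveI2)
qed

text \<open>With \<open>v = w powr (1 / (2 * p))\<close>, \<open>v powr p\<close> is
  \<open>w powr (1 / 2)\<close>, so half of the weight remains to absorb polynomial factors. At each
  point \<open>norm (f x) * v x\<close> is either at most the integrable \<open>decay x\<close> or
  larger; in the second case the missing power \<open>p - 1\<close> is supplied at the price of
  \<open>decay x powr (1 - p)\<close>, which grows polynomially and is below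
  \<open>B * w x powr (1 / 2)\<close>.\<close>

lemma Lpw_subset_root:
  "(Lpw p w :: ('a \<Rightarrow> 'k::{real_normed_field, second_countable_topology}) set) \<subseteq> Lpw 1 (\<lambda>x. w x powr (1 / (2 * p)))"
proof
  fix f :: "'a \<Rightarrow> 'k" assume f: "f \<in> Lpw p w"
  then have fm[measurable]: "f \<in> borel_measurable lebesgue" and fi: "integrable lebesgue (\<lambda>x. norm (f x) powr p * w x)"
    by (auto simp: Lpw_def)
  define v where "v x = w x powr (1 / (2 * p))" for x
  have v: "0 < v x" for x using w_pos by (simp add: v_def)
  have vm[measurable]: "v \<in> borel_measurable lebesgue"
    using admissible_weight_root by (intro continuous_lebesgue_measurable) (simp add: admissible_weight_def v_def)
  \<comment> \<open>An integer exponent for which \<open>(1 + norm x) ^ q\<close> dominates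
    \<open>decay x powr (1 - p)\<close>.\<close>
  define q where "q = nat \<lceil>(p - 1) * real (DIM('a) + 2)\<rceil>"
  obtain B where B: "0 < B" "\<And>x. (1 + norm x) ^ q \<le> B * w x powr (1 / 2)"
    by (rule admissible_weight_powr_bound[OF w, where a = "1 / 2" and j = q], simp, rule that)
  have "norm (f x) * v x \<le> decay x + B * (norm (f x) powr p * w x)" for x
  proof (cases "norm (f x) * v x \<le> decay x")
    case True
    then show ?thesis using B(1) w_pos[of x] by (simp add: add_increasing2)
  next
    case False
    have fpos: "0 < norm (f x)" using False decay_pos[of x] by (cases "f x = 0") auto
    have "1 \<le> B * (decay x powr (p - 1) * w x powr (1 / 2))"
    proof -
      have n1: "1 \<le> 1 + norm x" by simp
      have "1 / decay x = (1 + norm x) powr real (DIM('a) + 2)"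
        using powr_realpow[of "1 + norm x" "DIM('a) + 2"] by (simp add: decay_def add_pos_nonneg)
      then have "(1 / decay x) powr (p - 1) = (1 + norm x) powr (real (DIM('a) + 2) * (p - 1))"
        by (simp only: powr_powr)
      also have "\<dots> \<le> (1 + norm x) powr real q"
        using n1 real_nat_ceiling_ge[of "(p - 1) * real (DIM('a) + 2)"]
        by (intro powr_mono) (simp_all only: q_def mult.commute)
      also have "\<dots> = (1 + norm x) ^ q" by (simp add: powr_realpow add_pos_nonneg)
      also have "\<dots> \<le> B * w x powr (1 / 2)" by (rule B(2))
      finally have "(1 / decay x) powr (p - 1) * decay x powr (p - 1) \<le> B * w x powr (1 / 2) * decay x powr (p - 1)"
        by (rule mult_right_mono) simp
      moreover have "(1 / decay x) powr (p - 1) * decay x powr (p - 1) = 1"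
        using decay_pos[of x] by (simp flip: powr_mult)
      ultimately show ?thesis by (simp only: mult_ac)
    qed
    also have "\<dots> \<le> B * ((norm (f x) * v x) powr (p - 1) * w x powr (1 / 2))"
      using False B(1) p decay_pos[of x] by (intro mult_left_mono mult_right_mono powr_mono2) auto
    finally have "norm (f x) * v x \<le> norm (f x) * v x * (B * ((norm (f x) * v x) powr (p - 1) * w x powr (1 / 2)))"
      using fpos v[of x] by (simp add: mult_left_le)
    also have "\<dots> = B * ((norm (f x) * v x) powr p * w x powr (1 / 2))"
      using fpos v[of x] by (simp add: powr_diff)
    also have "\<dots> = B * (norm (f x) powr p * w x)"
    proof -
      have "v x powr p * w x powr (1 / 2) = w x"
        using p w_pos[of x] by (simp add: v_def powr_powr flip: powr_add)
      then show ?thesis by (simp add: powr_mult mult.assoc)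
    qed
    finally show ?thesis using decay_pos[of x] by linarith
  qed
  then have le: "norm (norm (f x) powr 1 * v x) \<le> norm (decay x + B * (norm (f x) powr p * w x))" for x
    using v[of x] B(1) w_pos[of x] decay_pos[of x] by (simp add: abs_mult less_imp_le add_nonneg_nonneg)
  have "integrable lebesgue (\<lambda>x. norm (f x) powr 1 * v x)"
  proof (rule Bochner_Integration.integrable_bound)
    show "integrable lebesgue (\<lambda>x. decay x + B * (norm (f x) powr p * w x))"
      using fi integrable_inverse_power[where 'a='a] by (simp add: decay_def)
  qed (use le in auto)
  then show "f \<in> Lpw 1 (\<lambda>x. w x powr (1 / (2 * p)))" by (simp add: Lpw_def v_def)
qed

end

theorem theorem1p1:
  fixes p :: real and w :: "'a::euclidean_space \<Rightarrow> real"
  assumes "1 \<le> p" and "admissible_weight w"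
  shows
    "(DIM('a) = 1 \<longrightarrow>
       (\<exists>e :: nat \<Rightarrow> 'a \<Rightarrow> real. schauder_basis_Lpw p w e \<and> heat_decay_property p w e) \<and>
       (\<exists>e :: nat \<Rightarrow> 'a \<Rightarrow> complex. schauder_basis_Lpw p w e \<and> heat_decay_property p w e)) \<and>
     (DIM('a) > 1 \<longrightarrow>
       (\<exists>w'. admissible_weight w' \<and>
          (Lpw p w :: ('a \<Rightarrow> real) set) \<subseteq> Lpw 1 w' \<and>
          (\<exists>e :: nat \<Rightarrow> 'a \<Rightarrow> real. schauder_basis_Lpw 1 w' e \<and> heat_decay_property 1 w' e)) \<and>
       (\<exists>w'. admissible_weight w' \<and>
          (Lpw p w :: ('a \<Rightarrow> complex) set) \<subseteq> Lpw 1 w' \<and>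
          (\<exists>e :: nat \<Rightarrow> 'a \<Rightarrow> complex. schauder_basis_Lpw 1 w' e \<and> heat_decay_property 1 w' e)))"
proof -
  interpret weighted_space p w by standard (fact assms)+
  let ?w' = "\<lambda>x. w x powr (1 / (2 * p))"
  interpret root: weighted_space 1 ?w'
    by standard (use admissible_weight_root in simp_all)
  show ?thesis
    using schauder_basis_with_heat_decay[where 'k=real] schauder_basis_with_heat_decay[where 'k=complex]
      root.schauder_basis_with_heat_decay[where 'k=real] root.schauder_basis_with_heat_decay[where 'k=complex]
      admissible_weight_root Lpw_subset_root[where 'k=real] Lpw_subset_root[where 'k=complex]
    by blast
qed

end
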